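(* Let $\mathfrak{F}$ be a fractal curve and $J$ its rise function regarded as a function of the points of $\mathfrak{F}$, as described in the context. Let $\beta$ be a real number and $n$ the integer with $n\alpha-\alpha\le\beta<n\alpha$, and let $M$ be the fractal Mellin transform of $f$. Then the fractal Mellin transform of the Riemann-Liouville derivative ${}_{0}\mathcal{D}_{\theta}^{\beta}f$ is $$\mathcal{M}\big[{}_{0}\mathcal{D}_{\theta}^{\beta}f(\theta)\big]=\frac{\Gamma(1-J(s)+\beta)}{\Gamma(1-J(s))}\,M(J(s)-\beta).$$
   Context: Fractal curve. $\mathfrak{F}\subset\mathbb{R}^{d}$ is a fractal curve with parametrization $\mathbf{v}$, whose parameter $z$ lies in an interval $[a_0,b_0]\subset\mathbb{R}$, and $1\le\alpha\le d$. For $[c_1,c_2]\subset[a_0,b_0]$ the mass function is $$\zeta^{\alpha}(\mathfrak{F},c_1,c_2)=\lim_{\delta\to0}\ \inf_{|P|\le\delta}\ \sum_{i=0}^{N-1}\frac{|\mathbf{v}(z_{i+1})-\mathbf{v}(z_i)|^{\alpha}}{\Gamma(\alpha+1)},$$ the infimum being over subdivisions $P=\{c_1=z_0,\dots,z_N=c_2\}$ with mesh $|P|=\max_i(z_{i+1}-z_i)\le\delta$; $|\cdot|$ on vectors is the Euclidean norm and $\Gamma$ is the gamma function. The rise function is $S_{\mathfrak{F}}^{\alpha}(z)=\zeta^{\alpha}(\mathfrak{F},q_0,z)$ for $z\ge q_0$ and $S_{\mathfrak{F}}^{\alpha}(z)=-\zeta^{\alpha}(\mathfrak{F},z,q_0)$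 for $z<q_0$, where $q_0$ is a fixed number. For $\theta=\mathbf{v}(z)$ one writes $J(\theta)=S_{\mathfrak{F}}^{\alpha}(z)$. $\mathfrak{F}^{\alpha}$-derivative. $$D_{\mathfrak{F}}^{\alpha}f(\theta)=\lim_{\theta'\to\theta,\ \theta'\in\mathfrak{F}}\frac{f(\theta')-f(\theta)}{J(\theta')-J(\theta)},$$ the limit being the fractal limit (taken along $\mathfrak{F}$); $(D_{\mathfrak{F}}^{\alpha})^{n}$ is its $n$-fold iterate, and $C^{n}(\mathfrak{F})$ is the set of functions on $\mathfrak{F}$ that are $n$ times $\mathfrak{F}^{\alpha}$-differentiable with continuous $n$-th derivative. $\mathfrak{F}^{\alpha}$-integral. $D(c_1,c_2)$ denotes the section of $\mathfrak{F}$ between $\mathbf{v}(c_1)$ and $\mathbf{v}(c_2)$, and $C(z_i,z_{i+1})$ the part of $\mathfrak{F}$ between $\mathbf{v}(z_i)$ and $\mathbf{v}(z_{i+1})$. Then $$\int_{D(c_1,c_2)}f(\theta)\,d_{\mathfrak{F}}^{\alpha}\theta=\sup_{P}\sum_{i}\inf_{\theta\in C(z_i,z_{i+1})}f(\theta)\,(J(\theta_{i+1})-J(\theta_i))=\inf_{P}\sum_{i}\sup_{\theta\in C(z_i,z_{i+1})}f(\theta)\,(J(\theta_{i+1})-J(\theta_i)),$$ where $\theta_i=\mathbf{v}(z_i)$, $P$ ranges over the subdivisions of $[c_1,c_2]$, and the integral is defined when the two expressions agree. $D(0,\theta)$ is the section of the curve from $0$ to $\theta$, and $D(0,\infty)$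 the section starting at $0$ and continuing indefinitely. Left-sided Riemann-Liouville derivative of order $\beta\in\mathbb{R}$ of $f\in C^{n}(\mathfrak{F})$, based at $0$, where $n\alpha-\alpha\le\beta<n\alpha$: $${}_{0}\mathcal{D}_{\theta}^{\beta}f(\theta)=\frac{1}{\Gamma(n-\beta)}(D_{\mathfrak{F}}^{\alpha})^{n}\int_{D(0,\theta)}\frac{f(\tau)}{(J(\theta)-J(\tau))^{-n+\beta+1}}\,d_{\mathfrak{F}}^{\alpha}\tau .$$ Fractal Mellin transform. $$M(J(s))=\mathcal{M}[f(\theta)]=\int_{D(0,\infty)}f(\theta)\,J(\theta)^{J(s)-1}\,d_{\mathfrak{F}}^{\alpha}\theta,$$ where $J(s)$ denotes the complex transform variable, $\lambda_1<\mathrm{Re}\,J(s)<\lambda_2$; $M(J(s)-\beta)$ is the same integral with $J(s)$ replaced by $J(s)-\beta$. The transform exists if $f$ is fractal piecewise continuous in every closed section $D(a,b)\subset D(0,\infty)$ and $\int_{D(0,1)}|f(\theta)|J(\theta)^{\lambda_1-1}d_{\mathfrak{F}}^{\alpha}\theta<\infty$, $\int_{D(1,\infty)}|f(\theta)|J(\theta)^{\lambda_2-1}d_{\mathfrak{F}}^{\alpha}\theta<\infty$.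
   Formalization: Proved assuming J vanishes at the base point 0 and tends to infinity along the curve (boundary terms otherwise break the formula), the derivative and its Mellin transform at J(s) exist, J(s)-β lies in the strip of M, and 1-J(s)+β is not a pole of Γ. *)

theory Defs
  imports "HOL-Analysis.Analysis"
begin

subsection \<open>Mass function and rise function\<close>

definition subdivision :: "real \<Rightarrow> real \<Rightarrow> (nat \<Rightarrow> real) \<Rightarrow> nat \<Rightarrow> bool" where
  "subdivision c1 c2 z N \<longleftrightarrow> z 0 = c1 \<and> z N = c2 \<and> (\<forall>i<N. z i < z (Suc i))"

text \<open>The limit is taken in the extended reals, where it always exists (the infimum grows as
  the mesh bound shrinks), so that finiteness of the mass can be stated as a property.\<close>

definition curve_mass :: "(real \<Rightarrow> 'a::euclidean_space) \<Rightarrow> real \<Rightarrow> real \<Rightarrow> real \<Rightarrow> ereal" where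
  "curve_mass v \<alpha> c1 c2 =
     Lim (at_right (0::real)) (\<lambda>\<delta>.
       INF (z, N) \<in> {(z, N). subdivision c1 c2 z N \<and> (\<forall>i<N. z (Suc i) - z i \<le> \<delta>)}.
         ereal (\<Sum>i<N. norm (v (z (Suc i)) - v (z i)) powr \<alpha> / Gamma (\<alpha> + 1)))"

definition rise_fun :: "(real \<Rightarrow> 'a::euclidean_space) \<Rightarrow> real \<Rightarrow> real \<Rightarrow> real \<Rightarrow> real" where
  "rise_fun v \<alpha> q0 z =
     (if q0 \<le> z then real_of_ereal (curve_mass v \<alpha> q0 z)
      else - real_of_ereal (curve_mass v \<alpha> z q0))"

text \<open>Curves are parametrized over a half-line \<open>{a0..}\<close>, so that the section from a point of the
  curve to infinity makes sense. Finite mass of bounded sections makes the rise function real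
  valued; its strict monotonicity makes the rise an injective function of the points, without
  which the difference quotients below are undefined.\<close>

definition fractal_curve ::
    "(real \<Rightarrow> 'a::euclidean_space) \<Rightarrow> real \<Rightarrow> real \<Rightarrow> real \<Rightarrow> bool" where
  "fractal_curve v a0 \<alpha> q0 \<longleftrightarrow>
     1 \<le> \<alpha> \<and> \<alpha> \<le> real DIM('a) \<and> a0 \<le> q0 \<and>
     continuous_on {a0..} v \<and> inj_on v {a0..} \<and>
     (\<forall>c1 c2. a0 \<le> c1 \<and> c1 \<le> c2 \<longrightarrow> curve_mass v \<alpha> c1 c2 < \<infinity>) \<and>
     strict_mono_on {a0..} (rise_fun v \<alpha> q0)"

abbreviation curve_points :: "(real \<Rightarrow> 'a) \<Rightarrow> real \<Rightarrow> 'a set" where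
  "curve_points v a0 \<equiv> v ` {a0..}"

definition curve_param :: "(real \<Rightarrow> 'a) \<Rightarrow> real \<Rightarrow> 'a \<Rightarrow> real" where
  "curve_param v a0 = the_inv_into {a0..} v"

text \<open>The rise as a function of the points of the curve.\<close>

definition rise_pt ::
    "(real \<Rightarrow> 'a::euclidean_space) \<Rightarrow> real \<Rightarrow> real \<Rightarrow> real \<Rightarrow> 'a \<Rightarrow> real" where
  "rise_pt v a0 \<alpha> q0 \<theta> = rise_fun v \<alpha> q0 (curve_param v a0 \<theta>)"


subsection \<open>Fractal derivative\<close>

definition frac_quot :: "('a \<Rightarrow> real) \<Rightarrow> ('a \<Rightarrow> real) \<Rightarrow> 'a \<Rightarrow> 'a \<Rightarrow> real" where
  "frac_quot J f \<theta> \<theta>' = (f \<theta>' - f \<theta>) / (J \<theta>' - J \<theta>)"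

definition frac_differentiable_at ::
    "'a::euclidean_space set \<Rightarrow> ('a \<Rightarrow> real) \<Rightarrow> ('a \<Rightarrow> real) \<Rightarrow> 'a \<Rightarrow> bool" where
  "frac_differentiable_at F J f \<theta> \<longleftrightarrow> (\<exists>l. (frac_quot J f \<theta> \<longlongrightarrow> l) (at \<theta> within F))"

definition frac_deriv ::
    "'a::euclidean_space set \<Rightarrow> ('a \<Rightarrow> real) \<Rightarrow> ('a \<Rightarrow> real) \<Rightarrow> 'a \<Rightarrow> real" where
  "frac_deriv F J f \<theta> = Lim (at \<theta> within F) (frac_quot J f \<theta>)"

definition frac_C ::
    "'a::euclidean_space set \<Rightarrow> ('a \<Rightarrow> real) \<Rightarrow> nat \<Rightarrow> ('a \<Rightarrow> real) set" where
  "frac_C F J n =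
     {f. (\<forall>k<n. \<forall>\<theta>\<in>F. frac_differentiable_at F J ((frac_deriv F J ^^ k) f) \<theta>) \<and>
         continuous_on F ((frac_deriv F J ^^ n) f)}"


subsection \<open>Fractal integral\<close>

definition curve_section :: "(real \<Rightarrow> 'a) \<Rightarrow> real \<Rightarrow> real \<Rightarrow> 'a set" where
  "curve_section v c1 c2 = v ` {c1..c2}"

definition lower_frac_integral ::
    "(real \<Rightarrow> 'a) \<Rightarrow> ('a \<Rightarrow> real) \<Rightarrow> ('a \<Rightarrow> real) \<Rightarrow> real \<Rightarrow> real \<Rightarrow> real" where
  "lower_frac_integral v J f c1 c2 =
     (SUP (z, N) \<in> {(z, N). subdivision c1 c2 z N}.
        \<Sum>i<N. (INF \<theta>\<in>curve_section v (z i) (z (Suc i)). f \<theta>) * (J (v (z (Suc i))) - J (v (z i))))"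

definition upper_frac_integral ::
    "(real \<Rightarrow> 'a) \<Rightarrow> ('a \<Rightarrow> real) \<Rightarrow> ('a \<Rightarrow> real) \<Rightarrow> real \<Rightarrow> real \<Rightarrow> real" where
  "upper_frac_integral v J f c1 c2 =
     (INF (z, N) \<in> {(z, N). subdivision c1 c2 z N}.
        \<Sum>i<N. (SUP \<theta>\<in>curve_section v (z i) (z (Suc i)). f \<theta>) * (J (v (z (Suc i))) - J (v (z i))))"

text \<open>Boundedness is required because suprema and infima of unbounded sets of reals are
  unspecified.\<close>

definition frac_integrable ::
    "(real \<Rightarrow> 'a) \<Rightarrow> ('a \<Rightarrow> real) \<Rightarrow> ('a \<Rightarrow> real) \<Rightarrow> real \<Rightarrow> real \<Rightarrow> bool" where
  "frac_integrable v J f c1 c2 \<longleftrightarrow>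
     bounded (f ` curve_section v c1 c2) \<and>
     lower_frac_integral v J f c1 c2 = upper_frac_integral v J f c1 c2"

definition frac_integral ::
    "(real \<Rightarrow> 'a) \<Rightarrow> ('a \<Rightarrow> real) \<Rightarrow> ('a \<Rightarrow> real) \<Rightarrow> real \<Rightarrow> real \<Rightarrow> real" where
  "frac_integral v J f c1 c2 = lower_frac_integral v J f c1 c2"

text \<open>Integrals over a section from \<open>v c1\<close> to \<open>v c2\<close> whose integrand may be singular at either end,
  or with \<open>c2 = \<infinity>\<close>, are limits of integrals over the compact sections strictly between the ends.\<close>

definition improper_ends :: "real \<Rightarrow> ereal \<Rightarrow> (real \<times> real) filter" where
  "improper_ends c1 c2 = at_right c1 \<times>\<^sub>F filtercomap ereal (at_left c2)"

definition frac_improper_integrable ::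
    "(real \<Rightarrow> 'a) \<Rightarrow> ('a \<Rightarrow> real) \<Rightarrow> ('a \<Rightarrow> real) \<Rightarrow> real \<Rightarrow> ereal \<Rightarrow> bool" where
  "frac_improper_integrable v J f c1 c2 \<longleftrightarrow>
     (\<forall>x y. c1 < x \<and> x \<le> y \<and> ereal y < c2 \<longrightarrow> frac_integrable v J f x y) \<and>
     (\<exists>I. ((\<lambda>(x, y). frac_integral v J f x y) \<longlongrightarrow> I) (improper_ends c1 c2))"

definition frac_improper_integral ::
    "(real \<Rightarrow> 'a) \<Rightarrow> ('a \<Rightarrow> real) \<Rightarrow> ('a \<Rightarrow> real) \<Rightarrow> real \<Rightarrow> ereal \<Rightarrow> real" where
  "frac_improper_integral v J f c1 c2 =
     Lim (improper_ends c1 c2) (\<lambda>(x, y). frac_integral v J f x y)"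


subsection \<open>Riemann-Liouville derivative\<close>

definition RL_integrand ::
    "('a \<Rightarrow> real) \<Rightarrow> nat \<Rightarrow> real \<Rightarrow> ('a \<Rightarrow> real) \<Rightarrow> 'a \<Rightarrow> 'a \<Rightarrow> real" where
  "RL_integrand J n \<beta> f \<theta> \<tau> = f \<tau> / (J \<theta> - J \<tau>) powr (- real n + \<beta> + 1)"

definition RL_integral ::
    "(real \<Rightarrow> 'a) \<Rightarrow> real \<Rightarrow> ('a \<Rightarrow> real) \<Rightarrow> nat \<Rightarrow> real \<Rightarrow> ('a \<Rightarrow> real) \<Rightarrow> 'a \<Rightarrow> real" where
  "RL_integral v a0 J n \<beta> f \<theta> =
     frac_improper_integral v J (RL_integrand J n \<beta> f \<theta>) 0 (ereal (curve_param v a0 \<theta>))"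

definition RL_deriv ::
    "(real \<Rightarrow> 'a::euclidean_space) \<Rightarrow> real \<Rightarrow> ('a \<Rightarrow> real) \<Rightarrow> nat \<Rightarrow> real \<Rightarrow> ('a \<Rightarrow> real) \<Rightarrow> 'a \<Rightarrow> real"
  where
  "RL_deriv v a0 J n \<beta> f \<theta> =
     1 / Gamma (real n - \<beta>) *
     (frac_deriv (curve_points v a0) J ^^ n) (RL_integral v a0 J n \<beta> f) \<theta>"

text \<open>The derivative is defined at all points after the base point \<open>v 0\<close>. At \<open>v 0\<close> itself it
  typically does not exist, even for smooth \<open>f\<close>.\<close>

definition RL_differentiable ::
    "(real \<Rightarrow> 'a::euclidean_space) \<Rightarrow> real \<Rightarrow> ('a \<Rightarrow> real) \<Rightarrow> nat \<Rightarrow> real \<Rightarrow> ('a \<Rightarrow> real) \<Rightarrow> bool"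
  where
  "RL_differentiable v a0 J n \<beta> f \<longleftrightarrow>
     (\<forall>z>0. frac_improper_integrable v J (RL_integrand J n \<beta> f (v z)) 0 (ereal z)) \<and>
     (\<forall>z>0. \<forall>k<n. frac_differentiable_at (curve_points v a0) J
        ((frac_deriv (curve_points v a0) J ^^ k) (RL_integral v a0 J n \<beta> f)) (v z))"


subsection \<open>Mellin transform\<close>

text \<open>The argument \<open>s\<close> is the complex transform variable, often written \<open>J(s)\<close>.\<close>

definition mellin_integrand :: "('a \<Rightarrow> real) \<Rightarrow> ('a \<Rightarrow> real) \<Rightarrow> complex \<Rightarrow> 'a \<Rightarrow> complex" where
  "mellin_integrand J f s \<theta> = complex_of_real (f \<theta>) * complex_of_real (J \<theta>) powr (s - 1)"

definition mellin_convergent ::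
    "(real \<Rightarrow> 'a) \<Rightarrow> ('a \<Rightarrow> real) \<Rightarrow> ('a \<Rightarrow> real) \<Rightarrow> complex \<Rightarrow> bool" where
  "mellin_convergent v J f s \<longleftrightarrow>
     frac_improper_integrable v J (\<lambda>\<theta>. Re (mellin_integrand J f s \<theta>)) 0 \<infinity> \<and>
     frac_improper_integrable v J (\<lambda>\<theta>. Im (mellin_integrand J f s \<theta>)) 0 \<infinity>"

definition mellin ::
    "(real \<Rightarrow> 'a) \<Rightarrow> ('a \<Rightarrow> real) \<Rightarrow> ('a \<Rightarrow> real) \<Rightarrow> complex \<Rightarrow> complex" where
  "mellin v J f s =
     Complex (frac_improper_integral v J (\<lambda>\<theta>. Re (mellin_integrand J f s \<theta>)) 0 \<infinity>)
             (frac_improper_integral v J (\<lambda>\<theta>. Im (mellin_integrand J f s \<theta>)) 0 \<infinity>)"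

definition frac_piecewise_continuous ::
    "(real \<Rightarrow> 'a::euclidean_space) \<Rightarrow> ('a \<Rightarrow> real) \<Rightarrow> real \<Rightarrow> real \<Rightarrow> bool" where
  "frac_piecewise_continuous v f a b \<longleftrightarrow>
     (\<exists>z N. subdivision a b z N \<and>
        (\<forall>i<N. continuous_on (v ` {z i<..<z (Suc i)}) f \<and>
               (\<exists>l. ((f \<circ> v) \<longlongrightarrow> l) (at_right (z i))) \<and>
               (\<exists>l. ((f \<circ> v) \<longlongrightarrow> l) (at_left (z (Suc i))))))"

text \<open>The existence conditions guaranteeing absolute convergence of the transform of \<open>f\<close> on the
  strip \<open>\<sigma>1 < Re s < \<sigma>2\<close>.\<close>

definition mellin_strip ::
    "(real \<Rightarrow> 'a::euclidean_space) \<Rightarrow> ('a \<Rightarrow> real) \<Rightarrow> ('a \<Rightarrow> real) \<Rightarrow> real \<Rightarrow> real \<Rightarrow> bool" where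
  "mellin_strip v J f \<sigma>1 \<sigma>2 \<longleftrightarrow>
     (\<forall>a b. 0 < a \<and> a < b \<longrightarrow> frac_piecewise_continuous v f a b) \<and>
     frac_improper_integrable v J (\<lambda>\<theta>. \<bar>f \<theta>\<bar> * J \<theta> powr (\<sigma>1 - 1)) 0 1 \<and>
     frac_improper_integrable v J (\<lambda>\<theta>. \<bar>f \<theta>\<bar> * J \<theta> powr (\<sigma>2 - 1)) 1 \<infinity>"

end

theory Submission
  imports Defs
begin

text \<open>Measured by its rise \<open>u = J(\<theta>)\<close>, the curve from \<open>v 0\<close> on becomes the half-line \<open>[0, \<infinity>)\<close>. The rise is
  continuous (\<open>continuous_on_rise_fun\<close>): the mass is additive because a subdivision can be cut at any
  point at small cost, and it is small on short intervals. In the variable \<open>u\<close> a fractal derivative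
  is an ordinary derivative (\<open>frac_deriv_rise\<close>) and a fractal integral is an ordinary integral
  (\<open>frac_integrable_has_integral\<close>), so the claim is one about a continuous function \<open>g\<close> on the
  half-line. With \<open>\<gamma> = n - \<beta>\<close> and \<open>w = s - \<beta>\<close> it says that the Mellin transform at \<open>s\<close> of the \<open>n\<close>-th
  derivative of \<open>\<integral>\<^sub>0\<^sup>u g(\<tau>) (u - \<tau>)\<^sup>\<gamma>\<^sup>-\<^sup>1 d\<tau>\<close> is \<open>\<Gamma>(\<gamma>) \<Gamma>(1 - w) / \<Gamma>(1 - s)\<close> times the Mellin
  transform of \<open>g\<close> at \<open>w\<close>.

  For \<open>n = 0\<close> and \<open>Re w < 1\<close> this is Fubini's theorem and the Beta integral
  (\<open>riesz_mellin_absolute\<close>). Two difficulties remain. First, the transform of the derivative need only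
  converge conditionally, and nothing is known about the lower derivatives at the ends of the
  half-line, so partial integration is not available. The remedy is to compare the function with
  its dilation by a factor \<open>\<rho>\<close>: the difference \<open>D(\<rho> u) - D(u)\<close> of a derivative is an integral of the
  next derivative, hence has a conditionally convergent transform, and it is again a derivative, of
  an order lower by one, of the Riemann-Liouville integral of a combination of \<open>g(\<rho> u)\<close> and \<open>g(u)\<close>.
  This reduces \<open>n\<close> to \<open>0\<close> (\<open>dilation_step\<close>). Secondly, \<open>Re w\<close> may be at least \<open>1\<close>, where the double
  integral diverges. The assumed convergence then forces the total integral of \<open>g\<close> to vanish
  (\<open>moment_vanishes\<close>), and passing from \<open>g\<close> to its primitive raises \<open>n\<close> by one and lowers \<open>w\<close> by one.
  The two reductions together give the identity for all \<open>w\<close> other than the poles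
  (\<open>riesz_derivative_mellin\<close>).

  If \<open>\<beta> \<ge> n\<close>, which happens only for \<open>\<alpha> > 1\<close>, the kernel is not integrable and convergence of the
  Riemann-Liouville integral forces \<open>f\<close> to vanish on the section after \<open>v 0\<close>, so both
  sides are zero.\<close>

section \<open>The Beta integral with a complex exponent\<close>

lemma set_borel_measurable_if_continuous:
  fixes f :: "'a::topological_space \<Rightarrow> 'b::real_normed_vector"
  assumes "A \<in> sets borel" "continuous_on A f"
  shows "set_borel_measurable borel A f"
  unfolding set_borel_measurable_def by (rule borel_measurable_continuous_on_indicator[OF assms])

lemma set_integrable_lborel_if_absolutely:
  fixes f :: "real \<Rightarrow> 'b::euclidean_space"
  assumes "f absolutely_integrable_on S" "set_borel_measurable borel S f"
  shows "set_integrable lborel S f"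
  using assms unfolding set_integrable_def set_borel_measurable_def
  by (subst (asm) integrable_completion) auto

lemma halfline_integral_scale:
  fixes f :: "real \<Rightarrow> 'b::{banach,second_countable_topology}"
  assumes "c > 0"
  shows "set_integrable lborel {0<..} (\<lambda>u. f (c * u)) \<longleftrightarrow> set_integrable lborel {0<..} f"
    and "(LINT u:{0<..}|lborel. f (c * u)) = (LINT u:{0<..}|lborel. f u) /\<^sub>R c"
proof -
  have ind: "indicat_real {0<..} (0 + c * u) = indicat_real {0<..} u" for u
    using assms by (auto simp: indicator_def zero_less_mult_iff)
  show "set_integrable lborel {0<..} (\<lambda>u. f (c * u)) \<longleftrightarrow> set_integrable lborel {0<..} f"
    unfolding set_integrable_def
    using lborel_integrable_real_affine_iff[of c "\<lambda>u. indicator {0<..} u *\<^sub>R f u" 0] assms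
    by (simp only: ind) simp
  show "(LINT u:{0<..}|lborel. f (c * u)) = (LINT u:{0<..}|lborel. f u) /\<^sub>R c"
    unfolding set_lebesgue_integral_def
    using lborel_integral_real_affine[of c "\<lambda>u. indicator {0<..} u *\<^sub>R f u" 0] assms
    by (simp only: ind) simp
qed

lemma Gamma_set_integrable:
  assumes "Re z > 0"
  shows "set_integrable lborel {0<..} (\<lambda>t. complex_of_real t powr (z - 1) * of_real (exp (- t)))"
    and "(LINT t:{0<..}|lborel. complex_of_real t powr (z - 1) * of_real (exp (- t))) = Gamma z"
proof -
  have eq: "(\<lambda>t. complex_of_real t powr (z - 1) / of_real (exp t)) =
            (\<lambda>t. complex_of_real t powr (z - 1) * of_real (exp (- t)))"
    by (simp add: exp_minus field_simps)
  have "set_borel_measurable borel {0<..} (\<lambda>t. complex_of_real t powr (z - 1) * of_real (exp (- t)))"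
    by (rule set_borel_measurable_if_continuous) (auto intro!: continuous_intros)
  then show *: "set_integrable lborel {0<..} (\<lambda>t. complex_of_real t powr (z - 1) * of_real (exp (- t)))"
    using absolutely_integrable_Gamma_integral'[OF assms] unfolding eq
    by (rule set_integrable_lborel_if_absolutely[rotated])
  show "(LINT t:{0<..}|lborel. complex_of_real t powr (z - 1) * of_real (exp (- t))) = Gamma z"
    using Gamma_integral_complex'[OF assms] unfolding eq
    by (subst set_borel_integral_eq_integral(2)[OF *]) (rule integral_unique)
qed

lemma norm_powr_of_real:
  assumes "t > 0"
  shows "norm (complex_of_real t powr z) = t powr Re z"
  using assms by (simp add: norm_powr_real_powr)

lemma Beta_set_integrable:
  assumes a: "Re a > 0" and b: "b > 0"
  shows "set_integrable lborel {0<..<1} (\<lambda>t. complex_of_real t powr (a - 1) * of_real ((1 - t) powr (b - 1)))"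
proof -
  have 1: "set_integrable lborel {0<..<1} (\<lambda>t. t powr (Re a - 1) * (1 - t) powr (b - 1))"
    by (rule set_integrable_subset[OF integrable_Beta[OF a b]]) auto
  have m: "set_borel_measurable borel {0<..<1} (\<lambda>t. complex_of_real t powr (a - 1) * of_real ((1 - t) powr (b - 1)))"
    by (rule set_borel_measurable_if_continuous) (auto intro!: continuous_intros)
  show ?thesis
    by (rule set_integrable_bound[OF 1]) (use m in \<open>auto simp: set_borel_measurable_def norm_mult norm_powr_of_real\<close>)
qed

text \<open>Fubini's theorem for \<open>t\<^sup>a\<^sup>-\<^sup>1 (u - t)\<^sup>b\<^sup>-\<^sup>1 e\<^sup>-\<^sup>u\<close> on the wedge \<open>0 < t < u\<close>:
  integrating first over \<open>u\<close> gives \<open>\<Gamma>(a) \<Gamma>(b)\<close>, while integrating first over \<open>t\<close> gives, by the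
  scaling \<open>t \<mapsto> u t\<close>, the Beta integral times \<open>\<Gamma>(a + b)\<close>.\<close>
theorem Beta_integral_complex:
  assumes a: "Re a > 0" and b: "b > 0"
  shows "(LINT t:{0<..<1}|lborel. complex_of_real t powr (a - 1) * of_real ((1 - t) powr (b - 1))) = Beta a (of_real b)"
    (is "?B = _")
proof -
  define p where "p c t = indicat_real {0<..} t *\<^sub>R (complex_of_real t powr (c - 1) * of_real (exp (- t)))" for c t
  define k where "k t = indicat_real {0<..<1} t *\<^sub>R (complex_of_real t powr (a - 1) * of_real ((1 - t) powr (b - 1)))" for t
  define F where "F = (\<lambda>(t, u). p a t * p (of_real b) (- t + 1 * u))"
  have p: "integrable lborel (p c)" "integral\<^sup>L lborel (p c) = Gamma c" if "Re c > 0" for c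
    using Gamma_set_integrable[OF that] by (simp_all add: p_def[abs_def] set_integrable_def set_lebesgue_integral_def)
  have b': "Re (complex_of_real b) > 0" using b by simp
  note pa = p[OF a] and pb = p[OF b']
  have [measurable]: "p a \<in> borel_measurable borel" "p (of_real b) \<in> borel_measurable borel"
    using pa(1) pb(1) by auto
  have Fm: "F \<in> borel_measurable (lborel \<Otimes>\<^sub>M lborel)" unfolding F_def by measurable
  have i1: "integrable lborel (\<lambda>u. F (t, u))" for t
    unfolding F_def using lborel_integrable_real_affine[OF pb(1), of 1 "-t"]
    by (simp only: prod.case) (intro integrable_mult_right, simp)
  have i2: "(LINT u|lborel. F (t, u)) = p a t * Gamma (of_real b)" for t
    unfolding F_def prod.case integral_mult_right_zero pb(2)[symmetric]
    using lborel_integral_real_affine[of 1 "p (of_real b)" "-t"] by simp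
  have i3: "(LINT u|lborel. norm (F (t, u))) = norm (p a t) * (LINT u|lborel. norm (p (of_real b) u))" for t
    unfolding F_def prod.case norm_mult integral_mult_right_zero
    using lborel_integral_real_affine[of 1 "\<lambda>u. norm (p (of_real b) u)" "-t"] by simp
  have Fi: "integrable (lborel \<Otimes>\<^sub>M lborel) (case_prod (\<lambda>t u. F (t, u)))"
    using lborel_pair.Fubini_integrable[OF Fm] i1 by (auto simp: i3 intro!: integrable_mult_left integrable_norm pa)
  have inner: "(LINT t|lborel. F (t, u)) = ?B * p (a + of_real b) u" for u
  proof (cases "u > 0")
    case False
    then have "F (t, u) = 0" for t by (auto simp: F_def p_def indicator_def)
    with False show ?thesis by (simp add: p_def)
  next
    case True
    have "F (0 + u * t, u) = (complex_of_real u powr (a + of_real b - 2) * of_real (exp (- u))) * k t" for t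
    proof (cases "t \<in> {0<..<1}")
      case False then show ?thesis using True by (auto simp: F_def p_def k_def indicator_def zero_less_mult_iff)
    next
      case True' : True
      have u1: "- (u * t) + 1 * u = u * (1 - t)" by (simp add: algebra_simps)
      have "complex_of_real (u * (1 - t)) powr (of_real b - 1) = of_real (u powr (b - 1)) * of_real ((1 - t) powr (b - 1))"
        using powr_of_real[of "u * (1 - t)" "b - 1"] True True' by (simp add: powr_mult)
      moreover have "complex_of_real (u * t) powr (a - 1) = complex_of_real u powr (a - 1) * complex_of_real t powr (a - 1)"
        using True True' by (simp add: powr_times_real)
      moreover have "complex_of_real u powr (a + of_real b - 2) = complex_of_real u powr (a - 1) * of_real (u powr (b - 1))"
        using True by (simp add: powr_of_real[symmetric] powr_add[symmetric])
      moreover have "exp (- u) = exp (- (u * t)) * exp (- (u * (1 - t)))" by (simp add: algebra_simps flip: exp_add)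
      ultimately show ?thesis using True True' unfolding F_def prod.case add_0 u1 p_def k_def by simp
    qed
    then have "(LINT t|lborel. F (0 + u * t, u)) = (complex_of_real u powr (a + of_real b - 2) * of_real (exp (- u))) * ?B"
      by (simp only: set_lebesgue_integral_def integral_mult_right_zero flip: k_def)
    then have "(LINT t|lborel. F (t, u)) = of_real u * ((complex_of_real u powr (a + of_real b - 2) * of_real (exp (- u))) * ?B)"
      using lborel_integral_real_affine[of u "\<lambda>t. F (t, u)" 0] True by (simp add: scaleR_conv_of_real)
    moreover have "of_real u * complex_of_real u powr (a + of_real b - 2) = complex_of_real u powr (a + of_real b - 1)"
      using True powr_add[of "complex_of_real u" "a + of_real b - 2" 1] by (simp add: algebra_simps)
    ultimately show ?thesis using True by (simp add: p_def algebra_simps)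
  qed
  have "Gamma a * Gamma (of_real b) = (LINT t|lborel. LINT u|lborel. F (t, u))"
    unfolding i2 integral_mult_left_zero pa(2) ..
  also have "\<dots> = (LINT u|lborel. LINT t|lborel. F (t, u))"
    using lborel_pair.Fubini_integral[OF Fi] by simp
  also have "\<dots> = ?B * Gamma (a + of_real b)"
    unfolding inner integral_mult_right_zero using p(2)[of "a + of_real b"] a b by simp
  finally have "Gamma a * Gamma (of_real b) = ?B * Gamma (a + of_real b)" .
  moreover have "Gamma (a + of_real b) \<noteq> 0"
    using a b by (auto simp: Gamma_eq_zero_iff elim!: nonpos_Ints_cases dest!: arg_cong[where f=Re])
  ultimately show ?thesis by (simp add: Beta_def field_simps)
qed

section \<open>Riemann-Liouville integrals on the half-line\<close>

text \<open>This is \<open>\<Gamma>(\<gamma>)\<close> times the Riemann-Liouville integral of order \<open>\<gamma>\<close>, that is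
  \<open>\<integral>\<^sub>0\<^sup>u g(\<tau>) (u - \<tau>)\<^sup>\<gamma>\<^sup>-\<^sup>1 d\<tau>\<close>, after the substitution \<open>x = (1 - \<tau>/u)\<^sup>\<gamma>\<close>. The kernel, singular for
  \<open>\<gamma> < 1\<close>, is absorbed, and for continuous \<open>g\<close> the integrand is continuous on a fixed compact
  interval, so that the theorems on parameter integrals apply for every \<open>\<gamma> > 0\<close>.\<close>
definition riesz :: "real \<Rightarrow> (real \<Rightarrow> real) \<Rightarrow> real \<Rightarrow> real" where
  "riesz \<gamma> g u = u powr \<gamma> / \<gamma> * integral {0..1} (\<lambda>x. g (u * (1 - x powr (1 / \<gamma>))))"

lemma continuous_on_root_powr:
  fixes \<gamma> :: real
  assumes "\<gamma> > 0" "S \<subseteq> {0..}"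
  shows "continuous_on S (\<lambda>x. x powr (1 / \<gamma>))"
  by (rule continuous_on_powr') (use assms in \<open>auto intro!: continuous_intros\<close>)

lemma continuous_on_riesz_integrand:
  fixes g :: "real \<Rightarrow> real"
  assumes "\<gamma> > 0" "continuous_on UNIV g" "S \<subseteq> {0..}"
  shows "continuous_on S (\<lambda>x. g (u * (1 - x powr (1 / \<gamma>))))"
  by (rule continuous_on_compose2[OF assms(2)])
     (auto intro!: continuous_intros continuous_on_root_powr assms)

text \<open>The substitution is carried out on primitives: with \<open>\<Xi>\<close> a primitive of the substituted integrand,
  \<open>- (u\<^sup>\<gamma>/\<gamma>) \<Xi>((1 - \<tau>/u)\<^sup>\<gamma>)\<close> is a primitive of \<open>g(\<tau>) (u - \<tau>)\<^sup>\<gamma>\<^sup>-\<^sup>1\<close> inside \<open>(0, u)\<close> and is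
  continuous up to the ends.\<close>
lemma riesz_has_integral:
  assumes \<gamma>: "\<gamma> > 0" and g: "continuous_on UNIV g" and u: "u > 0"
  shows "((\<lambda>\<tau>. g \<tau> * (u - \<tau>) powr (\<gamma> - 1)) has_integral riesz \<gamma> g u) {0..u}"
proof -
  define \<Xi> where "\<Xi> z = integral {0..z} (\<lambda>x. g (u * (1 - x powr (1 / \<gamma>))))" for z
  define f where "f \<tau> = - (u powr \<gamma> / \<gamma>) * \<Xi> ((1 - \<tau> / u) powr \<gamma>)" for \<tau>
  have k: "continuous_on {0..1} (\<lambda>x. g (u * (1 - x powr (1 / \<gamma>))))"
    using continuous_on_riesz_integrand[OF \<gamma> g] by auto
  have d\<Xi>: "(\<Xi> has_real_derivative g (u * (1 - z powr (1 / \<gamma>)))) (at z within {0..1})"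
    if "z \<in> {0..1}" for z
    unfolding \<Xi>_def using integral_has_real_derivative[OF k that] .
  have c\<Xi>: "continuous_on {0..1} \<Xi>"
    using d\<Xi> by (meson DERIV_continuous_on)
  have "((\<lambda>\<tau>. g \<tau> * (u - \<tau>) powr (\<gamma> - 1)) has_integral (f u - f 0)) {0..u}"
  proof (rule fundamental_theorem_of_calculus_interior)
    show "0 \<le> u" using u by simp
    have "continuous_on {0..u} (\<lambda>\<tau>. (1 - \<tau> / u) powr \<gamma>)"
      by (rule continuous_on_powr') (use u \<gamma> in \<open>auto intro!: continuous_intros\<close>)
    moreover have "(\<lambda>\<tau>. (1 - \<tau> / u) powr \<gamma>) ` {0..u} \<subseteq> {0..1}"
      using u \<gamma> powr_mono2[of \<gamma> _ 1] by (auto simp: field_simps)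
    ultimately have "continuous_on {0..u} (\<lambda>\<tau>. \<Xi> ((1 - \<tau> / u) powr \<gamma>))"
      by (rule continuous_on_compose2[OF c\<Xi>])
    then show "continuous_on {0..u} f"
      unfolding f_def by (rule continuous_on_mult_left)
    show "(f has_vector_derivative g \<tau> * (u - \<tau>) powr (\<gamma> - 1)) (at \<tau>)" if \<tau>: "\<tau> \<in> {0<..<u}" for \<tau>
    proof -
      let ?z = "(1 - \<tau> / u) powr \<gamma>"
      have t1: "0 < 1 - \<tau> / u" "1 - \<tau> / u < 1" using \<tau> by auto
      have z: "0 < ?z" "?z < 1" using t1 \<gamma> powr_less_mono2[of \<gamma> "1 - \<tau> / u" 1] by auto
      have "(\<Xi> has_real_derivative g (u * (1 - ?z powr (1 / \<gamma>)))) (at ?z within {0..1})"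
        using z by (intro d\<Xi>) auto
      moreover have "at ?z within {0..1} = at ?z"
        using z by (intro at_within_interior) auto
      moreover have "u * (1 - ?z powr (1 / \<gamma>)) = \<tau>" using \<gamma> t1 u by (simp add: powr_powr)
      ultimately have 1: "(\<Xi> has_real_derivative g \<tau>) (at ?z)" by simp
      have 2: "((\<lambda>\<tau>. (1 - \<tau> / u) powr \<gamma>) has_real_derivative \<gamma> * (1 - \<tau> / u) powr (\<gamma> - 1) * (- 1 / u)) (at \<tau>)"
        using t1 u by (auto intro!: derivative_eq_intros simp: powr_diff)
      have "(f has_real_derivative - (u powr \<gamma> / \<gamma>) * (g \<tau> * (\<gamma> * (1 - \<tau> / u) powr (\<gamma> - 1) * (- 1 / u)))) (at \<tau>)"
        unfolding f_def by (intro DERIV_cmult DERIV_chain2[OF 1 2])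
      moreover have "(u - \<tau>) powr (\<gamma> - 1) = u powr (\<gamma> - 1) * (1 - \<tau> / u) powr (\<gamma> - 1)"
        using powr_mult[of u "1 - \<tau> / u" "\<gamma> - 1"] t1 u by (simp add: right_diff_distrib)
      then have "- (u powr \<gamma> / \<gamma>) * (g \<tau> * (\<gamma> * (1 - \<tau> / u) powr (\<gamma> - 1) * (- 1 / u))) = g \<tau> * (u - \<tau>) powr (\<gamma> - 1)"
        using u \<gamma> powr_mult_base[of u "\<gamma> - 1"] by (simp only:) (simp add: field_simps)
      ultimately show ?thesis by (simp add: has_real_derivative_iff_has_vector_derivative)
    qed
  qed
  also have "f u - f 0 = riesz \<gamma> g u"
    using u \<gamma> by (simp add: f_def \<Xi>_def riesz_def)
  finally show ?thesis .
qed

lemma continuous_on_riesz: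
  assumes \<gamma>: "\<gamma> > 0" and g: "continuous_on UNIV g"
  shows "continuous_on {0<..} (riesz \<gamma> g)"
proof -
  have "continuous_on ({0<..} \<times> cbox 0 1) (\<lambda>(u, x). g (u * (1 - x powr (1 / \<gamma>))))"
    unfolding case_prod_unfold
    by (rule continuous_on_compose2[OF g])
       (use \<gamma> in \<open>auto intro!: continuous_intros continuous_on_powr'\<close>)
  from integral_continuous_on_param[OF this]
  show ?thesis unfolding riesz_def using \<gamma>
    by (auto intro!: continuous_intros simp: riesz_def)
qed

text \<open>Integrals of fractional and of integer order commute. Differentiating the factor \<open>u\<^sup>\<gamma>\<close> and the
  integrand separately gives two terms; partial integration in \<open>x\<close>, which uses \<open>G 0 = 0\<close>, combines
  them into \<open>riesz \<gamma> g\<close>.\<close>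
lemma riesz_has_real_derivative:
  assumes \<gamma>: "\<gamma> > 0" and g: "continuous_on UNIV g"
    and G: "\<And>u. (G has_real_derivative g u) (at u)" "G 0 = 0" and u: "u > 0"
  shows "(riesz \<gamma> G has_real_derivative riesz \<gamma> g u) (at u)"
proof -
  let ?k = "\<lambda>x::real. 1 - x powr (1 / \<gamma>)"
  have Gc: "continuous_on UNIV G" using G(1) by (meson DERIV_continuous_on DERIV_subset subset_UNIV)
  have kc: "continuous_on {0..1} ?k"
    by (intro continuous_intros continuous_on_root_powr \<gamma>) auto
  have c: "continuous_on {0..1} (\<lambda>x. g (u * ?k x))" "continuous_on {0..1} (\<lambda>x. G (u * ?k x))"
    using continuous_on_riesz_integrand[OF \<gamma> g] continuous_on_riesz_integrand[OF \<gamma> Gc] by auto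
  have L: "((\<lambda>u. integral (cbox 0 1) (\<lambda>x. G (u * ?k x))) has_real_derivative
       integral (cbox 0 1) (\<lambda>x. g (u * ?k x) * ?k x)) (at u within UNIV)"
  proof (rule leibniz_rule_field_derivative)
    show "((\<lambda>u. G (u * ?k t)) has_real_derivative g (x * ?k t) * ?k t) (at x within UNIV)" for x t
      by (rule DERIV_chain2[OF G(1)]) (auto intro!: derivative_eq_intros)
    show "(\<lambda>t. G (x * ?k t)) integrable_on cbox 0 1" for x
      by (intro integrable_continuous continuous_on_riesz_integrand[OF \<gamma> Gc]) auto
    have "continuous_on (UNIV \<times> cbox 0 1) (\<lambda>p. g (fst p * ?k (snd p)))"
      by (rule continuous_on_compose2[OF g])
         (use \<gamma> in \<open>auto intro!: continuous_intros continuous_on_powr'\<close>)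
    then show "continuous_on (UNIV \<times> cbox 0 1) (\<lambda>(x, t). g (x * ?k t) * ?k t)"
      unfolding case_prod_unfold
      using \<gamma> by (auto intro!: continuous_intros continuous_on_powr')
  qed auto
  have parts: "((\<lambda>x. G (u * ?k x) - u / \<gamma> * (g (u * ?k x) * x powr (1 / \<gamma>))) has_integral
      (1 * G (u * ?k 1) - 0 * G (u * ?k 0))) {0..1}"
  proof (rule fundamental_theorem_of_calculus_interior)
    show "continuous_on {0..1} (\<lambda>x. x * G (u * ?k x))"
      by (intro continuous_intros c)
    show "((\<lambda>x. x * G (u * ?k x)) has_vector_derivative
        G (u * ?k x) - u / \<gamma> * (g (u * ?k x) * x powr (1 / \<gamma>))) (at x)" if x: "x \<in> {0<..<1}" for x
    proof -
      let ?g = "g (u * ?k x)" and ?q = "x powr (1 / \<gamma> - 1)"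
      have "((\<lambda>x. G (u * ?k x)) has_real_derivative ?g * (u * (- (1 / \<gamma> * ?q)))) (at x)"
        by (rule DERIV_chain2[OF G(1)]) (use x in \<open>auto intro!: derivative_eq_intros\<close>)
      from DERIV_mult[OF DERIV_ident this]
      have d: "((\<lambda>x. x * G (u * ?k x)) has_real_derivative 1 * G (u * ?k x) + ?g * (u * (- (1 / \<gamma> * ?q))) * x) (at x)" .
      have e1: "?g * (u * (- (1 / \<gamma> * ?q))) * x = - (u / \<gamma> * (?g * (x * ?q)))"
        by simp
      have e2: "x * ?q = x powr (1 / \<gamma>)"
        using x by (simp add: powr_mult_base)
      show ?thesis
        using d unfolding e1 e2 by (simp add: has_real_derivative_iff_has_vector_derivative[symmetric])
    qed
  qed auto
  let ?A = "integral {0..1} (\<lambda>x. G (u * ?k x))" and ?B = "integral {0..1} (\<lambda>x. g (u * ?k x))"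
    and ?C = "integral {0..1} (\<lambda>x. g (u * ?k x) * ?k x)"
  have i: "(\<lambda>x. g (u * ?k x)) integrable_on {0..1}" "(\<lambda>x. g (u * ?k x) * ?k x) integrable_on {0..1}"
    "(\<lambda>x. G (u * ?k x)) integrable_on {0..1}"
    by (intro integrable_continuous_real continuous_intros c kc)+
  have "?A - u / \<gamma> * (?B - ?C) = 0"
  proof -
    have "((\<lambda>x. G (u * ?k x) - u / \<gamma> * (g (u * ?k x) - g (u * ?k x) * ?k x)) has_integral
        (?A - u / \<gamma> * (?B - ?C))) {0..1}"
      by (intro has_integral_diff has_integral_mult_right integrable_integral i)
    moreover have "(\<lambda>x. G (u * ?k x) - u / \<gamma> * (g (u * ?k x) - g (u * ?k x) * ?k x)) =
       (\<lambda>x. G (u * ?k x) - u / \<gamma> * (g (u * ?k x) * x powr (1 / \<gamma>)))"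
      by (simp add: algebra_simps)
    ultimately show ?thesis using parts G(2) by (auto dest: has_integral_unique)
  qed
  then have A: "?A = u / \<gamma> * (?B - ?C)" by simp
  have "((\<lambda>u. u powr \<gamma> / \<gamma> * integral {0..1} (\<lambda>x. G (u * ?k x))) has_real_derivative
      (u powr (\<gamma> - 1)) * ?A + ?C * (u powr \<gamma> / \<gamma>)) (at u)"
    using L u \<gamma> by (intro DERIV_mult) (auto intro!: derivative_eq_intros)
  also have "(u powr (\<gamma> - 1)) * ?A + ?C * (u powr \<gamma> / \<gamma>) = u powr \<gamma> / \<gamma> * ?B"
    unfolding A using u \<gamma> by (simp add: powr_diff field_simps)
  finally show ?thesis by (simp add: riesz_def[abs_def])
qed

text \<open>The arguments \<open>u (1 - x\<^sup>1\<^sup>/\<^sup>\<gamma>)\<close> tend to infinity for \<open>x < 1\<close>, and \<open>G\<close> is bounded on \<open>[0, \<infinity>)\<close>, so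
  dominated convergence applies.\<close>
lemma riesz_asymptotics:
  assumes \<gamma>: "\<gamma> > 0" and G: "continuous_on UNIV G" "(G \<longlongrightarrow> m) at_top"
  shows "((\<lambda>u. riesz \<gamma> G u / u powr \<gamma>) \<longlongrightarrow> m / \<gamma>) at_top"
proof -
  let ?k = "\<lambda>x::real. 1 - x powr (1 / \<gamma>)"
  obtain B where B: "\<And>y. y \<ge> 0 \<Longrightarrow> norm (G y) \<le> B"
  proof -
    have "eventually (\<lambda>y. norm (G y) < norm m + 1) at_top"
      by (rule order_tendstoD(2)[OF tendsto_norm[OF G(2)]]) simp
    then obtain y0 where y0: "\<And>y. y \<ge> y0 \<Longrightarrow> norm (G y) < norm m + 1"
      by (auto simp: eventually_at_top_linorder)
    have "bounded (G ` {0..y0})"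
      by (intro compact_imp_bounded compact_continuous_image continuous_on_subset[OF G(1)]) auto
    then obtain C where C: "\<And>y. y \<in> {0..y0} \<Longrightarrow> norm (G y) \<le> C" unfolding bounded_iff by blast
    have "norm (G y) \<le> max C (norm m + 1)" if "y \<ge> 0" for y
      using y0[of y] C[of y] that by (cases "y \<ge> y0") auto
    then show ?thesis by (rule that)
  qed
  have "((\<lambda>u. integral {0..1} (\<lambda>x. G (u * ?k x))) \<longlongrightarrow> m) at_top"
  proof (rule tendsto_at_topI_sequentially)
    fix X :: "nat \<Rightarrow> real" assume X: "filterlim X at_top sequentially"
    then have "eventually (\<lambda>n. X n \<ge> 0) sequentially" by (simp add: filterlim_at_top)
    then obtain n0 where n0: "\<And>n. n \<ge> n0 \<Longrightarrow> X n \<ge> 0"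
      by (auto simp: eventually_sequentially)
    have X': "filterlim (\<lambda>n. X (n + n0)) at_top sequentially"
      by (rule filterlim_compose[OF X filterlim_add_const_nat_at_top])
    have "(\<lambda>n. integral {0..1} (\<lambda>x. G (X (n + n0) * ?k x))) \<longlonglongrightarrow> integral {0..1::real} (\<lambda>x. if x = 1 then G 0 else m)"
    proof (rule dominated_convergence(2)[where f="\<lambda>n x. G (X (n + n0) * ?k x)" and h="\<lambda>x. B"])
      show "(\<lambda>x. G (X (n + n0) * ?k x)) integrable_on {0..1}" for n
        using continuous_on_riesz_integrand[OF \<gamma> G(1)] by (auto intro!: integrable_continuous_real)
      show "(\<lambda>x. B) integrable_on {0..1::real}" by (rule integrable_const_ivl)
      show "norm (G (X (n + n0) * ?k x)) \<le> B" if "x \<in> {0..1}" for n x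
        using that \<gamma> powr_mono2[of "1/\<gamma>" x 1] by (intro B mult_nonneg_nonneg n0) auto
      show "(\<lambda>n. G (X (n + n0) * ?k x)) \<longlonglongrightarrow> (if x = 1 then G 0 else m)" if x: "x \<in> {0..1}" for x
      proof (cases "x = 1")
        case False
        then have "?k x > 0" using x \<gamma> powr_less_mono2[of "1/\<gamma>" x 1] by auto
        then have "filterlim (\<lambda>n. X (n + n0) * ?k x) at_top sequentially"
          using filterlim_at_top_mult_tendsto_pos[OF tendsto_const _ X'] by blast
        from filterlim_compose[OF G(2) this] False show ?thesis by simp
      qed simp
    qed
    moreover have "((\<lambda>x. if x = 1 then G 0 else m) has_integral m) {0..1::real}"
      by (rule has_integral_spike[of "{1}", rotated 2])
         (use has_integral_const_real[of m 0 1] in auto)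
    ultimately show "(\<lambda>n. integral {0..1} (\<lambda>x. G (X n * ?k x))) \<longlonglongrightarrow> m"
      using LIMSEQ_offset[of "\<lambda>n. integral {0..1} (\<lambda>x. G (X n * ?k x))" n0] by (simp add: integral_unique)
  qed
  then have "((\<lambda>u. integral {0..1} (\<lambda>x. G (u * ?k x)) / \<gamma>) \<longlongrightarrow> m / \<gamma>) at_top"
    using \<gamma> by (intro tendsto_intros) auto
  moreover have "eventually (\<lambda>u. integral {0..1} (\<lambda>x. G (u * ?k x)) / \<gamma> = riesz \<gamma> G u / u powr \<gamma>) at_top"
    using eventually_gt_at_top[of 0] by eventually_elim (auto simp: riesz_def)
  ultimately show ?thesis by (rule Lim_transform_eventually)
qed

section \<open>Mellin transforms on the half-line\<close>

definition weighted_integrable :: "(real \<Rightarrow> real) \<Rightarrow> real \<Rightarrow> bool" where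
  "weighted_integrable g x \<longleftrightarrow> set_integrable lborel {0<..} (\<lambda>u. g u * u powr (x - 1))"

definition halfline_mellin :: "(real \<Rightarrow> real) \<Rightarrow> complex \<Rightarrow> complex" where
  "halfline_mellin g w = (LINT u:{0<..}|lborel. of_real (g u) * of_real u powr (w - 1))"

lemma mellin_set_integrable:
  assumes "continuous_on {0<..} g" "weighted_integrable g (Re w)"
  shows "set_integrable lborel {0<..} (\<lambda>u. complex_of_real (g u) * of_real u powr (w - 1))"
proof (rule set_integrable_bound[OF assms(2)[unfolded weighted_integrable_def]])
  have "set_borel_measurable borel {0<..} (\<lambda>u. complex_of_real (g u) * of_real u powr (w - 1))"
    by (rule set_borel_measurable_if_continuous) (auto intro!: continuous_intros assms(1))
  then show "set_borel_measurable lborel {0<..} (\<lambda>u. complex_of_real (g u) * of_real u powr (w - 1))"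
    by (simp add: set_borel_measurable_def)
qed (auto simp: norm_mult norm_powr_of_real abs_mult)

abbreviation halfline_ends :: "(real \<times> real) filter" where
  "halfline_ends \<equiv> at_right 0 \<times>\<^sub>F at_top"

lemma halfline_ends_iff:
  fixes F :: "real \<Rightarrow> real \<Rightarrow> 'b::metric_space"
  shows "((\<lambda>(r, R). F r R) \<longlongrightarrow> L) halfline_ends \<longleftrightarrow>
     (\<forall>e>0. \<exists>a>0. \<exists>b. \<forall>r R. 0 < r \<and> r < a \<and> b \<le> R \<longrightarrow> dist (F r R) L < e)"
proof -
  have "eventually (\<lambda>x. dist (case x of (r, R) \<Rightarrow> F r R) L < e) halfline_ends \<longleftrightarrow>
     (\<exists>a>0. \<exists>b. \<forall>r R. 0 < r \<and> r < a \<and> b \<le> R \<longrightarrow> dist (F r R) L < e)" (is "?l = ?r") for e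
  proof
    assume ?l
    then obtain P Q where PQ: "eventually P (at_right (0::real))" "eventually Q (at_top :: real filter)"
      "\<And>x y. P x \<Longrightarrow> Q y \<Longrightarrow> dist (F x y) L < e"
      unfolding eventually_prod_filter by auto
    obtain a where "a > 0" "\<And>x. 0 < x \<Longrightarrow> x < a \<Longrightarrow> P x" using PQ(1) by (auto simp: eventually_at_right_field)
    moreover obtain b where "\<And>x. b \<le> x \<Longrightarrow> Q x" using PQ(2) by (auto simp: eventually_at_top_linorder)
    ultimately show ?r using PQ(3) by blast
  next
    assume ?r
    then obtain a b where ab: "a > 0" "\<And>r R. 0 < r \<Longrightarrow> r < a \<Longrightarrow> b \<le> R \<Longrightarrow> dist (F r R) L < e" by blast
    have "eventually (\<lambda>x. 0 < x \<and> x < a) (at_right 0)" using ab(1) by (auto simp: eventually_at_right_field)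
    moreover have "eventually (\<lambda>x. b \<le> x) at_top" by (rule eventually_ge_at_top)
    ultimately show ?l unfolding eventually_prod_filter
      by (intro exI[of _ "\<lambda>x. 0 < x \<and> x < a"] exI[of _ "\<lambda>x. b \<le> x"] conjI) (simp_all add: ab(2))
  qed
  then show ?thesis unfolding tendsto_iff by simp
qed

lemma halfline_ends_nontrivial: "halfline_ends \<noteq> bot"
  by (simp add: prod_filter_eq_bot)

lemma tendsto_halfline_ends_cong:
  assumes "((\<lambda>x. f (fst x) (snd x)) \<longlongrightarrow> L) halfline_ends"
    and "\<And>r R. 0 < r \<Longrightarrow> r \<le> 1 \<Longrightarrow> 1 \<le> R \<Longrightarrow> f r R = g r R"
  shows "((\<lambda>(r, R). g r R) \<longlongrightarrow> L) halfline_ends"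
proof (rule Lim_transform_eventually[OF assms(1)])
  show "eventually (\<lambda>x. f (fst x) (snd x) = (case x of (r, R) \<Rightarrow> g r R)) halfline_ends"
    unfolding eventually_prod_filter
  proof (intro exI conjI allI impI)
    show "eventually (\<lambda>r. 0 < r \<and> r \<le> 1) (at_right (0::real))"
      by (auto simp: eventually_at_right_field intro: exI[of _ 1])
    show "eventually (\<lambda>R. 1 \<le> R) (at_top :: real filter)" by (rule eventually_ge_at_top)
  qed (use assms(2) in auto)
qed

lemma tendsto_halfline_integral:
  fixes f :: "real \<Rightarrow> 'b::{banach,second_countable_topology}"
  assumes f: "set_integrable lborel {0<..} f"
  shows "((\<lambda>(r, R). LINT u:{r..R}|lborel. f u) \<longlongrightarrow> (LINT u:{0<..}|lborel. f u)) halfline_ends"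
proof -
  have sub: "set_integrable lborel A f" if "A \<subseteq> {0<..}" "A \<in> sets lborel" for A
    by (rule set_integrable_subset[OF f]) (use that in auto)
  have "((\<lambda>r. LINT u:{r..1}|lborel. f u) \<longlongrightarrow> (LINT u:{0<..1}|lborel. f u)) (at_right 0)"
    by (rule tendsto_set_lebesgue_integral_at_right) (auto intro!: sub)
  then have 1: "((\<lambda>x. LINT u:{fst x..1}|lborel. f u) \<longlongrightarrow> (LINT u:{0<..1}|lborel. f u)) halfline_ends"
    by (rule filterlim_compose[OF _ filterlim_fst])
  have "((\<lambda>R. LINT u:{1..R}|lborel. f u) \<longlongrightarrow> (LINT u:{1..}|lborel. f u)) at_top"
    by (rule tendsto_set_lebesgue_integral_at_top) (auto intro!: sub)
  then have 2: "((\<lambda>x. LINT u:{1..snd x}|lborel. f u) \<longlongrightarrow> (LINT u:{1..}|lborel. f u)) halfline_ends"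
    by (rule filterlim_compose[OF _ filterlim_snd])
  have un: "(LINT u:A \<union> B|lborel. f u) = (LINT u:A|lborel. f u) + (LINT u:B|lborel. f u)"
    if "A \<inter> B \<subseteq> {1}" "A \<subseteq> {0<..}" "B \<subseteq> {0<..}" "A \<in> sets lborel" "B \<in> sets lborel" for A B
  proof (rule set_integral_Un_AE)
    show "AE x in lborel. \<not> (x \<in> A \<and> x \<in> B)"
      using AE_lborel_singleton[of "1::real"] by eventually_elim (use that in auto)
  qed (use that sub in auto)
  have tot: "(LINT u:{0<..}|lborel. f u) = (LINT u:{0<..1}|lborel. f u) + (LINT u:{1..}|lborel. f u)"
    by (subst un[symmetric]) (auto intro!: arg_cong[where f="\<lambda>A. set_lebesgue_integral lborel A f"])
  show ?thesis
  proof (rule tendsto_halfline_ends_cong)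
    show "((\<lambda>x. (LINT u:{fst x..1}|lborel. f u) + (LINT u:{1..snd x}|lborel. f u)) \<longlongrightarrow> (LINT u:{0<..}|lborel. f u)) halfline_ends"
      unfolding tot by (intro tendsto_add 1 2)
    show "(LINT u:{r..1}|lborel. f u) + (LINT u:{1..R}|lborel. f u) = (LINT u:{r..R}|lborel. f u)"
      if "0 < r" "r \<le> 1" "1 \<le> R" for r R
    proof -
      have "{r..R} = {r..1} \<union> {1..R}" using that by auto
      moreover have "(LINT u:{r..1} \<union> {1..R}|lborel. f u) = (LINT u:{r..1}|lborel. f u) + (LINT u:{1..R}|lborel. f u)"
        using that by (intro un) auto
      ultimately show ?thesis by simp
    qed
  qed
qed

lemma riesz_unit_form:
  assumes \<gamma>: "\<gamma> > 0" and g: "continuous_on UNIV g" and u: "u > 0"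
  shows "set_integrable lborel {0<..<1} (\<lambda>t. g (u * t) * (1 - t) powr (\<gamma> - 1))"
    and "u powr \<gamma> * (LINT t:{0<..<1}|lborel. g (u * t) * (1 - t) powr (\<gamma> - 1)) = riesz \<gamma> g u"
proof -
  have gc: "continuous_on UNIV (\<lambda>t. g (u * t))"
    by (rule continuous_on_compose2[OF g]) (auto intro!: continuous_intros)
  have "compact ((\<lambda>t. g (u * t)) ` {0..1})"
    by (intro compact_continuous_image continuous_on_subset[OF gc]) auto
  then obtain B where B: "\<And>t. t \<in> {0..1} \<Longrightarrow> norm (g (u * t)) \<le> B"
    by (meson bounded_iff compact_imp_bounded imageI)
  have 1: "set_integrable lborel {0<..<1} (\<lambda>t. B * (t powr (1 - 1) * (1 - t) powr (\<gamma> - 1)))"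
    by (intro set_integrable_mult_right set_integrable_subset[OF integrable_Beta[of 1 \<gamma>]]) (use \<gamma> in auto)
  have "(\<lambda>t. indicat_real {0<..<1} t *\<^sub>R (g (u * t) * (1 - t) powr (\<gamma> - 1))) \<in> borel_measurable borel"
    by (rule borel_measurable_continuous_on_indicator)
       (auto intro!: continuous_intros continuous_on_subset[OF gc])
  then show *: "set_integrable lborel {0<..<1} (\<lambda>t. g (u * t) * (1 - t) powr (\<gamma> - 1))"
    by (intro set_integrable_bound[OF 1])
       (use B in \<open>auto simp: set_borel_measurable_def abs_mult intro!: mult_right_mono order_trans[OF _ abs_ge_self]\<close>)
  have "(LINT t:{0<..<1}|lborel. g (u * t) * (1 - t) powr (\<gamma> - 1)) = integral {0<..<1} (\<lambda>t. g (u * t) * (1 - t) powr (\<gamma> - 1))"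
    by (rule set_borel_integral_eq_integral(2)[OF *])
  also have "\<dots> = integral {0..1} (\<lambda>t. g (u * t) * (1 - t) powr (\<gamma> - 1))"
    by (simp add: integral_open_interval_real)
  also have "\<dots> = riesz \<gamma> (\<lambda>t. g (u * t)) 1"
    by (rule integral_unique[OF riesz_has_integral[OF \<gamma> gc]]) simp
  finally show "u powr \<gamma> * (LINT t:{0<..<1}|lborel. g (u * t) * (1 - t) powr (\<gamma> - 1)) = riesz \<gamma> g u"
    by (simp add: riesz_def)
qed

text \<open>Below the line \<open>Re w = 1\<close> everything converges absolutely. With \<open>\<tau> = u t\<close> the double integral has
  the integrand \<open>g(u t) u\<^sup>w\<^sup>-\<^sup>1 (1 - t)\<^sup>\<gamma>\<^sup>-\<^sup>1\<close>; the integral over \<open>u\<close> scales to \<open>t\<^sup>-\<^sup>w\<close> times the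
  transform of \<open>g\<close>, and what remains is the Beta integral.\<close>
theorem riesz_mellin_absolute:
  assumes \<gamma>: "\<gamma> > 0" and g: "continuous_on UNIV g" and w: "w = s + of_real \<gamma>" "Re w < 1"
    and int: "weighted_integrable g (Re w)"
  shows "set_integrable lborel {0<..} (\<lambda>u. of_real (riesz \<gamma> g u) * of_real u powr (s - 1))"
    and "halfline_mellin (riesz \<gamma> g) s = Beta (1 - w) (of_real \<gamma>) * halfline_mellin g w"
proof -
  define K where "K = (\<lambda>u. indicat_real {0<..} u *\<^sub>R (complex_of_real (g u) * of_real u powr (w - 1)))"
  define b where "b = (\<lambda>t. indicat_real {0<..<1} t *\<^sub>R (complex_of_real t powr (1 - w - 1) * of_real ((1 - t) powr (\<gamma> - 1))))"
  define F where "F = (\<lambda>(t, u). (b t * of_real t) * K (0 + t * u))"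
  have gc: "continuous_on {0<..} g" using g continuous_on_subset by blast
  have K: "integrable lborel K" "integral\<^sup>L lborel K = halfline_mellin g w"
    using mellin_set_integrable[OF gc int] by (simp_all add: K_def set_integrable_def halfline_mellin_def set_lebesgue_integral_def)
  have b: "integrable lborel b" "integral\<^sup>L lborel b = Beta (1 - w) (of_real \<gamma>)"
    using Beta_set_integrable[of "1 - w" \<gamma>] Beta_integral_complex[of "1 - w" \<gamma>] w(2) \<gamma>
    by (simp_all add: b_def set_integrable_def set_lebesgue_integral_def)
  have [measurable]: "K \<in> borel_measurable borel" "b \<in> borel_measurable borel"
    using K(1) b(1) by auto
  have Fm: "F \<in> borel_measurable (lborel \<Otimes>\<^sub>M lborel)"
    unfolding F_def by measurable
  have b0: "b t = 0" if "\<not> (0 < t \<and> t < 1)" for t using that by (auto simp: b_def)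
  have i1: "integrable lborel (\<lambda>u. F (t, u))" for t
  proof (cases "t > 0")
    case True then show ?thesis unfolding F_def using lborel_integrable_real_affine[OF K(1), of t 0]
      by (simp only: prod.case) (intro integrable_mult_right, simp)
  qed (simp add: F_def b0)
  have i2: "(LINT u|lborel. F (t, u)) = b t * halfline_mellin g w" for t
  proof (cases "t > 0")
    case True then show ?thesis unfolding F_def prod.case integral_mult_right_zero 
      using lborel_integral_real_affine[of t K 0] K(2) by (simp add: scaleR_conv_of_real)
  qed (simp add: F_def b0)
  have i3: "(LINT u|lborel. norm (F (t, u))) = norm (b t) * (LINT u|lborel. norm (K u))" for t
  proof (cases "t > 0")
    case True then show ?thesis unfolding F_def prod.case norm_mult integral_mult_right_zero 
      using lborel_integral_real_affine[of t "\<lambda>u. norm (K u)" 0] by simp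
  qed (simp add: F_def b0)
  have Fi: "integrable (lborel \<Otimes>\<^sub>M lborel) F"
    by (rule lborel_pair.Fubini_integrable[OF Fm])
       (use i1 in \<open>auto simp: i3 intro!: integrable_mult_left integrable_norm b\<close>)
  then have Fi': "integrable (lborel \<Otimes>\<^sub>M lborel) (case_prod (\<lambda>t u. F (t, u)))" by simp
  have inner: "(LINT t|lborel. F (t, u)) = indicat_real {0<..} u *\<^sub>R (of_real (riesz \<gamma> g u) * of_real u powr (s - 1))" for u
  proof (cases "u > 0")
    case False
    then have "F (t, u) = 0" for t
      by (cases "0 < t") (auto simp: F_def K_def b0 zero_less_mult_iff)
    with False show ?thesis by simp
  next
    case True
    have "F (t, u) = of_real u powr (w - 1) * of_real (indicat_real {0<..<1} t * (g (u * t) * (1 - t) powr (\<gamma> - 1)))" for t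
    proof (cases "0 < t \<and> t < 1")
      case True': True
      then have "complex_of_real (t * u) powr (w - 1) = of_real t powr (w - 1) * of_real u powr (w - 1)"
        using True by (simp add: powr_times_real)
      moreover have "complex_of_real t powr (1 - w - 1) * of_real t * of_real t powr (w - 1) = 1"
        using True' powr_add[of "of_real t" "1 - w - 1" "w - 1"] powr_add[of "of_real t" "1 - w - 1 + (w - 1)" 1]
        by (simp add: algebra_simps)
      ultimately show ?thesis using True True' 
        by (simp add: F_def K_def b_def algebra_simps)
    qed (auto simp: F_def b0)
    then have "(LINT t|lborel. F (t, u)) = of_real u powr (w - 1) * of_real (LINT t:{0<..<1}|lborel. g (u * t) * (1 - t) powr (\<gamma> - 1))"
      unfolding set_lebesgue_integral_def
      by (simp only: integral_mult_right_zero integral_complex_of_real real_scaleR_def)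
    also have "of_real u powr (w - 1) = of_real u powr (s - 1) * complex_of_real (u powr \<gamma>)"
      using True by (simp add: w powr_of_real[symmetric] powr_add[symmetric] algebra_simps)
    finally show ?thesis using True riesz_unit_form(2)[OF \<gamma> g True]
      by (simp flip: of_real_mult add: mult.assoc) 
  qed
  show "set_integrable lborel {0<..} (\<lambda>u. of_real (riesz \<gamma> g u) * of_real u powr (s - 1))"
    using lborel_pair.integrable_snd[OF Fi'] unfolding inner set_integrable_def .
  have "halfline_mellin (riesz \<gamma> g) s = (LINT u|lborel. LINT t|lborel. F (t, u))"
    unfolding inner halfline_mellin_def set_lebesgue_integral_def ..
  also have "\<dots> = (LINT t|lborel. LINT u|lborel. F (t, u))"
    using lborel_pair.Fubini_integral[OF Fi'] .
  also have "\<dots> = Beta (1 - w) (of_real \<gamma>) * halfline_mellin g w"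
    unfolding i2 integral_mult_left_zero b(2) ..
  finally show "halfline_mellin (riesz \<gamma> g) s = Beta (1 - w) (of_real \<gamma>) * halfline_mellin g w" .
qed

section \<open>Differences under dilation\<close>

lemma has_vector_derivative_of_real_powr:
  assumes "u > 0"
  shows "((\<lambda>u. complex_of_real u powr z) has_vector_derivative z * of_real u powr (z - 1)) (at u within S)"
  by (rule has_vector_derivative_real_field, rule has_field_derivative_powr) (use assms in auto)

lemma powr_add_one:
  assumes "u > 0"
  shows "complex_of_real u * of_real u powr z = of_real u powr (z + 1)"
  using assms powr_add[of "complex_of_real u" z 1] by simp

lemma has_vector_derivative_dilate:
  assumes "(f has_vector_derivative f') (at (c * u))"
  shows "((\<lambda>u. f (c * u)) has_vector_derivative c *\<^sub>R f') (at u)"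
proof -
  have "((\<lambda>u. c * u) has_vector_derivative c) (at u)"
    by (auto intro!: derivative_eq_intros)
  from vector_diff_chain_at[OF this assms] show ?thesis by (simp add: o_def)
qed

lemma halfline_antiderivative:
  fixes f :: "real \<Rightarrow> complex"
  assumes "continuous_on {0<..} f"
  obtains F where "\<And>u. u > 0 \<Longrightarrow> (F has_vector_derivative f u) (at u)"
proof -
  have "\<exists>F. \<forall>x :: real. ereal 0 < x \<longrightarrow> ereal x < \<infinity> \<longrightarrow> (F has_vector_derivative f x) (at x)"
  proof (rule einterval_antiderivative)
    show "isCont f x" if "ereal 0 < ereal x" "ereal x < \<infinity>" for x
      using assms that by (auto simp: continuous_on_eq_continuous_at)
  qed auto
  then show ?thesis using that by auto
qed

text \<open>The mechanism that trades a derivative for a dilation while keeping control of conditionally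
  convergent integrals. Here \<open>H\<close> is a primitive of the Mellin integrand of \<open>h = E'\<close>. The average
  \<open>P u = \<integral>\<^sub>1\<^sup>\<rho> H(u t) t\<^sup>-\<^sup>s dt\<close> is a primitive of the Mellin integrand, at \<open>s - 1\<close>, of the difference
  \<open>E(\<rho> u) - E(u)\<close>: limits of \<open>H\<close> at the ends of the half-line pass to \<open>P\<close> with no hypothesis of
  absolute convergence. The third identity is partial integration in \<open>\<integral> h\<close> between \<open>u\<close> and \<open>\<rho> u\<close>.\<close>
lemma scaled_difference:
  fixes E H h :: "real \<Rightarrow> complex"
  assumes lam: "\<rho> > 1"
    and E: "\<And>u. u > 0 \<Longrightarrow> (E has_vector_derivative h u) (at u)"
    and H: "\<And>u. u > 0 \<Longrightarrow> (H has_vector_derivative h u * of_real u powr (s - 1)) (at u)"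
  obtains P where
    "\<And>u. u > 0 \<Longrightarrow> ((\<lambda>t. H (u * t) * of_real t powr (- s)) has_integral P u) {1..\<rho>}"
    "\<And>u. u > 0 \<Longrightarrow> (P has_vector_derivative (E (\<rho> * u) - E u) * of_real u powr (s - 2)) (at u)"
    "\<And>u. u > 0 \<Longrightarrow> (E (\<rho> * u) - E u) * of_real u powr (s - 1) =
        H (\<rho> * u) * of_real \<rho> powr (1 - s) - H u + (s - 1) * P u"
proof -
  have lam0: "\<rho> > 0" using lam by simp
  have Hc: "continuous_on {0<..} H"
    by (rule continuous_on_vector_derivative) (use H in \<open>auto intro: has_vector_derivative_at_within\<close>)
  then have "continuous_on {0<..} (\<lambda>u. H u * of_real u powr (- s))"
    by (auto intro!: continuous_intros)
  then obtain Q where Q: "\<And>u. u > 0 \<Longrightarrow> (Q has_vector_derivative H u * of_real u powr (- s)) (at u)"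
    using halfline_antiderivative by blast
  \<comment> \<open>with \<open>Q\<close> a primitive of \<open>H u u\<^sup>-\<^sup>s\<close>, this is the scaled form of \<open>\<integral>\<^sub>1\<^sup>\<rho> H(u t) t\<^sup>-\<^sup>s dt\<close>\<close>
  define P where "P u = of_real u powr (s - 1) * (Q (\<rho> * u) - Q u)" for u
  have mul: "complex_of_real (x * y) powr z = of_real x powr z * of_real y powr z" if "x > 0" "y > 0" for x y z
    using that by (simp add: powr_times_real)
  have inv: "complex_of_real u powr z * of_real u powr (- z) = 1" if "u > 0" for u z
    using that by (simp add: powr_minus)
  have const: "E (\<rho> * u) - E u = H (\<rho> * u) * of_real (\<rho> * u) powr (1 - s) - H u * of_real u powr (1 - s)
      + (s - 1) * (Q (\<rho> * u) - Q u)" if u: "u > 0" for u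
  proof -
    define Z where "Z = (\<lambda>u. E u - H u * of_real u powr (1 - s) - (s - 1) * Q u)"
    have zero: "(Z has_vector_derivative 0) (at u within {0<..})"
      if u: "u \<in> {0<..}" for u
    proof -
      have u0: "u > 0" using u by simp
      note E' = has_vector_derivative_at_within[OF E[OF u0], of "{0<..}"]
        and H' = has_vector_derivative_at_within[OF H[OF u0], of "{0<..}"]
        and Q' = has_vector_derivative_at_within[OF Q[OF u0], of "{0<..}"]
        and pow = has_vector_derivative_of_real_powr[OF u0, of "1 - s" "{0<..}"]
      have "(Z has_vector_derivative
          h u - (H u * ((1 - s) * of_real u powr (1 - s - 1)) + h u * of_real u powr (s - 1) * of_real u powr (1 - s))
            - (s - 1) * (H u * of_real u powr (- s))) (at u within {0<..})"
        unfolding Z_def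
        by (rule has_vector_derivative_diff[OF has_vector_derivative_diff[OF E' has_vector_derivative_mult[OF H' pow]]
              has_vector_derivative_mult_right[OF Q']])
      moreover have "of_real u powr (s - 1) * complex_of_real u powr (1 - s) = 1"
        using inv[of u "s - 1"] u by simp
      ultimately show ?thesis by (simp add: mult.assoc) (simp add: algebra_simps)
    qed
    obtain c where c: "\<And>u. u \<in> {0<..} \<Longrightarrow> Z u = c"
    proof (rule has_vector_derivative_zero_constant[of "{0<..}" Z])
      show "convex {0::real<..}" by simp
      show "(Z has_vector_derivative 0) (at u within {0<..})" if "u \<in> {0<..}" for u
        by (rule zero[OF that])
      show thesis if "\<And>u. u \<in> {0<..} \<Longrightarrow> Z u = c" for c
        using that \<open>\<And>c. (\<And>u. u \<in> {0<..} \<Longrightarrow> Z u = c) \<Longrightarrow> thesis\<close> by blast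
    qed
    have E_eq: "E x = c + H x * of_real x powr (1 - s) + (s - 1) * Q x" if "x > 0" for x
      using c[of x] that by (simp add: Z_def diff_eq_eq)
    have "\<rho> * u > 0" using u lam0 by simp
    then show ?thesis unfolding E_eq[OF u] E_eq[OF \<open>\<rho> * u > 0\<close>] by (simp add: algebra_simps)
  qed
  have I: "((\<lambda>t. H (u * t) * of_real t powr (- s)) has_integral P u) {1..\<rho>}" if u: "u > 0" for u
  proof -
    have "((\<lambda>t. H (u * t) * of_real t powr (- s)) has_integral
        (of_real u powr (s - 1) * Q (u * \<rho>) - of_real u powr (s - 1) * Q (u * 1))) {1..\<rho>}"
    proof (rule fundamental_theorem_of_calculus)
      fix t assume t: "t \<in> {1..\<rho>}"
      then have t0: "t > 0" by auto
      have "((\<lambda>t. of_real u powr (s - 1) * Q (u * t)) has_vector_derivative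
        of_real u powr (s - 1) * (u *\<^sub>R (H (u * t) * of_real (u * t) powr (- s)))) (at t)"
        using u t0 by (intro has_vector_derivative_mult_right has_vector_derivative_dilate Q) auto
      moreover have "of_real u powr (s - 1) * (u *\<^sub>R (H (u * t) * of_real (u * t) powr (- s))) = H (u * t) * of_real t powr (- s)"
      proof -
        have "of_real u powr (s - 1) * (u *\<^sub>R (H (u * t) * of_real (u * t) powr (- s))) =
           H (u * t) * of_real t powr (- s) * ((of_real u * of_real u powr (s - 1)) * of_real u powr (- s))"
          using u t0 unfolding mul[OF u t0] by (simp add: scaleR_conv_of_real)
        also have "of_real u * of_real u powr (s - 1) = complex_of_real u powr s"
          using powr_add_one[OF u, of "s - 1"] by simp
        finally show ?thesis using inv[OF u] by simp
      qed
      ultimately show "((\<lambda>t. of_real u powr (s - 1) * Q (u * t)) has_vector_derivative H (u * t) * of_real t powr (- s)) (at t within {1..\<rho>})"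
        by (simp add: has_vector_derivative_at_within)
    qed (use lam in auto)
    then show ?thesis by (simp add: P_def mult.commute right_diff_distrib)
  qed
  have S: "(E (\<rho> * u) - E u) * of_real u powr (s - 1) =
        H (\<rho> * u) * of_real \<rho> powr (1 - s) - H u + (s - 1) * P u" if u: "u > 0" for u
  proof -
    have 1: "of_real u powr (1 - s) * of_real u powr (s - 1) = (1::complex)"
      using inv[OF u, of "1 - s"] by simp
    have "(E (\<rho> * u) - E u) * of_real u powr (s - 1) =
       H (\<rho> * u) * of_real \<rho> powr (1 - s) * (of_real u powr (1 - s) * of_real u powr (s - 1))
        - H u * (of_real u powr (1 - s) * of_real u powr (s - 1)) + (s - 1) * P u"
      unfolding const[OF u] mul[OF lam0 u] P_def by (simp add: algebra_simps)
    then show ?thesis unfolding 1 by simp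
  qed
  have D: "(P has_vector_derivative (E (\<rho> * u) - E u) * of_real u powr (s - 2)) (at u)" if u: "u > 0" for u
  proof -
    have "(P has_vector_derivative
       of_real u powr (s - 1) * (\<rho> *\<^sub>R (H (\<rho> * u) * of_real (\<rho> * u) powr (- s)) - H u * of_real u powr (- s))
       + ((s - 1) * of_real u powr (s - 1 - 1)) * (Q (\<rho> * u) - Q u)) (at u)"
      unfolding P_def[abs_def]
      using u lam0 by (intro has_vector_derivative_mult has_vector_derivative_of_real_powr
         has_vector_derivative_diff has_vector_derivative_dilate Q) auto
    moreover have "of_real u powr (s - 1) * (\<rho> *\<^sub>R (H (\<rho> * u) * of_real (\<rho> * u) powr (- s)) - H u * of_real u powr (- s))
       + ((s - 1) * of_real u powr (s - 1 - 1)) * (Q (\<rho> * u) - Q u) = (E (\<rho> * u) - E u) * of_real u powr (s - 2)"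
    proof -
      have 1: "of_real u * of_real u powr (s - 2) = complex_of_real u powr (s - 1)"
        using powr_add_one[OF u, of "s - 2"] by simp
      have 2: "of_real u * of_real u powr (- s) = complex_of_real u powr (1 - s)"
        using powr_add_one[OF u, of "- s"] by simp
      have 3: "of_real \<rho> * of_real \<rho> powr (- s) = complex_of_real \<rho> powr (1 - s)"
        using powr_add_one[OF lam0, of "- s"] by simp
      have "s - 1 - 1 = s - 2" by simp
      then show ?thesis
        unfolding const[OF u] mul[OF lam0 u] scaleR_conv_of_real 1[symmetric] 2[symmetric] 3[symmetric]
        by (simp only:) (simp only: algebra_simps)
    qed
    ultimately show ?thesis by simp
  qed
  show ?thesis by (rule that[OF I D S])
qed

lemma dilation_factor:
  assumes "\<rho> > 1"
  obtains c where "((\<lambda>t. complex_of_real t powr (- s)) has_integral c) {1..\<rho>}"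
    "(1 - s) * c = of_real \<rho> powr (1 - s) - 1" "s = 1 \<Longrightarrow> c = of_real (ln \<rho>)"
proof (cases "s = 1")
  case True
  have "((\<lambda>t. complex_of_real (1 / t)) has_integral of_real (ln \<rho> - ln 1)) {1..\<rho>}"
    by (intro has_integral_of_real fundamental_theorem_of_calculus)
       (use assms in \<open>auto intro!: derivative_eq_intros simp: has_real_derivative_iff_has_vector_derivative[symmetric]\<close>)
  then have "((\<lambda>t. complex_of_real t powr (- s)) has_integral of_real (ln \<rho>)) {1..\<rho>}"
    unfolding ln_one diff_0_right
    by (rule has_integral_eq[rotated]) (use True in \<open>auto simp: powr_minus divide_inverse\<close>)
  then show ?thesis using True assms by (intro that) auto
next
  case False
  have "((\<lambda>t. complex_of_real t powr (- s)) has_integral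
     (of_real \<rho> powr (1 - s) / (1 - s) - of_real 1 powr (1 - s) / (1 - s))) {1..\<rho>}"
  proof (rule fundamental_theorem_of_calculus)
    fix t assume "t \<in> {1..\<rho>}"
    then have "((\<lambda>t. of_real t powr (1 - s) / (1 - s)) has_vector_derivative ((1 - s) * of_real t powr (1 - s - 1)) / (1 - s)) (at t within {1..\<rho>})"
      by (intro has_vector_derivative_divide has_vector_derivative_of_real_powr) auto
    then show "((\<lambda>t. of_real t powr (1 - s) / (1 - s)) has_vector_derivative of_real t powr (- s)) (at t within {1..\<rho>})"
      using False by simp
  qed (use assms in auto)
  then have "((\<lambda>t. complex_of_real t powr (- s)) has_integral ((of_real \<rho> powr (1 - s) - 1) / (1 - s))) {1..\<rho>}"
    by (simp add: diff_divide_distrib)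
  then show ?thesis using False by (intro that) auto
qed

lemma norm_powr_le_dilation:
  assumes "t \<in> {1..\<rho>}"
  shows "norm (complex_of_real t powr (- s)) \<le> \<rho> powr \<bar>Re s\<bar>"
proof -
  have "t powr (- Re s) \<le> t powr \<bar>Re s\<bar>" using assms by (intro powr_mono) auto
  also have "\<dots> \<le> \<rho> powr \<bar>Re s\<bar>" using assms by (intro powr_mono2) auto
  finally show ?thesis using assms by (simp add: norm_powr_of_real)
qed

section \<open>Derivatives of Riemann-Liouville integrals\<close>

text \<open>The transform of \<open>g\<close> converges absolutely on the line \<open>Re w = x\<close>, with a margin to the right. The
  margin is what makes a primitive of \<open>g\<close> admissible at \<open>x - 1\<close> also when \<open>x = 1\<close>.\<close>
definition admissible :: "(real \<Rightarrow> real) \<Rightarrow> real \<Rightarrow> bool" where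
  "admissible g x \<longleftrightarrow> continuous_on UNIV g \<and> weighted_integrable g x \<and> (\<exists>\<sigma>>x. weighted_integrable g \<sigma>)"

text \<open>\<open>D k\<close> is the \<open>k\<close>-th derivative of the Riemann-Liouville integral of \<open>g\<close>. The top derivative \<open>D n\<close>
  may be discontinuous and its Mellin integral need only converge conditionally, so that integral is
  represented by an everywhere differentiable primitive \<open>H\<close> and the limit \<open>L\<close> of its increments.\<close>
definition RL_data ::
    "real \<Rightarrow> (real \<Rightarrow> real) \<Rightarrow> nat \<Rightarrow> complex \<Rightarrow> (nat \<Rightarrow> real \<Rightarrow> real) \<Rightarrow> (real \<Rightarrow> complex) \<Rightarrow> complex \<Rightarrow> bool" where
  "RL_data \<gamma> g n s D H L \<longleftrightarrow>
     (\<forall>u>0. D 0 u = riesz \<gamma> g u) \<and>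
     (\<forall>k<n. \<forall>u>0. (D k has_real_derivative D (Suc k) u) (at u)) \<and>
     (\<forall>u>0. (H has_vector_derivative of_real (D n u) * of_real u powr (s - 1)) (at u)) \<and>
     ((\<lambda>(r, R). H R - H r) \<longlongrightarrow> L) halfline_ends"

lemma weighted_integrable_dilation:
  assumes "\<rho> > 0" "weighted_integrable g x"
  shows "weighted_integrable (\<lambda>u. a * g (\<rho> * u) - g u) x"
proof -
  have "set_integrable lborel {0<..} (\<lambda>u. a * \<rho> powr (1 - x) * (g (\<rho> * u) * (\<rho> * u) powr (x - 1)) - g u * u powr (x - 1))"
    using assms halfline_integral_scale(1)[of \<rho> "\<lambda>u. g u * u powr (x - 1)"]
    unfolding weighted_integrable_def by (intro set_integral_diff set_integrable_mult_right) auto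
  also have "?this \<longleftrightarrow> set_integrable lborel {0<..} (\<lambda>u. (a * g (\<rho> * u) - g u) * u powr (x - 1))"
  proof (rule set_integrable_cong[OF refl refl])
    fix u :: real assume "u \<in> {0<..}"
    then have "(\<rho> * u) powr (x - 1) = \<rho> powr (x - 1) * u powr (x - 1)" "\<rho> powr (1 - x) * \<rho> powr (x - 1) = 1"
      using assms by (auto simp: powr_mult powr_add[symmetric])
    then show "a * \<rho> powr (1 - x) * (g (\<rho> * u) * (\<rho> * u) powr (x - 1)) - g u * u powr (x - 1) = (a * g (\<rho> * u) - g u) * u powr (x - 1)"
      by (simp add: left_diff_distrib)
  qed
  finally show ?thesis unfolding weighted_integrable_def .
qed

lemma halfline_mellin_dilation:
  assumes "\<rho> > 0" "continuous_on UNIV g" "weighted_integrable g (Re w)"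
  shows "halfline_mellin (\<lambda>u. a * g (\<rho> * u) - g u) w = (of_real a * of_real \<rho> powr (- w) - 1) * halfline_mellin g w"
proof -
  let ?f = "\<lambda>u. complex_of_real (g u) * of_real u powr (w - 1)"
  have f: "set_integrable lborel {0<..} ?f"
    by (rule mellin_set_integrable) (use assms continuous_on_subset in auto)
  then have f': "set_integrable lborel {0<..} (\<lambda>u. ?f (\<rho> * u))"
    using halfline_integral_scale(1)[of \<rho> ?f] assms(1) by simp
  have "halfline_mellin (\<lambda>u. a * g (\<rho> * u) - g u) w =
     (LINT u:{0<..}|lborel. (of_real a * of_real \<rho> powr (1 - w)) * ?f (\<rho> * u) - ?f u)"
    unfolding halfline_mellin_def
  proof (rule set_lebesgue_integral_cong; safe?)
    fix u :: real assume "u > 0"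
    then have "complex_of_real (\<rho> * u) powr (w - 1) = of_real \<rho> powr (w - 1) * of_real u powr (w - 1)"
       "complex_of_real \<rho> powr (1 - w) * of_real \<rho> powr (w - 1) = 1"
      using assms by (auto simp: powr_times_real powr_add[symmetric])
    moreover have "A * p * (G * (q * U)) = A * G * U" if "p * q = 1" for A p G q U :: complex
      using that by (metis mult.assoc mult.left_commute mult.right_neutral)
    ultimately show "of_real (a * g (\<rho> * u) - g u) * of_real u powr (w - 1) = (of_real a * of_real \<rho> powr (1 - w)) * ?f (\<rho> * u) - ?f u"
      by (simp only: of_real_diff of_real_mult left_diff_distrib)
  qed auto
  also have "\<dots> = (of_real a * of_real \<rho> powr (1 - w)) * (LINT u:{0<..}|lborel. ?f (\<rho> * u)) - (LINT u:{0<..}|lborel. ?f u)"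
    using f f' by (subst set_integral_diff(2)) auto
  also have "(LINT u:{0<..}|lborel. ?f (\<rho> * u)) = halfline_mellin g w / of_real \<rho>"
    using halfline_integral_scale(2)[of \<rho> ?f] assms(1) by (simp add: halfline_mellin_def scaleR_conv_of_real field_simps)
  also have "(of_real a * of_real \<rho> powr (1 - w)) * (halfline_mellin g w / of_real \<rho>) = of_real a * of_real \<rho> powr (- w) * halfline_mellin g w"
    using powr_add_one[OF assms(1), of "- w"] assms(1) by (simp add: field_simps)
  finally show ?thesis by (simp add: halfline_mellin_def algebra_simps)
qed

lemma admissible_dilation:
  assumes "\<rho> > 0" "admissible g x"
  shows "admissible (\<lambda>u. a * g (\<rho> * u) - g u) x"
proof -
  have "continuous_on UNIV g" using assms by (simp add: admissible_def)
  then have "continuous_on UNIV (\<lambda>u. a * g (\<rho> * u) - g u)"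
    by (intro continuous_on_diff continuous_on_mult_left continuous_on_compose2[of UNIV g UNIV "\<lambda>u. \<rho> * u"]
          continuous_on_id) auto
  then show ?thesis using assms weighted_integrable_dilation unfolding admissible_def by blast
qed

lemma riesz_dilation:
  assumes \<gamma>: "\<gamma> > 0" and \<rho>: "\<rho> > 0" and g: "continuous_on UNIV g" and u: "u > 0"
  shows "riesz \<gamma> (\<lambda>u. a * g (\<rho> * u) - g u) u = a * \<rho> powr (- \<gamma>) * riesz \<gamma> g (\<rho> * u) - riesz \<gamma> g u"
proof -
  have i: "(\<lambda>x. g (u * (1 - x powr (1 / \<gamma>)))) integrable_on {0..1}" for u
    by (intro integrable_continuous_real continuous_on_riesz_integrand[OF \<gamma> g]) auto
  let ?I = "integral {0..1} (\<lambda>x. g (\<rho> * u * (1 - x powr (1 / \<gamma>))))"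
  have 1: "integral {0..1} (\<lambda>x. a * g (\<rho> * (u * (1 - x powr (1 / \<gamma>)))) - g (u * (1 - x powr (1 / \<gamma>)))) =
    a * ?I - integral {0..1} (\<lambda>x. g (u * (1 - x powr (1 / \<gamma>))))"
    using i[of u] i[of "\<rho> * u"] by (subst integral_diff) (auto simp: mult.assoc intro: integrable_on_mult_right)
  have 2: "\<rho> powr (- \<gamma>) * (\<rho> * u) powr \<gamma> = u powr \<gamma>"
    using \<rho> u by (simp add: powr_mult powr_minus)
  have 3: "a * \<rho> powr (- \<gamma>) * ((\<rho> * u) powr \<gamma> / \<gamma> * ?I) = a * (\<rho> powr (- \<gamma>) * (\<rho> * u) powr \<gamma>) / \<gamma> * ?I"
    by simp
  show ?thesis unfolding riesz_def 1 3 2 by (simp add: right_diff_distrib)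
qed

lemma norm_integral_dilation_le:
  fixes f :: "real \<Rightarrow> complex"
  assumes "\<rho> > 1" and int: "((\<lambda>t. f t * of_real t powr (- s)) has_integral I) {1..\<rho>}"
    and e: "\<And>t. t \<in> {1..\<rho>} \<Longrightarrow> norm (f t) \<le> e" "e \<ge> 0"
  shows "norm I \<le> e * (\<rho> powr \<bar>Re s\<bar> * (\<rho> - 1))"
proof -
  have "norm I \<le> (e * \<rho> powr \<bar>Re s\<bar>) * measure lborel (cbox 1 \<rho>)"
  proof (rule has_integral_bound)
    show "norm (f t * of_real t powr (- s)) \<le> e * \<rho> powr \<bar>Re s\<bar>" if "t \<in> cbox 1 \<rho>" for t
      unfolding norm_mult using that e norm_powr_le_dilation[of t \<rho> s] by (intro mult_mono) auto
  qed (use int e in auto)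
  then show ?thesis using assms(1) by (simp add: mult.assoc)
qed

text \<open>Partial integration in \<open>\<integral> D (n+1) u\<^sup>s\<^sup>-\<^sup>1\<close> would leave boundary terms that conditional convergence does
  not control. Instead replace \<open>g\<close> by \<open>\<rho>\<^sup>\<gamma>\<^sup>-\<^sup>n g(\<rho> u) - g(u)\<close>. The \<open>n\<close>-th derivative of its
  Riemann-Liouville integral is \<open>D n (\<rho> u) - D n u\<close>, whose Mellin integral at \<open>s - 1\<close> is
  \<open>L \<integral>\<^sub>1\<^sup>\<rho> t\<^sup>-\<^sup>s dt\<close> by \<open>scaled_difference\<close>, and \<open>w\<close> is unchanged. Both sides of the identity acquire the
  factor \<open>\<rho>\<^sup>1\<^sup>-\<^sup>s - 1\<close>, up to the \<open>1 - s\<close> that turns \<open>\<Gamma>(1 - s)\<close> into \<open>\<Gamma>(2 - s)\<close>.\<close>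
lemma dilation_step:
  fixes \<gamma> :: real
  assumes \<gamma>: "\<gamma> > 0"
    and IH: "\<And>g s D H L. admissible g (Re w) \<Longrightarrow> w = s - of_nat n + of_real \<gamma> \<Longrightarrow> RL_data \<gamma> g n s D H L \<Longrightarrow>
        L = Gamma (of_real \<gamma>) * Gamma (1 - w) * rGamma (1 - s) * halfline_mellin g w"
    and g: "admissible g (Re w)" and w: "w = s - of_nat (Suc n) + of_real \<gamma>" and data: "RL_data \<gamma> g (Suc n) s D H L"
  shows "L = Gamma (of_real \<gamma>) * Gamma (1 - w) * rGamma (1 - s) * halfline_mellin g w"
proof -
  \<comment> \<open>then \<open>\<rho>\<^sup>1\<^sup>-\<^sup>s\<close> is the exponential of a number of modulus 1, hence different from 1, unless \<open>s = 1\<close>\<close>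
  define x where "x = (if s = 1 then 1 else 1 / norm (1 - s))"
  define \<rho> where "\<rho> = exp x"
  have x: "x > 0" by (auto simp: x_def)
  then have \<rho>: "\<rho> > 1" "\<rho> > 0" by (auto simp: \<rho>_def)
  have gc: "continuous_on UNIV g" and gi: "weighted_integrable g (Re w)" using g by (auto simp: admissible_def)
  have nz: "of_real \<rho> powr (1 - s) \<noteq> (1 :: complex)" if "s \<noteq> 1"
  proof
    assume eq: "of_real \<rho> powr (1 - s) = (1 :: complex)"
    have "of_real \<rho> powr (1 - s) = exp ((1 - s) * of_real x)"
      by (simp add: powr_def \<rho>_def Ln_of_real)
    with eq obtain k :: int where k: "Re ((1 - s) * of_real x) = 0" "Im ((1 - s) * of_real x) = of_int (2 * k) * pi"
      by (auto simp only: exp_eq_1)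
    moreover have n1: "norm ((1 - s) * of_real x) = 1" using that by (simp add: norm_mult norm_divide x_def)
    ultimately have k1: "\<bar>2 * real_of_int k * pi\<bar> = 1" by (simp add: cmod_eq_Im)
    have "k \<noteq> 0" using k1 by auto
    then have "1 \<le> \<bar>real_of_int k\<bar>" by linarith
    then have "2 * 1 * pi \<le> \<bar>2 * real_of_int k * pi\<bar>" unfolding abs_mult using pi_gt_zero by simp
    then show False using pi_gt3 k1 by simp
  qed
  obtain c where c: "((\<lambda>t. complex_of_real t powr (- s)) has_integral c) {1..\<rho>}"
    "(1 - s) * c = of_real \<rho> powr (1 - s) - 1" "s = 1 \<Longrightarrow> c = of_real (ln \<rho>)"
    using dilation_factor[OF \<rho>(1), of s] by blast
  have D0: "\<And>u. u > 0 \<Longrightarrow> D 0 u = riesz \<gamma> g u"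
    and D: "\<And>k u. k < Suc n \<Longrightarrow> u > 0 \<Longrightarrow> (D k has_real_derivative D (Suc k) u) (at u)"
    and H: "\<And>u. u > 0 \<Longrightarrow> (H has_vector_derivative of_real (D (Suc n) u) * of_real u powr (s - 1)) (at u)"
    and L: "((\<lambda>(r, R). H R - H r) \<longlongrightarrow> L) halfline_ends"
    using data by (auto simp: RL_data_def)
  have E: "((\<lambda>u. complex_of_real (D n u)) has_vector_derivative of_real (D (Suc n) u)) (at u)" if "u > 0" for u
    using D[of n u] that by (intro has_vector_derivative_of_real) (auto simp: has_real_derivative_iff_has_vector_derivative)
  obtain P where
    P1: "\<And>u. u > 0 \<Longrightarrow> ((\<lambda>t. H (u * t) * of_real t powr (- s)) has_integral P u) {1..\<rho>}" and
    P2: "\<And>u. u > 0 \<Longrightarrow> (P has_vector_derivative (of_real (D n (\<rho> * u)) - of_real (D n u)) * of_real u powr (s - 2)) (at u)"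
    by (rule scaled_difference[OF \<rho>(1) E H]) (assumption | rule that)+
  define g' where "g' = (\<lambda>u. \<rho> powr (\<gamma> - real n) * g (\<rho> * u) - g u)"
  define D' where "D' = (\<lambda>k u. \<rho> powr (real k - real n) * D k (\<rho> * u) - D k u)"
  have "RL_data \<gamma> g' n (s - 1) D' P (L * c)"
    unfolding RL_data_def
  proof (intro conjI allI impI)
    fix u :: real assume u: "u > 0"
    show "D' 0 u = riesz \<gamma> g' u"
      using u \<rho> by (simp add: D'_def g'_def riesz_dilation[OF \<gamma> \<rho>(2) gc u] D0 powr_add[symmetric] mult.assoc)
    show "(D' k has_real_derivative D' (Suc k) u) (at u)" if "k < n" for k
    proof -
      have "((\<lambda>u. D k (\<rho> * u)) has_real_derivative D (Suc k) (\<rho> * u) * \<rho>) (at u)"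
        by (rule DERIV_chain2[OF D]) (use that u \<rho> in \<open>auto intro!: derivative_eq_intros\<close>)
      then have "(D' k has_real_derivative (\<rho> powr (real k - real n) * (D (Suc k) (\<rho> * u) * \<rho>) - D (Suc k) u)) (at u)"
        unfolding D'_def by (intro DERIV_diff DERIV_cmult D) (use that u in auto)
      moreover have "\<rho> powr (real (Suc k) - real n) = \<rho> * \<rho> powr (real k - real n)"
        using \<rho> by (simp add: powr_mult_base algebra_simps)
      ultimately show ?thesis by (simp add: D'_def mult_ac)
    qed
    show "(P has_vector_derivative of_real (D' n u) * of_real u powr (s - 1 - 1)) (at u)"
      using P2[OF u] \<rho> by (simp add: D'_def)
  next
    define C where "C = \<rho> powr \<bar>Re s\<bar> * (\<rho> - 1)"
    have C: "C > 0" using \<rho> by (simp add: C_def)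
    show "((\<lambda>(r, R). P R - P r) \<longlongrightarrow> L * c) halfline_ends"
      unfolding halfline_ends_iff
    proof (intro allI impI)
      fix e :: real assume e: "e > 0"
      then have "e / (2 * C) > 0" using C by simp
      with L obtain a b where ab: "a > 0" "\<And>r R. 0 < r \<Longrightarrow> r < a \<Longrightarrow> b \<le> R \<Longrightarrow> dist (H R - H r) L < e / (2 * C)"
        unfolding halfline_ends_iff by metis
      show "\<exists>a>0. \<exists>b. \<forall>r R. 0 < r \<and> r < a \<and> b \<le> R \<longrightarrow> dist (P R - P r) (L * c) < e"
      proof (intro exI conjI allI impI)
        show "a / \<rho> > 0" using ab \<rho> by simp
        fix r R assume rR: "0 < r \<and> r < a / \<rho> \<and> max b 1 \<le> R"
        have "((\<lambda>t. H (R * t) * of_real t powr (- s) - H (r * t) * of_real t powr (- s) - L * of_real t powr (- s))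
             has_integral (P R - P r - L * c)) {1..\<rho>}"
          using rR by (intro has_integral_diff P1 has_integral_mult_right c) auto
        then have "((\<lambda>t. (H (R * t) - H (r * t) - L) * of_real t powr (- s)) has_integral (P R - P r - L * c)) {1..\<rho>}"
          by (simp add: algebra_simps)
        then have "norm (P R - P r - L * c) \<le> e / (2 * C) * (\<rho> powr \<bar>Re s\<bar> * (\<rho> - 1))"
        proof (rule norm_integral_dilation_le[OF \<rho>(1)])
          fix t assume t: "t \<in> {1..\<rho>}"
          have "r * t \<le> r * \<rho>" using rR t by (intro mult_left_mono) auto
          also have "\<dots> < a" using rR \<rho> by (simp add: field_simps)
          finally have "r * t < a" .
          moreover have "R * 1 \<le> R * t" using rR t by (intro mult_left_mono) auto
          then have "b \<le> R * t" using rR by linarith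
          moreover have "0 < r * t" using rR t by (intro mult_pos_pos) auto
          ultimately show "norm (H (R * t) - H (r * t) - L) \<le> e / (2 * C)"
            using ab(2)[of "r * t" "R * t"] by (simp add: dist_norm)
        qed (use e C in auto)
        also have "\<dots> < e" using e C by (simp flip: C_def)
        finally show "dist (P R - P r) (L * c) < e" by (simp add: dist_norm)
      qed
    qed
  qed
  then have "L * c = Gamma (of_real \<gamma>) * Gamma (1 - w) * rGamma (1 - (s - 1)) * halfline_mellin g' w"
  proof (rule IH[rotated 2])
    show "admissible g' (Re w)" unfolding g'_def by (rule admissible_dilation[OF \<rho>(2) g])
    show "w = s - 1 - of_nat n + of_real \<gamma>" using w by simp
  qed
  also have "halfline_mellin g' w = (of_real \<rho> powr (1 - s) - 1) * halfline_mellin g w"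
  proof -
    have "complex_of_real (\<rho> powr (\<gamma> - real n)) * of_real \<rho> powr (- w) = of_real \<rho> powr (1 - s)"
      using \<rho> by (simp add: powr_of_real[symmetric] powr_add[symmetric] w algebra_simps)
    then show ?thesis unfolding g'_def using halfline_mellin_dilation[OF \<rho>(2) gc gi] by simp
  qed
  finally have eq: "L * c = Gamma (of_real \<gamma>) * Gamma (1 - w) * rGamma (1 - (s - 1)) * ((1 - s) * c) * halfline_mellin g w"
    using c(2) by simp
  have "(1 - s) * rGamma ((1 - s) + 1) = rGamma (1 - s)" by (rule rGamma_plus1)
  then have rG: "rGamma (1 - (s - 1)) * (1 - s) = rGamma (1 - s)" by (simp add: algebra_simps)
  have "c \<noteq> 0"
  proof (cases "s = 1")
    case True then show ?thesis using c(3) \<rho> by simp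
  next
    case False then show ?thesis using c(2) nz by auto
  qed
  moreover from eq have "L * c = (Gamma (of_real \<gamma>) * Gamma (1 - w) * (rGamma (1 - (s - 1)) * (1 - s)) * halfline_mellin g w) * c"
    by (simp only: mult_ac)
  ultimately show ?thesis unfolding rG by simp
qed

section \<open>Vanishing moments and continuation across integer lines\<close>

text \<open>If \<open>m\<close> is the total integral of \<open>g\<close>, the Riemann-Liouville integral of \<open>g\<close> behaves on average like
  \<open>m u\<^sup>\<gamma>\<^sup>-\<^sup>1\<close> at infinity, and its Mellin integral at \<open>s\<close> can only converge for \<open>Re s + \<gamma> \<ge> 1\<close> if
  \<open>m = 0\<close>. Averaging is unavoidable since \<open>g\<close> need not decay pointwise: the increment of the
  integral of order \<open>\<gamma> + 1\<close> from \<open>u\<close> to \<open>2 u\<close> is of exact order \<open>m u\<^sup>\<gamma>\<close>, but it is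
  \<open>o(u powr (1 - Re s))\<close> because \<open>H\<close> is Cauchy at infinity.\<close>
lemma moment_vanishes:
  fixes g G :: "real \<Rightarrow> real" and H :: "real \<Rightarrow> complex"
  assumes \<gamma>: "\<gamma> > 0" and g: "continuous_on UNIV g"
    and G: "\<And>u. (G has_real_derivative g u) (at u)" "G 0 = 0" "(G \<longlongrightarrow> m) at_top"
    and H: "\<And>u. u > 0 \<Longrightarrow> (H has_vector_derivative of_real (riesz \<gamma> g u) * of_real u powr (s - 1)) (at u)"
    and L: "((\<lambda>(r, R). H R - H r) \<longlongrightarrow> L) halfline_ends"
    and s: "Re s + \<gamma> \<ge> 1"
  shows "m = 0"
proof -
  define E where "E = (\<lambda>u. complex_of_real (riesz \<gamma> G u))"
  have Gc: "continuous_on UNIV G" using G(1) by (meson DERIV_continuous_on DERIV_subset subset_UNIV)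
  have E: "(E has_vector_derivative of_real (riesz \<gamma> g u)) (at u)" if "u > 0" for u
    unfolding E_def using riesz_has_real_derivative[OF \<gamma> g G(1,2) that]
    by (intro has_vector_derivative_of_real) (simp add: has_real_derivative_iff_has_vector_derivative)
  have two: "(1::real) < 2" by simp
  obtain P where
    P1: "\<And>u. u > 0 \<Longrightarrow> ((\<lambda>t. H (u * t) * of_real t powr (- s)) has_integral P u) {1..2}" and
    P2: "\<And>u. u > 0 \<Longrightarrow> (E (2 * u) - E u) * of_real u powr (s - 1) =
        H (2 * u) * of_real 2 powr (1 - s) - H u + (s - 1) * P u"
    by (rule scaled_difference[OF two E H]) (assumption | rule that)+
  obtain c where c: "((\<lambda>t. complex_of_real t powr (- s)) has_integral c) {1..2}"
    "(1 - s) * c = of_real 2 powr (1 - s) - 1"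
    using dilation_factor[of 2 s] by auto
  define C where "C = (2::real) powr \<bar>Re s\<bar> * (2 - 1)"
  define K where "K = norm (complex_of_real 2 powr (1 - s)) + 1 + norm (s - 1) * C"
  have C: "C > 0" by (simp add: C_def)
  have K: "K > 0" unfolding K_def using C by (auto intro!: add_nonneg_pos add_pos_nonneg)
  have X: "((\<lambda>u. (E (2 * u) - E u) * of_real u powr (s - 1)) \<longlongrightarrow> 0) at_top"
  proof (rule tendstoI)
    fix e :: real assume e: "e > 0"
    define e' where "e' = e / (2 * K)"
    have e': "e' > 0" using e K by (simp add: e'_def)
    with L obtain a b where ab: "a > 0" "\<And>r R. 0 < r \<Longrightarrow> r < a \<Longrightarrow> b \<le> R \<Longrightarrow> dist (H R - H r) L < e'"
      unfolding halfline_ends_iff by metis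
    \<comment> \<open>an approximate limit of \<open>H\<close> at infinity; the constant drops out because of the value of \<open>c\<close>\<close>
    define B where "B = H (a / 2) + L"
    have B: "norm (H R - B) \<le> e'" if "R \<ge> b" for R
      using ab(2)[of "a / 2" R] ab(1) that by (simp add: B_def dist_norm algebra_simps)
    have "norm ((E (2 * u) - E u) * of_real u powr (s - 1)) < e" if u: "u \<ge> max b 1" for u
    proof -
      have u0: "u > 0" using u by auto
      have "((\<lambda>t. H (u * t) * of_real t powr (- s) - B * of_real t powr (- s)) has_integral (P u - B * c)) {1..2}"
        by (intro has_integral_diff P1 u0 has_integral_mult_right c)
      then have "((\<lambda>t. (H (u * t) - B) * of_real t powr (- s)) has_integral (P u - B * c)) {1..2}"
        by (simp add: algebra_simps)
      then have n1: "norm (P u - B * c) \<le> e' * C"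
        unfolding C_def
      proof (rule norm_integral_dilation_le[rotated])
        fix t :: real assume t: "t \<in> {1..2}"
        have "u * 1 \<le> u * t" using t u0 by (intro mult_left_mono) auto
        then have "b \<le> u * t" using u by linarith
        then show "norm (H (u * t) - B) \<le> e'" by (rule B)
      qed (use e' in auto)
      have "(E (2 * u) - E u) * of_real u powr (s - 1) =
         (H (2 * u) - B) * of_real 2 powr (1 - s) - (H u - B) + (s - 1) * (P u - B * c)
          + B * ((of_real 2 powr (1 - s) - 1) - (1 - s) * c)"
        unfolding P2[OF u0] by (simp add: algebra_simps)
      also have "\<dots> = (H (2 * u) - B) * of_real 2 powr (1 - s) - (H u - B) + (s - 1) * (P u - B * c)"
        unfolding c(2) by simp
      finally have eq: "(E (2 * u) - E u) * of_real u powr (s - 1) = \<dots>" .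
      have "norm ((E (2 * u) - E u) * of_real u powr (s - 1)) \<le>
         norm (H (2 * u) - B) * norm (complex_of_real 2 powr (1 - s)) + norm (H u - B) + norm (s - 1) * norm (P u - B * c)"
        unfolding eq norm_mult[symmetric]
        by (rule order_trans[OF norm_triangle_ineq]) (intro add_mono norm_triangle_ineq4 order_refl)
      also have "\<dots> \<le> e' * norm (complex_of_real 2 powr (1 - s)) + e' + norm (s - 1) * (e' * C)"
        using u n1 by (intro add_mono mult_right_mono mult_left_mono B) auto
      also have "\<dots> = e' * K" by (simp add: K_def algebra_simps)
      also have "\<dots> < e" using e K by (simp add: e'_def)
      finally show ?thesis .
    qed
    then show "eventually (\<lambda>u. dist ((E (2 * u) - E u) * of_real u powr (s - 1)) 0 < e) at_top"
      using eventually_ge_at_top[of "max b 1"] by (auto elim!: eventually_mono)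
  qed
  define q where "q = (\<lambda>u. riesz \<gamma> G u / u powr \<gamma>)"
  have q: "(q \<longlongrightarrow> m / \<gamma>) at_top" unfolding q_def by (rule riesz_asymptotics[OF \<gamma> Gc G(3)])
  have "filterlim (\<lambda>u. 2 * u :: real) at_top at_top"
    by (rule filterlim_tendsto_pos_mult_at_top[OF tendsto_const]) (auto simp: filterlim_ident)
  from filterlim_compose[OF q this] have q2: "((\<lambda>u. q (2 * u)) \<longlongrightarrow> m / \<gamma>) at_top" .
  have "((\<lambda>u. 2 powr \<gamma> * q (2 * u) - q u) \<longlongrightarrow> 2 powr \<gamma> * (m / \<gamma>) - m / \<gamma>) at_top"
    by (intro tendsto_intros q q2)
  moreover have "((\<lambda>u. 2 powr \<gamma> * q (2 * u) - q u) \<longlongrightarrow> 0) at_top"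
  proof (rule Lim_null_comparison[OF _ tendsto_norm_zero[OF X]])
    show "eventually (\<lambda>u. norm (2 powr \<gamma> * q (2 * u) - q u) \<le> norm ((E (2 * u) - E u) * of_real u powr (s - 1))) at_top"
      using eventually_ge_at_top[of 1]
    proof eventually_elim
      case (elim u)
      have "2 powr \<gamma> * q (2 * u) - q u = (riesz \<gamma> G (2 * u) - riesz \<gamma> G u) * u powr (- \<gamma>)"
        using elim by (simp add: q_def powr_mult powr_minus field_simps)
      then have "norm (2 powr \<gamma> * q (2 * u) - q u) = \<bar>riesz \<gamma> G (2 * u) - riesz \<gamma> G u\<bar> * u powr (- \<gamma>)"
        by (simp add: abs_mult)
      also have "\<dots> \<le> \<bar>riesz \<gamma> G (2 * u) - riesz \<gamma> G u\<bar> * u powr (Re s - 1)"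
        using elim s by (intro mult_left_mono powr_mono) auto
      also have "\<dots> = norm ((E (2 * u) - E u) * of_real u powr (s - 1))"
        using elim by (simp add: E_def norm_mult norm_powr_of_real flip: of_real_diff)
      finally show ?case .
    qed
  qed
  ultimately have "2 powr \<gamma> * (m / \<gamma>) - m / \<gamma> = 0"
    using tendsto_unique trivial_limit_at_top_linorder by blast
  then have "(2 powr \<gamma> - 1) * m = 0" using \<gamma> by (simp add: field_simps)
  moreover have "2 powr \<gamma> > (2 powr 0 :: real)" using \<gamma> by (intro powr_less_mono) auto
  ultimately show ?thesis using \<gamma> by auto
qed

lemma primitive_ends_limit:
  fixes f H :: "real \<Rightarrow> complex"
  assumes f: "set_integrable lborel {0<..} f"
    and H: "\<And>u. u > 0 \<Longrightarrow> (H has_vector_derivative f u) (at u)"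
    and L: "((\<lambda>(r, R). H R - H r) \<longlongrightarrow> L) halfline_ends"
  shows "L = (LINT u:{0<..}|lborel. f u)"
proof -
  have "((\<lambda>(r, R). H R - H r) \<longlongrightarrow> (LINT u:{0<..}|lborel. f u)) halfline_ends"
  proof (rule tendsto_halfline_ends_cong)
    show "((\<lambda>x. LINT u:{fst x..snd x}|lborel. f u) \<longlongrightarrow> (LINT u:{0<..}|lborel. f u)) halfline_ends"
      using tendsto_halfline_integral[OF f] by (simp add: case_prod_unfold)
    fix r R :: real assume rR: "0 < r" "r \<le> 1" "1 \<le> R"
    have "set_integrable lborel {r..R} f" by (rule set_integrable_subset[OF f]) (use rR in auto)
    then have "(LINT u:{r..R}|lborel. f u) = integral {r..R} f" by (rule set_borel_integral_eq_integral(2))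
    also have "(f has_integral (H R - H r)) {r..R}"
      by (rule fundamental_theorem_of_calculus) (use rR H in \<open>auto intro: has_vector_derivative_at_within\<close>)
    then have "integral {r..R} f = H R - H r" by (rule integral_unique)
    finally show "(LINT u:{r..R}|lborel. f u) = H R - H r" .
  qed
  then show ?thesis using L tendsto_unique[OF halfline_ends_nontrivial] by blast
qed

lemma admissible_integrable:
  assumes "admissible g x" "x \<ge> 1"
  shows "set_integrable lborel {0..} g"
proof -
  have g: "continuous_on UNIV g" "weighted_integrable g x" using assms by (auto simp: admissible_def)
  have "set_integrable lborel {0..1} g"
    by (rule borel_integrable_atLeastAtMost') (use g continuous_on_subset in auto)
  moreover have "set_integrable lborel {1..} (\<lambda>u. g u * u powr (x - 1))"
    by (rule set_integrable_subset[OF g(2)[unfolded weighted_integrable_def]]) auto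
  then have "set_integrable lborel {1..} g"
  proof (rule set_integrable_bound)
    have "set_borel_measurable borel {1..} g"
      by (rule set_borel_measurable_if_continuous) (use g continuous_on_subset in auto)
    then show "set_borel_measurable lborel {1..} g" by (simp add: set_borel_measurable_def)
    show "AE u in lborel. u \<in> {1..} \<longrightarrow> norm (g u) \<le> norm (g u * u powr (x - 1))"
    proof (intro AE_I2 impI)
      fix u :: real assume "u \<in> {1..}"
      then have "1 \<le> u powr (x - 1)" using assms by (simp add: ge_one_powr_ge_zero)
      then have "\<bar>g u\<bar> * 1 \<le> \<bar>g u\<bar> * u powr (x - 1)" by (intro mult_left_mono) auto
      then show "norm (g u) \<le> norm (g u * u powr (x - 1))" by (simp add: abs_mult)
    qed
  qed
  ultimately have "set_integrable lborel ({0..1} \<union> {1..}) g" by (rule set_integrable_Un) auto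
  moreover have "{0..1} \<union> {1..} = {0::real..}" by auto
  ultimately show ?thesis by simp
qed

text \<open>The decay of \<open>G u = - \<integral>\<^sub>u\<^sup>\<infinity> g\<close> follows by taking the weight \<open>\<tau>\<^sup>\<sigma>\<^sup>-\<^sup>1 \<ge> u\<^sup>\<sigma>\<^sup>-\<^sup>1\<close> into the integral.\<close>
lemma antiderivative_bounds:
  fixes g G :: "real \<Rightarrow> real"
  assumes g: "continuous_on UNIV g" "weighted_integrable g \<sigma>" and \<sigma>: "\<sigma> \<ge> 1"
    and G: "\<And>u. (G has_real_derivative g u) (at u)" "G 0 = 0" "(G \<longlongrightarrow> 0) at_top"
  obtains C where "C \<ge> 0" "\<And>u. 0 \<le> u \<Longrightarrow> u \<le> 1 \<Longrightarrow> \<bar>G u\<bar> \<le> C * u"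
    "\<And>u. u \<ge> 1 \<Longrightarrow> \<bar>G u\<bar> \<le> C * u powr (1 - \<sigma>)"
proof -
  have FTC: "(g has_integral (G b - G a)) {a..b}" if "a \<le> b" for a b
    by (rule fundamental_theorem_of_calculus[OF that])
       (use G(1) in \<open>auto simp: has_real_derivative_iff_has_vector_derivative intro: has_vector_derivative_at_within\<close>)
  have "bounded (g ` {0..1})"
    by (intro compact_imp_bounded compact_continuous_image continuous_on_subset[OF g(1)]) auto
  then obtain C0 where C0: "\<And>u. u \<in> {0..1} \<Longrightarrow> norm (g u) \<le> C0" unfolding bounded_iff by blast
  define C1 where "C1 = (LINT u:{0<..}|lborel. \<bar>g u\<bar> * u powr (\<sigma> - 1))"
  have gi: "set_integrable lborel {0<..} (\<lambda>u. \<bar>g u\<bar> * u powr (\<sigma> - 1))"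
    using set_integrable_abs[OF g(2)[unfolded weighted_integrable_def]] by (simp add: abs_mult)
  have C00: "C0 \<ge> 0" using C0[of 0] by (auto intro: order_trans[OF norm_ge_zero])
  have C10: "C1 \<ge> 0" unfolding C1_def set_lebesgue_integral_def by (intro Bochner_Integration.integral_nonneg) auto
  have small: "\<bar>G u\<bar> \<le> C0 * u" if u: "0 \<le> u" "u \<le> 1" for u
  proof -
    have "norm (G u - G 0) \<le> C0 * measure lborel {0..u}"
      by (rule has_integral_bound_real[OF C00 finite.emptyI FTC]) (use u C0 in auto)
    then show ?thesis using u G(2) by simp
  qed
  have large: "\<bar>G u\<bar> \<le> C1 * u powr (1 - \<sigma>)" if u: "u \<ge> 1" for u
  proof (rule tendsto_upperbound)
    show "((\<lambda>R. \<bar>G R - G u\<bar>) \<longlongrightarrow> \<bar>G u\<bar>) at_top"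
      using tendsto_rabs[OF tendsto_diff[OF G(3) tendsto_const[of "G u"]]] by simp
    show "eventually (\<lambda>R. \<bar>G R - G u\<bar> \<le> C1 * u powr (1 - \<sigma>)) at_top"
      using eventually_ge_at_top[of u]
    proof eventually_elim
      case (elim R)
      have gu: "continuous_on {u..R} g" using g continuous_on_subset by blast
      have i1: "set_integrable lborel {u..R} (\<lambda>t. \<bar>g t\<bar>)"
        by (rule borel_integrable_atLeastAtMost') (intro continuous_intros gu)
      have i2: "set_integrable lborel {u..R} (\<lambda>t. \<bar>g t\<bar> * t powr (\<sigma> - 1))"
        by (rule set_integrable_subset[OF gi]) (use u in auto)
      have "\<bar>G R - G u\<bar> \<le> integral {u..R} (\<lambda>t. \<bar>g t\<bar>)"
        using FTC[OF elim] i1 set_borel_integral_eq_integral(1)[OF i1]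
        by (metis abs_ge_self has_integral_integrable integral_norm_bound_integral integral_unique real_norm_def order_refl)
      also have "\<dots> = (LINT t:{u..R}|lborel. \<bar>g t\<bar>)"
        using set_borel_integral_eq_integral(2)[OF i1] by simp
      also have "\<dots> \<le> (LINT t:{u..R}|lborel. u powr (1 - \<sigma>) * (\<bar>g t\<bar> * t powr (\<sigma> - 1)))"
      proof (rule set_integral_mono[OF i1])
        show "set_integrable lborel {u..R} (\<lambda>t. u powr (1 - \<sigma>) * (\<bar>g t\<bar> * t powr (\<sigma> - 1)))" using i2 by simp
        fix t assume t: "t \<in> {u..R}"
        have "u powr (1 - \<sigma>) * u powr (\<sigma> - 1) = 1" using u by (simp add: powr_add[symmetric])
        moreover have "u powr (\<sigma> - 1) \<le> t powr (\<sigma> - 1)" using t u \<sigma> by (intro powr_mono2) auto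
        then have "u powr (1 - \<sigma>) * u powr (\<sigma> - 1) \<le> u powr (1 - \<sigma>) * t powr (\<sigma> - 1)" by (intro mult_left_mono) auto
        ultimately have "\<bar>g t\<bar> * 1 \<le> \<bar>g t\<bar> * (u powr (1 - \<sigma>) * t powr (\<sigma> - 1))" by (intro mult_left_mono) auto
        then show "\<bar>g t\<bar> \<le> u powr (1 - \<sigma>) * (\<bar>g t\<bar> * t powr (\<sigma> - 1))" by (simp add: mult_ac)
      qed
      also have "\<dots> = u powr (1 - \<sigma>) * (LINT t:{u..R}|lborel. \<bar>g t\<bar> * t powr (\<sigma> - 1))" by simp
      also have "(LINT t:{u..R}|lborel. \<bar>g t\<bar> * t powr (\<sigma> - 1)) \<le> C1"
        unfolding C1_def set_lebesgue_integral_def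
        by (rule Bochner_Integration.integral_mono)
           (use i2 gi u in \<open>auto simp: set_integrable_def indicator_def\<close>)
      then have "u powr (1 - \<sigma>) * (LINT t:{u..R}|lborel. \<bar>g t\<bar> * t powr (\<sigma> - 1)) \<le> u powr (1 - \<sigma>) * C1"
        by (intro mult_left_mono) auto
      finally show ?case by (simp add: mult.commute)
    qed
  qed simp
  show ?thesis
  proof (rule that[of "max C0 C1"])
    show "\<bar>G u\<bar> \<le> max C0 C1 * u" if "0 \<le> u" "u \<le> 1" for u
      using small[OF that] that by (meson max.cobounded1 mult_right_mono order_trans)
    show "\<bar>G u\<bar> \<le> max C0 C1 * u powr (1 - \<sigma>)" if "u \<ge> 1" for u
      using large[OF that] by (meson max.cobounded2 mult_right_mono order_trans powr_ge_zero)
  qed (use C00 in auto)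
qed

lemma weighted_measurable:
  fixes g :: "real \<Rightarrow> real"
  assumes g: "continuous_on UNIV g" and A: "A \<subseteq> {0<..}" "A \<in> sets borel"
  shows "set_borel_measurable lborel A (\<lambda>u. g u * u powr (x - 1))"
proof -
  have "continuous_on {0<..} (\<lambda>u. g u * u powr (x - 1))"
    by (auto intro!: continuous_intros continuous_on_subset[OF g])
  then have "continuous_on A (\<lambda>u. g u * u powr (x - 1))"
    using A(1) by (rule continuous_on_subset)
  from set_borel_measurable_if_continuous[OF A(2) this] show ?thesis
    by (simp add: set_borel_measurable_def)
qed

lemma antiderivative_weighted_integrable:
  assumes g: "continuous_on UNIV g" "weighted_integrable g \<sigma>" and \<sigma>: "\<sigma> \<ge> 1"
    and G: "\<And>u. (G has_real_derivative g u) (at u)" "G 0 = 0" "(G \<longlongrightarrow> 0) at_top"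
    and y: "0 \<le> y" "y < \<sigma> - 1"
  shows "weighted_integrable G y"
proof -
  obtain C where C: "C \<ge> 0" "\<And>u. 0 \<le> u \<Longrightarrow> u \<le> 1 \<Longrightarrow> \<bar>G u\<bar> \<le> C * u"
    "\<And>u. u \<ge> 1 \<Longrightarrow> \<bar>G u\<bar> \<le> C * u powr (1 - \<sigma>)"
    using antiderivative_bounds[OF g \<sigma> G] by blast
  have Gc: "continuous_on UNIV G" using G(1) by (meson DERIV_continuous_on DERIV_subset subset_UNIV)
  note m = weighted_measurable[OF Gc]
  have "set_integrable lborel {0<..1::real} (\<lambda>u. C)"
    by (rule set_integrable_subset[of _ "{0..1}"]) (auto intro!: borel_integrable_atLeastAtMost')
  then have 1: "set_integrable lborel {0<..1} (\<lambda>u. G u * u powr (y - 1))"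
  proof (rule set_integrable_bound[OF _ m])
    show "AE u in lborel. u \<in> {0<..1} \<longrightarrow> norm (G u * u powr (y - 1)) \<le> norm C"
    proof (intro AE_I2 impI)
      fix u :: real assume u: "u \<in> {0<..1}"
      have "\<bar>G u\<bar> * u powr (y - 1) \<le> (C * u) * u powr (y - 1)" using u C by (intro mult_right_mono) auto
      also have "\<dots> = C * u powr y" using u by (simp add: powr_mult_base mult.assoc)
      also have "\<dots> \<le> C * 1" using u y C powr_mono2[of y u 1] by (intro mult_left_mono) auto
      finally show "norm (G u * u powr (y - 1)) \<le> norm C" using C by (simp add: abs_mult)
    qed
  qed auto
  have "((\<lambda>u. u powr (y - \<sigma>)) has_integral - (1 powr (y - \<sigma> + 1)) / (y - \<sigma> + 1)) {1..}"
    by (rule has_integral_powr_to_inf) (use y in auto)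
  then have "(\<lambda>u. u powr (y - \<sigma>)) absolutely_integrable_on {1..}"
    by (intro nonnegative_absolutely_integrable_1) auto
  moreover have "set_borel_measurable borel {1..} (\<lambda>u. u powr (y - \<sigma>))"
    by (rule set_borel_measurable_if_continuous) (auto intro!: continuous_intros)
  ultimately have "set_integrable lborel {1..} (\<lambda>u. u powr (y - \<sigma>))"
    by (rule set_integrable_lborel_if_absolutely)
  then have "set_integrable lborel {1..} (\<lambda>u. C * u powr (y - \<sigma>))" by simp
  then have 2: "set_integrable lborel {1..} (\<lambda>u. G u * u powr (y - 1))"
  proof (rule set_integrable_bound[OF _ m])
    show "AE u in lborel. u \<in> {1..} \<longrightarrow> norm (G u * u powr (y - 1)) \<le> norm (C * u powr (y - \<sigma>))"
    proof (intro AE_I2 impI)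
      fix u :: real assume u: "u \<in> {1..}"
      have "\<bar>G u\<bar> * u powr (y - 1) \<le> (C * u powr (1 - \<sigma>)) * u powr (y - 1)" using u C by (intro mult_right_mono) auto
      also have "\<dots> = C * u powr (y - \<sigma>)" using u by (simp add: powr_add[symmetric] mult.assoc)
      finally show "norm (G u * u powr (y - 1)) \<le> norm (C * u powr (y - \<sigma>))" using C by (simp add: abs_mult)
    qed
  qed auto
  have "{0<..1} \<union> {1..} = {0::real<..}" by auto
  with set_integrable_Un[OF 1 2] show ?thesis unfolding weighted_integrable_def by simp
qed

text \<open>Partial integration; the bounds on \<open>G\<close> make both boundary terms vanish.\<close>
lemma antiderivative_mellin:
  assumes g: "admissible g (Re w)" and w: "Re w \<ge> 1"
    and G: "\<And>u. (G has_real_derivative g u) (at u)" "G 0 = 0" "(G \<longlongrightarrow> 0) at_top"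
  shows "admissible G (Re (w - 1))"
    and "halfline_mellin g w = (1 - w) * halfline_mellin G (w - 1)"
proof -
  have gc: "continuous_on UNIV g" and gi: "weighted_integrable g (Re w)" using g by (auto simp: admissible_def)
  obtain \<sigma> where \<sigma>: "\<sigma> > Re w" "weighted_integrable g \<sigma>" using g by (auto simp: admissible_def)
  then have \<sigma>1: "\<sigma> \<ge> 1" using w by simp
  have Gc: "continuous_on UNIV G" using G(1) by (meson DERIV_continuous_on DERIV_subset subset_UNIV)
  have Gi: "weighted_integrable G y" if "0 \<le> y" "y < \<sigma> - 1" for y
    by (rule antiderivative_weighted_integrable[OF gc \<sigma>(2) _ G that]) (use \<sigma> w in auto)
  have Gw: "weighted_integrable G (Re (w - 1))" by (rule Gi) (use \<sigma> w in auto)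
  moreover have "weighted_integrable G ((Re w + \<sigma>) / 2 - 1)" by (rule Gi) (use \<sigma> w in \<open>auto simp: field_simps\<close>)
  ultimately show "admissible G (Re (w - 1))"
    unfolding admissible_def using Gc \<sigma>(1) by (auto intro!: exI[of _ "(Re w + \<sigma>) / 2 - 1"] simp: field_simps)
  obtain C where C: "C \<ge> 0" "\<And>u. 0 \<le> u \<Longrightarrow> u \<le> 1 \<Longrightarrow> \<bar>G u\<bar> \<le> C * u"
    "\<And>u. u \<ge> 1 \<Longrightarrow> \<bar>G u\<bar> \<le> C * u powr (1 - \<sigma>)"
    using antiderivative_bounds[OF gc \<sigma>(2) \<sigma>1 G] by blast
  define F where "F = (\<lambda>u. complex_of_real (G u) * of_real u powr (w - 1))"
  define f where "f = (\<lambda>u. complex_of_real (g u) * of_real u powr (w - 1))"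
  define h where "h = (\<lambda>u. complex_of_real (G u) * of_real u powr (w - 1 - 1))"
  have fi: "set_integrable lborel {0<..} f" and hi: "set_integrable lborel {0<..} h"
    unfolding f_def h_def
    by (intro mellin_set_integrable[OF continuous_on_subset[OF gc] gi] mellin_set_integrable[OF continuous_on_subset[OF Gc] Gw] subset_UNIV)+
  have F': "(F has_vector_derivative f u + (w - 1) * h u) (at u)" if u: "u > 0" for u
  proof -
    have "((\<lambda>u. complex_of_real (G u)) has_vector_derivative of_real (g u)) (at u)"
      using G(1)[of u] by (intro has_vector_derivative_of_real) (simp add: has_real_derivative_iff_has_vector_derivative)
    from has_vector_derivative_mult[OF this has_vector_derivative_of_real_powr[OF u, of "w - 1" UNIV]]
    show ?thesis by (simp add: F_def f_def h_def algebra_simps)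
  qed
  have F0: "(F \<longlongrightarrow> 0) (at_right 0)"
  proof (rule Lim_null_comparison)
    show "eventually (\<lambda>u. norm (F u) \<le> C * u powr Re w) (at_right 0)"
      unfolding eventually_at_right_field
    proof (intro exI[of _ 1] conjI allI impI)
      fix u :: real assume u: "0 < u" "u < 1"
      have "norm (F u) = \<bar>G u\<bar> * u powr (Re w - 1)" using u by (simp add: F_def norm_mult norm_powr_of_real)
      also have "\<dots> \<le> (C * u) * u powr (Re w - 1)" using u C by (intro mult_right_mono) auto
      also have "\<dots> = C * u powr Re w" using u by (simp add: powr_mult_base mult.assoc)
      finally show "norm (F u) \<le> C * u powr Re w" .
    qed simp
    have "((\<lambda>u. u powr Re w) \<longlongrightarrow> 0 powr Re w) (at_right 0)"
      by (rule tendsto_powr') (use w in \<open>auto simp: eventually_at_right_field intro: exI[of _ 1]\<close>)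
    then have "((\<lambda>u. C * u powr Re w) \<longlongrightarrow> C * 0) (at_right 0)" by (intro tendsto_intros) auto
    then show "((\<lambda>u. C * u powr Re w) \<longlongrightarrow> 0) (at_right 0)" by simp
  qed
  have F1: "(F \<longlongrightarrow> 0) at_top"
  proof (rule Lim_null_comparison)
    show "eventually (\<lambda>u. norm (F u) \<le> C * u powr (Re w - \<sigma>)) at_top"
      using eventually_ge_at_top[of 1]
    proof eventually_elim
      case (elim u)
      have "norm (F u) = \<bar>G u\<bar> * u powr (Re w - 1)" using elim by (simp add: F_def norm_mult norm_powr_of_real)
      also have "\<dots> \<le> (C * u powr (1 - \<sigma>)) * u powr (Re w - 1)" using elim C by (intro mult_right_mono) auto
      also have "\<dots> = C * u powr (Re w - \<sigma>)" using elim by (simp add: powr_add[symmetric] mult.assoc)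
      finally show "norm (F u) \<le> C * u powr (Re w - \<sigma>)" .
    qed
    have "((\<lambda>u. u powr (Re w - \<sigma>)) \<longlongrightarrow> 0) at_top"
      by (rule tendsto_neg_powr) (use \<sigma> in \<open>auto simp: filterlim_ident\<close>)
    then have "((\<lambda>u. C * u powr (Re w - \<sigma>)) \<longlongrightarrow> C * 0) at_top" by (intro tendsto_intros) auto
    then show "((\<lambda>u. C * u powr (Re w - \<sigma>)) \<longlongrightarrow> 0) at_top" by simp
  qed
  have "((\<lambda>x. F (snd x) - F (fst x)) \<longlongrightarrow> 0 - 0) halfline_ends"
    by (intro tendsto_diff filterlim_compose[OF F1 filterlim_snd] filterlim_compose[OF F0 filterlim_fst])
  then have "((\<lambda>(r, R). F R - F r) \<longlongrightarrow> 0) halfline_ends" by (simp add: case_prod_unfold)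
  then have "0 = (LINT u:{0<..}|lborel. f u + (w - 1) * h u)"
    by (rule primitive_ends_limit[rotated 2]) (use fi hi F' in auto)
  also have "\<dots> = halfline_mellin g w + (w - 1) * halfline_mellin G (w - 1)"
    using fi hi by (subst set_integral_add(2)) (auto simp: f_def h_def halfline_mellin_def)
  finally show "halfline_mellin g w = (1 - w) * halfline_mellin G (w - 1)" by (simp add: algebra_simps)
qed

text \<open>Induction on the integer part of \<open>Re w\<close> and, inside it, on \<open>n\<close>, where \<open>dilation_step\<close> reduces every
  \<open>n\<close> to \<open>n = 0\<close>. For \<open>n = 0\<close> and \<open>Re w < 1\<close> the integral converges absolutely. For \<open>n = 0\<close> and
  \<open>Re w \<ge> 1\<close> the total integral of \<open>g\<close> vanishes, so its primitive \<open>G\<close> is admissible at \<open>w - 1\<close>; as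
  \<open>riesz \<gamma> g\<close> is the derivative of \<open>riesz \<gamma> G\<close>, the claim is the one for \<open>G\<close>, \<open>n = 1\<close> and \<open>w - 1\<close>.
  With \<open>rGamma\<close> the case of a pole of \<open>\<Gamma>(1 - s)\<close> is included.\<close>
theorem riesz_derivative_mellin:
  assumes \<gamma>: "\<gamma> > 0" and g: "admissible g (Re w)" and w: "w = s - of_nat n + of_real \<gamma>" "1 - w \<notin> \<int>\<^sub>\<le>\<^sub>0"
    and data: "RL_data \<gamma> g n s D H L"
  shows "L = Gamma (of_real \<gamma>) * Gamma (1 - w) * rGamma (1 - s) * halfline_mellin g w"
proof -
  have base: "L = Gamma (of_real \<gamma>) * Gamma (1 - w) * rGamma (1 - s) * halfline_mellin g w"
    if w: "Re w < 1" "w = s + of_real \<gamma>" and g: "admissible g (Re w)" and data: "RL_data \<gamma> g 0 s D H L"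
    for w g s D H L
  proof -
    have gc: "continuous_on UNIV g" and gi: "weighted_integrable g (Re w)" using g by (auto simp: admissible_def)
    have H: "\<And>u. u > 0 \<Longrightarrow> (H has_vector_derivative of_real (riesz \<gamma> g u) * of_real u powr (s - 1)) (at u)"
      and L: "((\<lambda>(r, R). H R - H r) \<longlongrightarrow> L) halfline_ends"
      using data by (auto simp: RL_data_def)
    have "L = halfline_mellin (riesz \<gamma> g) s"
      unfolding halfline_mellin_def
      by (rule primitive_ends_limit[OF riesz_mellin_absolute(1)[OF \<gamma> gc w(2,1) gi] H L])
    also have "\<dots> = Beta (1 - w) (of_real \<gamma>) * halfline_mellin g w"
      by (rule riesz_mellin_absolute(2)[OF \<gamma> gc w(2,1) gi])
    also have "Beta (1 - w) (of_real \<gamma>) = Gamma (of_real \<gamma>) * Gamma (1 - w) * rGamma (1 - s)"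
    proof -
      have "1 - w + of_real \<gamma> = 1 - s" using w by simp
      then show ?thesis unfolding Beta_altdef by (simp only: mult_ac)
    qed
    finally show ?thesis .
  qed
  have main: "L = Gamma (of_real \<gamma>) * Gamma (1 - w) * rGamma (1 - s) * halfline_mellin g w"
    if "Re w < real K + 1" "admissible g (Re w)" "w = s - of_nat n + of_real \<gamma>" "1 - w \<notin> \<int>\<^sub>\<le>\<^sub>0" "RL_data \<gamma> g n s D H L"
    for K w g n s D H L
    using that
  proof (induction K arbitrary: w g n s D H L)
    case 0
    then show ?case
    proof (induction n arbitrary: g s D H L)
      case 0 then show ?case by (intro base) auto
    next
      case (Suc n)
      then show ?case by (intro dilation_step[OF \<gamma> _ Suc.prems(2,3,5)]) blast
    qed
  next
    case (Suc K)
    note IH = Suc.IH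
    from Suc.prems show ?case
    proof (induction n arbitrary: g s D H L)
      case (Suc n)
      then show ?case by (intro dilation_step[OF \<gamma> _ Suc.prems(2,3,5)]) blast
    next
      case 0
      show ?case
      proof (cases "Re w < 1")
        case True then show ?thesis using 0 by (intro base) auto
      next
        case False
        have gc: "continuous_on UNIV g" using 0 by (auto simp: admissible_def)
        have H: "\<And>u. u > 0 \<Longrightarrow> (H has_vector_derivative of_real (riesz \<gamma> g u) * of_real u powr (s - 1)) (at u)"
          and L: "((\<lambda>(r, R). H R - H r) \<longlongrightarrow> L) halfline_ends"
          using 0 by (auto simp: RL_data_def)
        obtain F where F: "\<And>u. (F has_vector_derivative g u) (at u)"
          using einterval_antiderivative[of "-\<infinity>" "\<infinity>" g] gc by (auto simp: continuous_on_eq_continuous_at)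
        define G where "G = (\<lambda>u. F u - F 0)"
        have G: "(G has_real_derivative g u) (at u)" for u
          unfolding G_def using F[of u] by (auto intro!: derivative_eq_intros simp: has_real_derivative_iff_has_vector_derivative)
        have G0: "G 0 = 0" by (simp add: G_def)
        have gi: "set_integrable lborel {0..} g" using admissible_integrable[of g "Re w"] 0 False by auto
        have "((\<lambda>R. LINT u:{0..R}|lborel. g u) \<longlongrightarrow> (LINT u:{0..}|lborel. g u)) at_top"
          by (rule tendsto_set_lebesgue_integral_at_top[OF _ gi]) auto
        moreover have "eventually (\<lambda>R. (LINT u:{0..R}|lborel. g u) = G R) at_top"
          using eventually_ge_at_top[of 0]
        proof eventually_elim
          case (elim R)
          have "set_integrable lborel {0..R} g" by (rule set_integrable_subset[OF gi]) auto
          then have "(LINT u:{0..R}|lborel. g u) = integral {0..R} g" by (rule set_borel_integral_eq_integral(2))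
          also have "(g has_integral (G R - G 0)) {0..R}"
            using elim G by (intro fundamental_theorem_of_calculus)
               (auto simp: has_real_derivative_iff_has_vector_derivative intro: has_vector_derivative_at_within)
          then have "integral {0..R} g = G R" using G0 by (simp add: integral_unique)
          finally show ?case .
        qed
        ultimately have Gm: "(G \<longlongrightarrow> (LINT u:{0..}|lborel. g u)) at_top" by (rule Lim_transform_eventually)
        have "(LINT u:{0..}|lborel. g u) = 0"
          by (rule moment_vanishes[OF \<gamma> gc G G0 Gm H L]) (use 0 False in auto)
        with Gm have Gt: "(G \<longlongrightarrow> 0) at_top" by simp
        note am = antiderivative_mellin[OF 0(2) _ G G0 Gt]
        define D' where "D' = (\<lambda>k::nat. if k = 0 then riesz \<gamma> G else riesz \<gamma> g)"
        have "RL_data \<gamma> G 1 s D' H L"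
          unfolding RL_data_def D'_def using riesz_has_real_derivative[OF \<gamma> gc G G0] H L by auto
        moreover have "1 - (w - 1) \<notin> \<int>\<^sub>\<le>\<^sub>0"
        proof
          assume "1 - (w - 1) \<in> \<int>\<^sub>\<le>\<^sub>0"
          then obtain m :: nat where "1 - (w - 1) = - of_nat m" by (rule nonpos_Ints_cases')
          then have "1 - w = - of_nat (Suc m)" by (simp add: algebra_simps)
          then have "1 - w \<in> \<int>\<^sub>\<le>\<^sub>0" by (simp only: minus_of_nat_in_nonpos_Ints)
          then show False using 0 by simp
        qed
        ultimately have "L = Gamma (of_real \<gamma>) * Gamma (1 - (w - 1)) * rGamma (1 - s) * halfline_mellin G (w - 1)"
          using 0 False by (intro IH[of "w - 1" G s 1 D' H L] am) auto
        also have "Gamma (1 - (w - 1)) = (1 - w) * Gamma (1 - w)"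
          using Gamma_plus1[OF 0(4)] by (simp add: algebra_simps)
        finally show ?thesis using am(2) False by (simp add: mult_ac)
      qed
    qed
  qed
  obtain K :: nat where "Re w < real K" using reals_Archimedean2 by blast
  then show ?thesis using assms by (intro main[of w K]) auto
qed

section \<open>Continuity of the rise function\<close>

lemma subdivision_mono:
  assumes "subdivision a b z N" "i \<le> j" "j \<le> N"
  shows "z i \<le> z j"
  using assms(2,3)
proof (induction j)
  case (Suc j)
  show ?case
  proof (cases "i = Suc j")
    case False
    then have "z i \<le> z j" using Suc by auto
    also have "z j < z (Suc j)" using assms(1) Suc.prems by (auto simp: subdivision_def)
    finally show ?thesis by simp
  qed simp
qed simp

lemma subdivision_bounds:
  assumes "subdivision a b z N" "i \<le> N"
  shows "a \<le> z i" "z i \<le> b"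
  using subdivision_mono[OF assms(1), of 0 i] subdivision_mono[OF assms(1), of i N] assms
  by (auto simp: subdivision_def)

lemma fine_subdivision_exists:
  assumes "a \<le> b" "\<delta> > 0"
  shows "\<exists>z N. subdivision a b z N \<and> (\<forall>i<N. z (Suc i) - z i \<le> \<delta>)"
proof (cases "a = b")
  case True
  then have "subdivision a b (\<lambda>_. a) 0" by (simp add: subdivision_def)
  then show ?thesis by blast
next
  case False
  with assms have ab: "a < b" by simp
  obtain N :: nat where N: "(b - a) / \<delta> < real N" using reals_Archimedean2 by blast
  have N0: "N > 0" using N ab assms by (cases N) (auto simp: divide_less_0_iff)
  define z where "z i = a + (b - a) * real i / real N" for i
  have step: "z (Suc i) - z i = (b - a) / real N" for i
    using N0 by (simp add: z_def field_simps)
  have "subdivision a b z N"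
    unfolding subdivision_def
  proof (intro conjI allI impI)
    show "z 0 = a" "z N = b" using N0 by (auto simp: z_def)
    have "(b - a) / real N > 0" using ab N0 by simp
    then show "z i < z (Suc i)" for i using step[of i] by simp
  qed
  moreover have "(b - a) / real N \<le> \<delta>" using N N0 assms by (simp add: field_simps)
  then have "\<forall>i<N. z (Suc i) - z i \<le> \<delta>" by (simp add: step)
  ultimately show ?thesis by blast
qed

definition mesh_sums :: "(real \<Rightarrow> 'a::euclidean_space) \<Rightarrow> real \<Rightarrow> real \<Rightarrow> real \<Rightarrow> real \<Rightarrow> real set" where
  "mesh_sums v \<alpha> \<delta> a b = {\<Sum>i<N. norm (v (z (Suc i)) - v (z i)) powr \<alpha> / Gamma (\<alpha> + 1) | z N.
     subdivision a b z N \<and> (\<forall>i<N. z (Suc i) - z i \<le> \<delta>)}"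

text \<open>The infimum inside the limit that defines \<open>curve_mass\<close>, as a real number.\<close>
definition mesh_mass :: "(real \<Rightarrow> 'a::euclidean_space) \<Rightarrow> real \<Rightarrow> real \<Rightarrow> real \<Rightarrow> real \<Rightarrow> real" where
  "mesh_mass v \<alpha> \<delta> a b = Inf (mesh_sums v \<alpha> \<delta> a b)"

lemma mesh_sums_append:
  assumes "s \<in> mesh_sums v \<alpha> \<delta> a b" "t \<in> mesh_sums v \<alpha> \<delta> b c"
  shows "s + t \<in> mesh_sums v \<alpha> \<delta> a c"
proof -
  let ?f = "\<lambda>z i. norm (v (z (Suc i)) - v (z i)) powr \<alpha> / Gamma (\<alpha> + 1)"
  obtain z N where z: "subdivision a b z N" "\<And>i. i < N \<Longrightarrow> z (Suc i) - z i \<le> \<delta>" "s = (\<Sum>i<N. ?f z i)"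
    using assms(1) unfolding mesh_sums_def by blast
  obtain y M where y: "subdivision b c y M" "\<And>i. i < M \<Longrightarrow> y (Suc i) - y i \<le> \<delta>" "t = (\<Sum>i<M. ?f y i)"
    using assms(2) unfolding mesh_sums_def by blast
  define x where "x i = (if i \<le> N then z i else y (i - N))" for i
  have x1: "x i = z i" if "i \<le> N" for i using that by (simp add: x_def)
  have x2: "x (N + i) = y i" for i
    using z(1) y(1) by (cases i) (auto simp: x_def subdivision_def)
  have step: "P (x i) (x (Suc i))" if i: "i < N + M" and P: "\<And>i. i < N \<Longrightarrow> P (z i) (z (Suc i))" "\<And>i. i < M \<Longrightarrow> P (y i) (y (Suc i))" for P i
  proof (cases "i < N")
    case True then show ?thesis using P(1) by (simp add: x1)
  next
    case False
    then have "i = N + (i - N)" "i - N < M" using i by auto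
    then show ?thesis using P(2)[of "i - N"] x2[of "i - N"] x2[of "Suc (i - N)"] by simp
  qed
  have "subdivision a c x (N + M)"
    unfolding subdivision_def
  proof (intro conjI allI impI)
    show "x 0 = a" "x (N + M) = c" using z(1) y(1) x1[of 0] x2[of M] by (auto simp: subdivision_def)
    show "x i < x (Suc i)" if "i < N + M" for i
      by (rule step[OF that, of "(<)"]) (use z(1) y(1) in \<open>auto simp: subdivision_def\<close>)
  qed
  moreover have "x (Suc i) - x i \<le> \<delta>" if "i < N + M" for i
    by (rule step[OF that, of "\<lambda>p q. q - p \<le> \<delta>"]) (use z y in auto)
  moreover have "(\<Sum>i<N + M. ?f x i) = s + t"
  proof -
    have "(\<Sum>i<N + k. ?f x i) = (\<Sum>i<N. ?f z i) + (\<Sum>i<k. ?f y i)" for k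
    proof (induction k)
      case 0 show ?case by (auto intro!: sum.cong simp: x1)
    next
      case (Suc k) then show ?case using x2[of k] x2[of "Suc k"] by simp
    qed
    then show ?thesis by (simp add: z(3) y(3))
  qed
  ultimately show ?thesis unfolding mesh_sums_def by (intro CollectI exI[of _ x] exI[of _ "N + M"]) auto
qed

context
  fixes v :: "real \<Rightarrow> 'a::euclidean_space" and \<alpha> :: real
  assumes \<alpha>: "\<alpha> \<ge> 1"
begin

lemma Gamma_exponent_pos: "Gamma (\<alpha> + 1) > 0"
  using \<alpha> by (intro Gamma_real_pos) auto

lemma mesh_sums_nonneg: "s \<in> mesh_sums v \<alpha> \<delta> a b \<Longrightarrow> s \<ge> 0"
  unfolding mesh_sums_def using Gamma_exponent_pos
  by (auto intro!: sum_nonneg divide_nonneg_pos)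

lemma mesh_sums_bdd: "bdd_below (mesh_sums v \<alpha> \<delta> a b)"
  using mesh_sums_nonneg by (meson bdd_below.I)

lemma mesh_sums_nonempty: "a \<le> b \<Longrightarrow> \<delta> > 0 \<Longrightarrow> mesh_sums v \<alpha> \<delta> a b \<noteq> {}"
  using fine_subdivision_exists[of a b \<delta>] unfolding mesh_sums_def by blast

lemma mesh_mass_nonneg: "a \<le> b \<Longrightarrow> \<delta> > 0 \<Longrightarrow> mesh_mass v \<alpha> \<delta> a b \<ge> 0"
  unfolding mesh_mass_def by (intro cInf_greatest mesh_sums_nonempty mesh_sums_nonneg)

lemma mesh_mass_antimono:
  assumes "a \<le> b" "0 < \<delta>" "\<delta> \<le> \<epsilon>"
  shows "mesh_mass v \<alpha> \<epsilon> a b \<le> mesh_mass v \<alpha> \<delta> a b"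
  unfolding mesh_mass_def
proof (intro cInf_superset_mono mesh_sums_nonempty mesh_sums_bdd assms)
  show "mesh_sums v \<alpha> \<delta> a b \<subseteq> mesh_sums v \<alpha> \<epsilon> a b"
    unfolding mesh_sums_def using assms(3) by (force intro: order_trans)
qed

lemma mesh_mass_refl: "mesh_mass v \<alpha> \<delta> a a \<le> 0"
proof -
  have "0 \<in> mesh_sums v \<alpha> \<delta> a a"
    unfolding mesh_sums_def by (intro CollectI exI[of _ "\<lambda>_. a"] exI[of _ 0]) (auto simp: subdivision_def)
  then show ?thesis unfolding mesh_mass_def using mesh_sums_bdd by (rule cInf_lower)
qed

lemma mesh_mass_single:
  assumes "a \<le> b" "b - a \<le> \<delta>"
  shows "mesh_mass v \<alpha> \<delta> a b \<le> norm (v b - v a) powr \<alpha> / Gamma (\<alpha> + 1)"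
proof (cases "a = b")
  case True then show ?thesis using mesh_mass_refl[of \<delta> a] \<alpha> by simp
next
  case False
  then have "norm (v b - v a) powr \<alpha> / Gamma (\<alpha> + 1) \<in> mesh_sums v \<alpha> \<delta> a b"
    unfolding mesh_sums_def using assms
    by (intro CollectI exI[of _ "\<lambda>i. if i = 0 then a else b"] exI[of _ 1]) (auto simp: subdivision_def)
  then show ?thesis unfolding mesh_mass_def using mesh_sums_bdd by (rule cInf_lower)
qed

lemma mesh_mass_subadditive:
  assumes "a \<le> b" "b \<le> c" "\<delta> > 0"
  shows "mesh_mass v \<alpha> \<delta> a c \<le> mesh_mass v \<alpha> \<delta> a b + mesh_mass v \<alpha> \<delta> b c"
proof -
  have 1: "mesh_mass v \<alpha> \<delta> a c \<le> s + t" if "s \<in> mesh_sums v \<alpha> \<delta> a b" "t \<in> mesh_sums v \<alpha> \<delta> b c" for s t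
    using mesh_sums_append[OF that] mesh_sums_bdd unfolding mesh_mass_def by (rule cInf_lower)
  have "mesh_mass v \<alpha> \<delta> a c - t \<le> mesh_mass v \<alpha> \<delta> a b" if "t \<in> mesh_sums v \<alpha> \<delta> b c" for t
    unfolding mesh_mass_def[of _ _ _ a b]
    by (rule cInf_greatest[OF mesh_sums_nonempty]) (use 1[OF _ that] assms in \<open>auto simp: algebra_simps\<close>)
  then have "mesh_mass v \<alpha> \<delta> a c - mesh_mass v \<alpha> \<delta> a b \<le> mesh_mass v \<alpha> \<delta> b c"
    unfolding mesh_mass_def[of _ _ _ b c]
    by (intro cInf_greatest[OF mesh_sums_nonempty]) (use assms in \<open>auto simp: algebra_simps\<close>)
  then show ?thesis by simp
qed

text \<open>A subdivision of \<open>[a, c]\<close> need not contain \<open>b\<close>. Following it step by step, only the step that jumps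
  over \<open>b\<close> has to be split, which costs at most two increments of the curve over short intervals.\<close>
lemma mesh_mass_superadditive:
  assumes abc: "a \<le> b" "b \<le> c" "\<delta> > 0"
    and \<omega>: "\<And>x y. a \<le> x \<Longrightarrow> x \<le> y \<Longrightarrow> y \<le> c \<Longrightarrow> y - x \<le> \<delta> \<Longrightarrow> norm (v y - v x) powr \<alpha> / Gamma (\<alpha> + 1) \<le> \<omega>"
  shows "mesh_mass v \<alpha> \<delta> a b + mesh_mass v \<alpha> \<delta> b c \<le> mesh_mass v \<alpha> \<delta> a c + 2 * \<omega>"
proof -
  let ?f = "\<lambda>z i. norm (v (z (Suc i)) - v (z i)) powr \<alpha> / Gamma (\<alpha> + 1)"
  have \<omega>0: "\<omega> \<ge> 0" using \<omega>[of a a] abc \<alpha> by simp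
  have "mesh_mass v \<alpha> \<delta> a b + mesh_mass v \<alpha> \<delta> b c - 2 * \<omega> \<le> s" if "s \<in> mesh_sums v \<alpha> \<delta> a c" for s
  proof -
    obtain z N where z: "subdivision a c z N" "\<And>i. i < N \<Longrightarrow> z (Suc i) - z i \<le> \<delta>" "s = (\<Sum>i<N. ?f z i)"
      using \<open>s \<in> _\<close> unfolding mesh_sums_def by blast
    have incr: "z i < z (Suc i)" if "i < N" for i using z(1) that by (simp add: subdivision_def)
    have z0: "z 0 = a" using z(1) by (simp add: subdivision_def)
    have up: "mesh_mass v \<alpha> \<delta> a (z k) \<le> (\<Sum>i<k. ?f z i)" if "k \<le> N" for k
      using that
    proof (induction k)
      case 0 then show ?case using mesh_mass_refl z0 by simp
    next
      case (Suc k)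
      have "mesh_mass v \<alpha> \<delta> a (z (Suc k)) \<le> mesh_mass v \<alpha> \<delta> a (z k) + mesh_mass v \<alpha> \<delta> (z k) (z (Suc k))"
        using Suc.prems incr[of k] subdivision_bounds[OF z(1)] abc by (intro mesh_mass_subadditive) auto
      also have "mesh_mass v \<alpha> \<delta> (z k) (z (Suc k)) \<le> ?f z k"
        using Suc.prems incr[of k] z(2)[of k] by (intro mesh_mass_single) auto
      finally show ?case using Suc by simp
    qed
    have "mesh_mass v \<alpha> \<delta> a b + mesh_mass v \<alpha> \<delta> b (z k) \<le> (\<Sum>i<k. ?f z i) + 2 * \<omega>"
      if "k \<le> N" "b \<le> z k" for k
      using that
    proof (induction k)
      case 0
      then have "b = a" using abc z0 by simp
      then show ?case using mesh_mass_refl[of \<delta> a] z0 \<omega>0 by simp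
    next
      case (Suc k)
      note kN = Suc.prems(1) and inc = incr[of k] and fine = z(2)[of k]
      show ?case
      proof (cases "b \<le> z k")
        case True
        have "mesh_mass v \<alpha> \<delta> b (z (Suc k)) \<le> mesh_mass v \<alpha> \<delta> b (z k) + mesh_mass v \<alpha> \<delta> (z k) (z (Suc k))"
          using kN inc True abc by (intro mesh_mass_subadditive) auto
        also have "mesh_mass v \<alpha> \<delta> (z k) (z (Suc k)) \<le> ?f z k"
          using kN inc fine by (intro mesh_mass_single) auto
        finally show ?thesis using Suc.IH kN True by simp
      next
        case False
        have "a \<le> z k" "z (Suc k) \<le> c" using subdivision_bounds[OF z(1)] kN by auto
        have "mesh_mass v \<alpha> \<delta> a b \<le> mesh_mass v \<alpha> \<delta> a (z k) + mesh_mass v \<alpha> \<delta> (z k) b"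
          using False abc \<open>a \<le> z k\<close> by (intro mesh_mass_subadditive) auto
        moreover have "mesh_mass v \<alpha> \<delta> (z k) b \<le> \<omega>"
          using False Suc.prems kN fine \<open>a \<le> z k\<close> abc
          by (intro order_trans[OF mesh_mass_single \<omega>]) auto
        moreover have "mesh_mass v \<alpha> \<delta> b (z (Suc k)) \<le> \<omega>"
          using False Suc.prems kN fine abc \<open>z (Suc k) \<le> c\<close>
          by (intro order_trans[OF mesh_mass_single \<omega>]) auto
        moreover have "?f z k \<ge> 0" using Gamma_exponent_pos by simp
        ultimately show ?thesis using up[of k] kN by simp
      qed
    qed
    from this[of N] show ?thesis using z(1) abc z(3) by (simp add: subdivision_def)
  qed
  then have "mesh_mass v \<alpha> \<delta> a b + mesh_mass v \<alpha> \<delta> b c - 2 * \<omega> \<le> mesh_mass v \<alpha> \<delta> a c"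
    unfolding mesh_mass_def[of _ _ _ a c]
    by (intro cInf_greatest[OF mesh_sums_nonempty]) (use abc in auto)
  then show ?thesis by simp
qed

definition mass :: "real \<Rightarrow> real \<Rightarrow> real" where
  "mass a b = real_of_ereal (curve_mass v \<alpha> a b)"

text \<open>\<open>mesh_mass\<close> increases as the mesh bound shrinks, so the limit is a supremum.\<close>
lemma mass_limit:
  assumes ab: "a \<le> b" and fin: "curve_mass v \<alpha> a b < \<infinity>"
  shows "((\<lambda>\<delta>. mesh_mass v \<alpha> \<delta> a b) \<longlongrightarrow> mass a b) (at_right 0)"
    and "\<delta> > 0 \<Longrightarrow> mesh_mass v \<alpha> \<delta> a b \<le> mass a b"
proof -
  have eq: "(INF (z, N) \<in> {(z, N). subdivision a b z N \<and> (\<forall>i<N. z (Suc i) - z i \<le> \<delta>)}.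
         ereal (\<Sum>i<N. norm (v (z (Suc i)) - v (z i)) powr \<alpha> / Gamma (\<alpha> + 1))) = ereal (mesh_mass v \<alpha> \<delta> a b)"
    (is "?I = _") if "\<delta> > 0" for \<delta>
  proof -
    have "?I = Inf (ereal ` mesh_sums v \<alpha> \<delta> a b)"
      unfolding mesh_sums_def by (rule arg_cong[where f=Inf]) (auto simp: image_iff)
    also have "\<dots> = ereal (mesh_mass v \<alpha> \<delta> a b)"
      unfolding mesh_mass_def using ereal_Inf'[OF mesh_sums_bdd mesh_sums_nonempty[OF ab that]] by simp
    finally show ?thesis .
  qed
  define S where "S = (SUP \<delta>\<in>{0<..}. ereal (mesh_mass v \<alpha> \<delta> a b))"
  have le: "ereal (mesh_mass v \<alpha> \<delta> a b) \<le> S" if "\<delta> > 0" for \<delta>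
    unfolding S_def using that by (intro SUP_upper) auto
  have lim: "((\<lambda>\<delta>. ereal (mesh_mass v \<alpha> \<delta> a b)) \<longlongrightarrow> S) (at_right 0)"
  proof (rule order_tendstoI)
    fix x assume "x < S"
    then obtain \<epsilon> where \<epsilon>: "\<epsilon> > 0" "x < ereal (mesh_mass v \<alpha> \<epsilon> a b)" unfolding S_def less_SUP_iff by auto
    show "eventually (\<lambda>\<delta>. x < ereal (mesh_mass v \<alpha> \<delta> a b)) (at_right 0)"
      unfolding eventually_at_right_field
    proof (intro exI[of _ \<epsilon>] conjI allI impI)
      fix \<delta> assume "0 < \<delta>" "\<delta> < \<epsilon>"
      then have "ereal (mesh_mass v \<alpha> \<epsilon> a b) \<le> ereal (mesh_mass v \<alpha> \<delta> a b)" using mesh_mass_antimono[OF ab] by simp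
      with \<epsilon>(2) show "x < ereal (mesh_mass v \<alpha> \<delta> a b)" by (rule less_le_trans)
    qed (rule \<epsilon>)
  next
    fix x assume "S < x"
    then show "eventually (\<lambda>\<delta>. ereal (mesh_mass v \<alpha> \<delta> a b) < x) (at_right 0)"
      unfolding eventually_at_right_field using le by (intro exI[of _ 1]) (auto intro: le_less_trans)
  qed
  have "curve_mass v \<alpha> a b = S"
    unfolding curve_mass_def
  proof (rule tendsto_Lim)
    show "((\<lambda>\<delta>. INF (z, N) \<in> {(z, N). subdivision a b z N \<and> (\<forall>i<N. z (Suc i) - z i \<le> \<delta>)}.
         ereal (\<Sum>i<N. norm (v (z (Suc i)) - v (z i)) powr \<alpha> / Gamma (\<alpha> + 1))) \<longlongrightarrow> S) (at_right 0)"
      by (rule Lim_transform_eventually[OF lim])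
         (auto simp: eventually_at_right_field eq intro!: exI[of _ 1])
  qed simp
  moreover have "S \<ge> 0" using le[of 1] mesh_mass_nonneg[OF ab, of 1]
    by (metis ereal_less_eq(5) order_trans zero_less_one)
  ultimately have S: "S = ereal (mass a b)"
    using fin unfolding mass_def by (cases S) auto
  show "((\<lambda>\<delta>. mesh_mass v \<alpha> \<delta> a b) \<longlongrightarrow> mass a b) (at_right 0)"
    using lim unfolding S by simp
  show "\<delta> > 0 \<Longrightarrow> mesh_mass v \<alpha> \<delta> a b \<le> mass a b"
    using le unfolding S by simp
qed

lemma increment_small:
  assumes v: "continuous_on {a..b} v" and e: "e > 0"
  obtains d where "d > 0" "\<And>x y. a \<le> x \<Longrightarrow> x \<le> y \<Longrightarrow> y \<le> b \<Longrightarrow> y - x \<le> d \<Longrightarrow>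
    norm (v y - v x) powr \<alpha> / Gamma (\<alpha> + 1) \<le> e"
proof -
  define r where "r = (e * Gamma (\<alpha> + 1)) powr (1 / \<alpha>)"
  have r: "r > 0" using e Gamma_exponent_pos by (simp add: r_def)
  have "uniformly_continuous_on {a..b} v" using v by (intro compact_uniformly_continuous) auto
  then obtain d where d: "d > 0" "\<And>x y. x \<in> {a..b} \<Longrightarrow> y \<in> {a..b} \<Longrightarrow> dist y x < d \<Longrightarrow> dist (v y) (v x) < r"
    unfolding uniformly_continuous_on_def using r by metis
  show ?thesis
  proof (rule that[of "d / 2"])
    fix x y assume xy: "a \<le> x" "x \<le> y" "y \<le> b" "y - x \<le> d / 2"
    then have "norm (v y - v x) \<le> r" using d(2)[of x y] d(1) by (auto simp: dist_norm)
    then have "norm (v y - v x) powr \<alpha> \<le> r powr \<alpha>" using \<alpha> by (intro powr_mono2) auto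
    also have "r powr \<alpha> = e * Gamma (\<alpha> + 1)" using \<alpha> e Gamma_exponent_pos by (simp add: r_def powr_powr)
    finally show "norm (v y - v x) powr \<alpha> / Gamma (\<alpha> + 1) \<le> e"
      using Gamma_exponent_pos by (simp add: field_simps)
  qed (use d in simp)
qed

lemma mass_additive:
  assumes abc: "a \<le> b" "b \<le> c" and v: "continuous_on {a..c} v"
    and fin: "\<And>x y. a \<le> x \<Longrightarrow> x \<le> y \<Longrightarrow> y \<le> c \<Longrightarrow> curve_mass v \<alpha> x y < \<infinity>"
  shows "mass a c = mass a b + mass b c"
proof (rule antisym)
  note lims = mass_limit(1)[OF abc(1) fin] mass_limit(1)[OF abc(2) fin] mass_limit(1)[of a c, OF _ fin]
  have ev: "eventually (\<lambda>\<delta>. \<delta> > 0) (at_right (0::real))" by (auto simp: eventually_at_right_field intro: exI[of _ 1])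
  show "mass a c \<le> mass a b + mass b c"
  proof (rule tendsto_le)
    show "((\<lambda>\<delta>. mesh_mass v \<alpha> \<delta> a b + mesh_mass v \<alpha> \<delta> b c) \<longlongrightarrow> mass a b + mass b c) (at_right 0)"
      by (intro tendsto_add lims) (use abc in auto)
    show "((\<lambda>\<delta>. mesh_mass v \<alpha> \<delta> a c) \<longlongrightarrow> mass a c) (at_right 0)" by (rule lims) (use abc in auto)
    show "eventually (\<lambda>\<delta>. mesh_mass v \<alpha> \<delta> a c \<le> mesh_mass v \<alpha> \<delta> a b + mesh_mass v \<alpha> \<delta> b c) (at_right 0)"
      using ev by eventually_elim (rule mesh_mass_subadditive[OF abc])
  qed simp
  show "mass a b + mass b c \<le> mass a c"
  proof (rule field_le_epsilon)
    fix e :: real assume "e > 0"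
    then obtain d where d: "d > 0" "\<And>x y. a \<le> x \<Longrightarrow> x \<le> y \<Longrightarrow> y \<le> c \<Longrightarrow> y - x \<le> d \<Longrightarrow>
        norm (v y - v x) powr \<alpha> / Gamma (\<alpha> + 1) \<le> e / 2"
      using increment_small[OF v, of "e / 2"] by auto
    show "mass a b + mass b c \<le> mass a c + e"
    proof (rule tendsto_le)
      show "((\<lambda>\<delta>. mesh_mass v \<alpha> \<delta> a b + mesh_mass v \<alpha> \<delta> b c) \<longlongrightarrow> mass a b + mass b c) (at_right 0)"
        by (intro tendsto_add lims) (use abc in auto)
      show "((\<lambda>\<delta>. mesh_mass v \<alpha> \<delta> a c + e) \<longlongrightarrow> mass a c + e) (at_right 0)"
        by (intro tendsto_add tendsto_const lims) (use abc in auto)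
      have "eventually (\<lambda>\<delta>. 0 < \<delta> \<and> \<delta> < d) (at_right 0)"
        using d(1) by (auto simp: eventually_at_right_field)
      then show "eventually (\<lambda>\<delta>. mesh_mass v \<alpha> \<delta> a b + mesh_mass v \<alpha> \<delta> b c \<le> mesh_mass v \<alpha> \<delta> a c + e) (at_right 0)"
      proof eventually_elim
        case (elim \<delta>)
        have "mesh_mass v \<alpha> \<delta> a b + mesh_mass v \<alpha> \<delta> b c \<le> mesh_mass v \<alpha> \<delta> a c + 2 * (e / 2)"
          by (rule mesh_mass_superadditive[OF abc]) (use elim d(2) in auto)
        then show ?case by simp
      qed
    qed simp
  qed
qed

text \<open>Choose a mesh \<open>\<delta>\<close> for which \<open>mesh_mass\<close> nearly exhausts the mass of \<open>[a, b]\<close>. By additivity and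
  subadditivity, the mass of every subinterval \<open>[x, y]\<close> then nearly equals its \<open>mesh_mass\<close>, which for
  \<open>y - x \<le> \<delta>\<close> is at most the term of the trivial subdivision.\<close>
lemma mass_small:
  assumes ab: "a \<le> b" and v: "continuous_on {a..b} v" and e: "e > 0"
    and fin: "\<And>x y. a \<le> x \<Longrightarrow> x \<le> y \<Longrightarrow> y \<le> b \<Longrightarrow> curve_mass v \<alpha> x y < \<infinity>"
  obtains d where "d > 0" "\<And>x y. a \<le> x \<Longrightarrow> x \<le> y \<Longrightarrow> y \<le> b \<Longrightarrow> y - x \<le> d \<Longrightarrow> mass x y < e"
proof -
  have e3: "e / 3 > 0" using e by simp
  have "eventually (\<lambda>\<delta>. mesh_mass v \<alpha> \<delta> a b > mass a b - e / 3) (at_right 0)"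
    by (rule order_tendstoD(1)[OF mass_limit(1)]) (use ab fin e3 in auto)
  then obtain \<delta>0 where \<delta>0: "\<delta>0 > 0" "\<And>\<delta>. 0 < \<delta> \<Longrightarrow> \<delta> < \<delta>0 \<Longrightarrow> mesh_mass v \<alpha> \<delta> a b > mass a b - e / 3"
    by (auto simp: eventually_at_right_field)
  define \<delta> where "\<delta> = \<delta>0 / 2"
  have \<delta>: "\<delta> > 0" "mesh_mass v \<alpha> \<delta> a b > mass a b - e / 3" using \<delta>0 by (auto simp: \<delta>_def)
  obtain d where d: "d > 0" "\<And>x y. a \<le> x \<Longrightarrow> x \<le> y \<Longrightarrow> y \<le> b \<Longrightarrow> y - x \<le> d \<Longrightarrow>
        norm (v y - v x) powr \<alpha> / Gamma (\<alpha> + 1) \<le> e / 3"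
    using increment_small[OF v e3] by auto
  show ?thesis
  proof (rule that[of "min d \<delta>"])
    fix x y assume xy: "a \<le> x" "x \<le> y" "y \<le> b" "y - x \<le> min d \<delta>"
    have "mass a b = mass a x + mass x b"
      by (rule mass_additive) (use xy v fin in auto)
    moreover have "mass x b = mass x y + mass y b"
      by (rule mass_additive) (use xy v fin in \<open>auto intro: continuous_on_subset\<close>)
    moreover have "mesh_mass v \<alpha> \<delta> a b \<le> mesh_mass v \<alpha> \<delta> a x + mesh_mass v \<alpha> \<delta> x b"
      "mesh_mass v \<alpha> \<delta> x b \<le> mesh_mass v \<alpha> \<delta> x y + mesh_mass v \<alpha> \<delta> y b"
      using xy \<delta>(1) by (auto intro!: mesh_mass_subadditive)
    moreover have "mesh_mass v \<alpha> \<delta> a x \<le> mass a x" "mesh_mass v \<alpha> \<delta> y b \<le> mass y b"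
      using xy \<delta>(1) fin by (auto intro!: mass_limit(2))
    moreover have "mesh_mass v \<alpha> \<delta> x y \<le> e / 3"
      using xy by (intro order_trans[OF mesh_mass_single d(2)]) auto
    ultimately show "mass x y < e" using \<delta>(2) e by linarith
  qed (use d \<delta> in auto)
qed

end

theorem continuous_on_rise_fun:
  assumes "fractal_curve v a0 \<alpha> q0"
  shows "continuous_on {a0..} (rise_fun v \<alpha> q0)"
proof -
  have \<alpha>: "\<alpha> \<ge> 1" and q0: "a0 \<le> q0" and v: "continuous_on {a0..} v"
    and fin: "\<And>x y. a0 \<le> x \<Longrightarrow> x \<le> y \<Longrightarrow> curve_mass v \<alpha> x y < \<infinity>"
    using assms by (auto simp: fractal_curve_def)
  have add: "mass v \<alpha> a c = mass v \<alpha> a b + mass v \<alpha> b c" if "a0 \<le> a" "a \<le> b" "b \<le> c" for a b c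
    by (rule mass_additive[OF \<alpha>]) (use that fin continuous_on_subset[OF v] in auto)
  have z0: "mass v \<alpha> q0 q0 = 0" using add[of q0 q0 q0] q0 by simp
  have diff: "rise_fun v \<alpha> q0 y - rise_fun v \<alpha> q0 x = mass v \<alpha> x y" if xy: "a0 \<le> x" "x \<le> y" for x y
  proof -
    consider "q0 \<le> x" | "x < q0" "q0 \<le> y" | "y < q0" using xy by linarith
    then show ?thesis
    proof cases
      case 1 then show ?thesis using add[of q0 x y] xy q0 by (simp add: rise_fun_def mass_def[OF \<alpha>])
    next
      case 2 then show ?thesis using add[of x q0 y] xy q0 by (simp add: rise_fun_def mass_def[OF \<alpha>])
    next
      case 3 then show ?thesis using add[of x y q0] xy q0 by (simp add: rise_fun_def mass_def[OF \<alpha>])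
    qed
  qed
  have nonneg: "mass v \<alpha> x y \<ge> 0" if "a0 \<le> x" "x \<le> y" for x y
    using mass_limit(2)[OF \<alpha> that(2) fin[OF that], of 1] mesh_mass_nonneg[OF \<alpha> that(2), of 1 v] by simp
  show ?thesis
    unfolding continuous_on_iff
  proof (intro ballI allI impI)
    fix x e :: real assume x: "x \<in> {a0..}" and e: "e > 0"
    obtain d where d: "d > 0" "\<And>p q. a0 \<le> p \<Longrightarrow> p \<le> q \<Longrightarrow> q \<le> x + 1 \<Longrightarrow> q - p \<le> d \<Longrightarrow> mass v \<alpha> p q < e"
      by (rule mass_small[OF \<alpha>, of a0 "x + 1" v e]) (use x e fin continuous_on_subset[OF v] in auto)
    show "\<exists>d>0. \<forall>y\<in>{a0..}. dist y x < d \<longrightarrow> dist (rise_fun v \<alpha> q0 y) (rise_fun v \<alpha> q0 x) < e"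
    proof (intro exI[of _ "min d 1"] conjI ballI impI)
      fix y assume y: "y \<in> {a0..}" "dist y x < min d 1"
      show "dist (rise_fun v \<alpha> q0 y) (rise_fun v \<alpha> q0 x) < e"
      proof (cases "x \<le> y")
        case True then show ?thesis using diff[of x y] d(2)[of x y] nonneg[of x y] x y by (auto simp: dist_real_def)
      next
        case False then show ?thesis using diff[of y x] d(2)[of y x] nonneg[of y x] x y by (auto simp: dist_real_def)
      qed
    qed (use d in auto)
  qed
qed

section \<open>The curve parametrized by its rise\<close>

lemma filtercomap_ereal_filtermap: "filtercomap ereal (filtermap ereal F) = F"
proof (rule filter_eq_iff[THEN iffD2], intro allI iffI)
  fix P assume "eventually P (filtercomap ereal (filtermap ereal F))"
  then obtain Q where "eventually (\<lambda>x. Q (ereal x)) F" "\<And>x. Q (ereal x) \<Longrightarrow> P x"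
    by (auto simp: eventually_filtercomap eventually_filtermap)
  then show "eventually P F" by (auto elim: eventually_mono)
next
  fix P assume "eventually P F"
  then show "eventually P (filtercomap ereal (filtermap ereal F))"
    by (auto simp: eventually_filtercomap eventually_filtermap intro!: exI[of _ "\<lambda>y. P (real_of_ereal y)"])
qed

lemma improper_ends_infinity: "improper_ends c \<infinity> = at_right c \<times>\<^sub>F at_top"
  by (simp add: improper_ends_def at_left_PInf filtercomap_ereal_filtermap)

lemma improper_ends_real: "improper_ends c (ereal z) = at_right c \<times>\<^sub>F at_left z"
  by (simp add: improper_ends_def at_left_ereal filtercomap_ereal_filtermap)

locale fractal_halfline =
  fixes v :: "real \<Rightarrow> 'a::euclidean_space" and a0 \<alpha> q0 :: real and J :: "'a \<Rightarrow> real"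
  assumes curve: "fractal_curve v a0 \<alpha> q0"
    and J_def: "J = rise_pt v a0 \<alpha> q0"
    and base: "a0 \<le> 0" "J (v 0) = 0"
    and unbounded: "filterlim (rise_fun v \<alpha> q0) at_top at_top"
begin

abbreviation S :: "real \<Rightarrow> real" where "S \<equiv> rise_fun v \<alpha> q0"

text \<open>The inverse of \<open>S\<close> on \<open>[0, \<infinity>)\<close>. Continued by the identity to the negative numbers it is an
  increasing surjection of the whole line, and therefore continuous.\<close>
definition T :: "real \<Rightarrow> real" where "T u = (if u < 0 then u else inv_into {0..} S u)"

lemma v_continuous: "continuous_on {a0..} v" and v_inj: "inj_on v {a0..}"
  and S_strict_mono: "strict_mono_on {a0..} S"
  using curve by (auto simp: fractal_curve_def)

lemma S_continuous: "continuous_on {0..} S"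
  using continuous_on_rise_fun[OF curve] base(1) by (auto intro: continuous_on_subset)

lemma J_v: "z \<ge> a0 \<Longrightarrow> J (v z) = S z"
  using v_inj by (simp add: J_def rise_pt_def curve_param_def the_inv_into_f_f)

lemma curve_param_v: "z \<ge> a0 \<Longrightarrow> curve_param v a0 (v z) = z"
  using v_inj by (simp add: curve_param_def the_inv_into_f_f)

lemma S_0: "S 0 = 0"
  using J_v[of 0] base by simp

lemma S_less_iff: "x \<ge> 0 \<Longrightarrow> y \<ge> 0 \<Longrightarrow> S x < S y \<longleftrightarrow> x < y"
  using strict_mono_on_less[OF S_strict_mono, of x y] base(1) by auto

lemma S_le_iff: "x \<ge> 0 \<Longrightarrow> y \<ge> 0 \<Longrightarrow> S x \<le> S y \<longleftrightarrow> x \<le> y"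
  using S_less_iff[of y x] by (simp add: not_less[symmetric])

lemma S_pos: "x > 0 \<Longrightarrow> S x > 0"
  using S_less_iff[of 0 x] S_0 by simp

lemma S_inj: "inj_on S {0..}"
  using strict_mono_on_imp_inj_on[OF S_strict_mono] base(1) by (auto intro: inj_on_subset)

lemma S_image: "S ` {0..} = {0..}"
proof
  show "S ` {0..} \<subseteq> {0..}" using S_le_iff[of 0] S_0 by auto
  show "{0..} \<subseteq> S ` {0..}"
  proof
    fix u :: real assume u: "u \<in> {0..}"
    have "eventually (\<lambda>z. u \<le> S z \<and> 0 \<le> z) at_top"
      using unbounded eventually_ge_at_top[of 0] by (auto simp: filterlim_at_top intro: eventually_conj)
    then obtain z where z: "u \<le> S z" "0 \<le> z"
      using eventually_happens'[OF trivial_limit_at_top_linorder] by blast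
    then have "\<exists>x\<ge>0. x \<le> z \<and> S x = u"
      using u S_0 continuous_on_subset[OF S_continuous] by (intro IVT') auto
    then show "u \<in> S ` {0..}" by auto
  qed
qed

lemma S_T: "u \<ge> 0 \<Longrightarrow> S (T u) = u"
  unfolding T_def using f_inv_into_f[of u S "{0..}"] S_image by auto

lemma T_nonneg: "u \<ge> 0 \<Longrightarrow> T u \<ge> 0"
  unfolding T_def using inv_into_into[of u S "{0..}"] S_image by auto

lemma T_S: "z \<ge> 0 \<Longrightarrow> T (S z) = z"
  unfolding T_def using inv_into_f_f[OF S_inj, of z] S_le_iff[of 0 z] S_0 by auto

lemma T_0: "T 0 = 0"
  using T_S[of 0] S_0 by simp

lemma T_less: "u < u' \<Longrightarrow> T u < T u'"
proof -
  assume uu: "u < u'"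
  consider "u' < 0" | "u < 0" "u' \<ge> 0" | "u \<ge> 0" using uu by linarith
  then show ?thesis
  proof cases
    case 2 then show ?thesis using T_nonneg[of u'] by (simp add: T_def)
  next
    case 3 then show ?thesis using S_less_iff[of "T u" "T u'"] T_nonneg[of u] T_nonneg[of u'] S_T uu by simp
  qed (use uu in \<open>simp add: T_def\<close>)
qed

lemma T_le: "u \<le> u' \<Longrightarrow> T u \<le> T u'"
  using T_less[of u u'] by (cases "u = u'") auto

lemma T_pos: "u > 0 \<Longrightarrow> T u > 0"
  using T_less[of 0 u] T_0 by simp

lemma T_continuous: "continuous_on UNIV T"
proof (rule continuous_onI_mono)
  have "z \<in> range T" for z
  proof (cases "z < 0")
    case True then show ?thesis by (intro image_eqI[of _ _ z]) (auto simp: T_def)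
  next
    case False then show ?thesis using T_S[of z] by (intro image_eqI[of _ _ "S z"]) auto
  qed
  then have "range T = UNIV" by auto
  then show "open (range T)" by simp
qed (rule T_le)

lemma T_at_top: "filterlim T at_top at_top"
  unfolding filterlim_at_top
proof
  fix Z :: real
  show "eventually (\<lambda>u. Z \<le> T u) at_top"
    using eventually_ge_at_top[of "S (max Z 0)"]
  proof eventually_elim
    case (elim u)
    then show ?case using T_le[OF elim] T_S[of "max Z 0"] by simp
  qed
qed

lemma S_at_right_0: "filterlim S (at_right 0) (at_right 0)"
proof (rule filterlim_at[THEN iffD2, OF conjI])
  show "eventually (\<lambda>u. S u \<in> {0<..} \<and> S u \<noteq> 0) (at_right 0)"
  proof -
    have "S u \<in> {0<..} \<and> S u \<noteq> 0" if "u > 0" for u using S_pos[OF that] by simp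
    then show ?thesis by (auto simp: eventually_at_right_field intro!: exI[of _ 1])
  qed
  have "(S \<longlongrightarrow> S 0) (at 0 within {0..})" using S_continuous by (simp add: continuous_on_def)
  then show "(S \<longlongrightarrow> 0) (at_right 0)"
    unfolding S_0 by (rule filterlim_mono[OF _ order_refl at_le]) auto
qed

text \<open>The curve may return arbitrarily close to its own points for large parameters, so \<open>v\<close> need not be a
  homeomorphism onto its image. Derivatives are therefore transported in one direction: a limit along
  the curve implies the limit along the parameter.\<close>
lemma v_T_tendsto:
  assumes u: "u > 0"
  shows "filterlim (\<lambda>x. v (T x)) (at (v (T u)) within curve_points v a0) (at u)"
proof (rule filterlim_at[THEN iffD2, OF conjI])
  have a0: "a0 \<le> T x" if "x > 0" for x using T_pos[OF that] base by simp
  have "eventually (\<lambda>x. x > 0) (at u)" using u by (intro order_tendstoD[OF tendsto_ident_at])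
  moreover have "eventually (\<lambda>x. x \<noteq> u) (at u)" by (simp add: eventually_at_filter)
  ultimately show "eventually (\<lambda>x. v (T x) \<in> curve_points v a0 \<and> v (T x) \<noteq> v (T u)) (at u)"
  proof eventually_elim
    case (elim x)
    have "T x \<noteq> T u" using T_less[of x u] T_less[of u x] elim by linarith
    then show ?case using a0[of x] a0[of u] elim u v_inj by (auto dest: inj_onD)
  qed
  have "isCont T u" using T_continuous by (simp add: continuous_on_eq_continuous_at)
  moreover have "isCont v (T u)"
  proof (rule continuous_on_interior[OF v_continuous])
    have "{a0<..} \<subseteq> interior {a0..}" by (rule interior_maximal) auto
    then show "T u \<in> interior {a0..}" using T_pos[OF u] base by auto
  qed
  ultimately have "isCont (\<lambda>x. v (T x)) u" by (rule isCont_o2)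
  then show "((\<lambda>x. v (T x)) \<longlongrightarrow> v (T u)) (at u)" by (simp add: isCont_def)
qed

lemma frac_deriv_rise:
  assumes diff: "frac_differentiable_at (curve_points v a0) J \<Phi> (v (T u))" and u: "u > 0"
  shows "((\<lambda>x. \<Phi> (v (T x))) has_real_derivative frac_deriv (curve_points v a0) J \<Phi> (v (T u))) (at u)"
proof -
  let ?F = "at (v (T u)) within curve_points v a0"
  obtain l where l: "(frac_quot J \<Phi> (v (T u)) \<longlongrightarrow> l) ?F"
    using diff by (auto simp: frac_differentiable_at_def)
  have "?F \<noteq> bot"
  proof
    assume "?F = bot"
    then have "eventually (\<lambda>_. False) ?F" by simp
    from v_T_tendsto[OF u, unfolded filterlim_iff, rule_format, OF this] show False by simp
  qed
  then have "frac_deriv (curve_points v a0) J \<Phi> (v (T u)) = l"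
    unfolding frac_deriv_def using l by (rule tendsto_Lim)
  moreover have "((\<lambda>x. frac_quot J \<Phi> (v (T u)) (v (T x))) \<longlongrightarrow> l) (at u)"
    by (rule filterlim_compose[OF l v_T_tendsto[OF u]])
  moreover have "eventually (\<lambda>x. frac_quot J \<Phi> (v (T u)) (v (T x)) = (\<Phi> (v (T x)) - \<Phi> (v (T u))) / (x - u)) (at u)"
  proof -
    have "eventually (\<lambda>x. x > 0) (at u)" using u by (intro order_tendstoD[OF tendsto_ident_at])
    then show ?thesis
    proof eventually_elim
      case (elim x)
      have "a0 \<le> T x" "a0 \<le> T u" using T_pos elim u base by (auto intro: order_trans less_imp_le)
      then show ?case using elim u S_T by (simp add: frac_quot_def J_v)
    qed
  qed
  ultimately show ?thesis
    unfolding has_field_derivative_iff by (auto intro: Lim_transform_eventually)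
qed

section \<open>Fractal integrals in the rise variable\<close>

text \<open>A Darboux sum is the integral of a step function of the rise. The relation \<open>R\<close> stands for \<open>\<le>\<close> or
  \<open>\<ge>\<close> against the integrand, so that lower and upper sums are treated together.\<close>
lemma step_function_exists:
  assumes z: "subdivision x y z N" and x: "x \<ge> 0"
    and R: "\<And>t. \<exists>d. R t d" "\<And>i t. i < N \<Longrightarrow> z i \<le> t \<Longrightarrow> t \<le> z (Suc i) \<Longrightarrow> R t (c i)"
  shows "\<exists>s. (s has_integral (\<Sum>i<N. c i * (J (v (z (Suc i))) - J (v (z i))))) {S x..S y} \<and> (\<forall>u\<in>{S x..S y}. R (T u) (s u))"
proof -
  have "\<exists>s. (s has_integral (\<Sum>i<k. c i * (J (v (z (Suc i))) - J (v (z i))))) {S x..S (z k)} \<and> (\<forall>u\<in>{S x..S (z k)}. R (T u) (s u))"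
    if "k \<le> N" for k
    using that
  proof (induction k)
    case 0
    obtain d where d: "R (T (S x)) d" using R(1) by blast
    have "z 0 = x" using z by (simp add: subdivision_def)
    then show ?case using d by (intro exI[of _ "\<lambda>_. d"]) (auto simp: has_integral_refl)
  next
    case (Suc k)
    then obtain s where s: "(s has_integral (\<Sum>i<k. c i * (J (v (z (Suc i))) - J (v (z i))))) {S x..S (z k)}"
      "\<And>u. u \<in> {S x..S (z k)} \<Longrightarrow> R (T u) (s u)" by auto
    have zk: "x \<le> z k" "z k < z (Suc k)" using subdivision_bounds[OF z, of k] z Suc.prems by (auto simp: subdivision_def)
    then have z0: "0 \<le> z k" "0 \<le> z (Suc k)" using x by auto
    then have J: "J (v (z k)) = S (z k)" "J (v (z (Suc k))) = S (z (Suc k))" using base by (auto intro!: J_v)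
    have le: "S x \<le> S (z k)" "S (z k) \<le> S (z (Suc k))" using zk x z0 S_le_iff by auto
    define s' where "s' u = (if u \<le> S (z k) then s u else c k)" for u
    have "(s' has_integral (\<Sum>i<k. c i * (J (v (z (Suc i))) - J (v (z i))))) {S x..S (z k)}"
      by (rule has_integral_eq[OF _ s(1)]) (simp add: s'_def)
    moreover have "(s' has_integral (c k * (S (z (Suc k)) - S (z k)))) {S (z k)..S (z (Suc k))}"
      by (rule has_integral_spike_finite[of "{S (z k)}" _ _ "\<lambda>_. c k"])
         (use le has_integral_const_real[of "c k" "S (z k)" "S (z (Suc k))"] in \<open>auto simp: s'_def mult.commute\<close>)
    ultimately have "(s' has_integral (\<Sum>i<Suc k. c i * (J (v (z (Suc i))) - J (v (z i))))) {S x..S (z (Suc k))}"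
      using has_integral_combine[OF le] J by simp
    moreover have "R (T u) (s' u)" if u: "u \<in> {S x..S (z (Suc k))}" for u
    proof (cases "u \<le> S (z k)")
      case True then show ?thesis using u s(2) by (simp add: s'_def)
    next
      case False
      then have "T (S (z k)) \<le> T u" "T u \<le> T (S (z (Suc k)))" using u by (auto intro!: T_le)
      then show ?thesis using False R(2)[of k "T u"] Suc.prems z0 by (simp add: s'_def T_S)
    qed
    ultimately show ?case by blast
  qed
  from this[of N] show ?thesis using z by (simp add: subdivision_def)
qed

lemma section_param:
  assumes "0 \<le> x" "u \<in> {S x..S y}" "x \<le> y"
  shows "T u \<in> {x..y}"
  using T_le[of "S x" u] T_le[of u "S y"] T_S[of x] T_S[of y] assms by auto

lemma step_below:
  assumes z: "subdivision x y z N" and x: "x \<ge> 0" and bdd: "bdd_below (F ` curve_section v x y)"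
  shows "\<exists>s. (s has_integral (\<Sum>i<N. (INF \<theta>\<in>curve_section v (z i) (z (Suc i)). F \<theta>) * (J (v (z (Suc i))) - J (v (z i))))) {S x..S y} \<and>
     (\<forall>u\<in>{S x..S y}. s u \<le> F (v (T u)))"
proof (rule step_function_exists[OF z x, where R="\<lambda>t d. d \<le> F (v t)"])
  fix i t assume i: "i < N" "z i \<le> t" "t \<le> z (Suc i)"
  have "curve_section v (z i) (z (Suc i)) \<subseteq> curve_section v x y"
    using subdivision_bounds[OF z, of i] subdivision_bounds[OF z, of "Suc i"] i by (auto simp: curve_section_def)
  then have "bdd_below (F ` curve_section v (z i) (z (Suc i)))" using bdd by (meson bdd_below_mono image_mono)
  then show "(INF \<theta>\<in>curve_section v (z i) (z (Suc i)). F \<theta>) \<le> F (v t)"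
    by (rule cINF_lower) (use i in \<open>auto simp: curve_section_def\<close>)
qed blast

lemma step_above:
  assumes z: "subdivision x y z N" and x: "x \<ge> 0" and bdd: "bdd_above (F ` curve_section v x y)"
  shows "\<exists>s. (s has_integral (\<Sum>i<N. (SUP \<theta>\<in>curve_section v (z i) (z (Suc i)). F \<theta>) * (J (v (z (Suc i))) - J (v (z i))))) {S x..S y} \<and>
     (\<forall>u\<in>{S x..S y}. F (v (T u)) \<le> s u)"
proof (rule step_function_exists[OF z x, where R="\<lambda>t d. F (v t) \<le> d"])
  fix i t assume i: "i < N" "z i \<le> t" "t \<le> z (Suc i)"
  have "curve_section v (z i) (z (Suc i)) \<subseteq> curve_section v x y"
    using subdivision_bounds[OF z, of i] subdivision_bounds[OF z, of "Suc i"] i by (auto simp: curve_section_def)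
  then have "bdd_above (F ` curve_section v (z i) (z (Suc i)))" using bdd by (meson bdd_above_mono image_mono)
  then show "F (v t) \<le> (SUP \<theta>\<in>curve_section v (z i) (z (Suc i)). F \<theta>)"
    by (rule cSUP_upper[rotated]) (use i in \<open>auto simp: curve_section_def\<close>)
qed blast

lemma frac_integrable_has_integral:
  assumes x: "0 \<le> x" "x \<le> y" and int: "frac_integrable v J F x y"
  shows "((\<lambda>u. F (v (T u))) has_integral frac_integral v J F x y) {S x..S y}"
proof -
  define P where "P = {(z, N). subdivision x y z N}"
  define lo where "lo = (\<lambda>(z, N). \<Sum>i<N. (INF \<theta>\<in>curve_section v (z i) (z (Suc i)). F \<theta>) * (J (v (z (Suc i))) - J (v (z i))))"
  define up where "up = (\<lambda>(z, N). \<Sum>i<N. (SUP \<theta>\<in>curve_section v (z i) (z (Suc i)). F \<theta>) * (J (v (z (Suc i))) - J (v (z i))))"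
  define I where "I = frac_integral v J F x y"
  have I: "I = (SUP p\<in>P. lo p)" "I = (INF p\<in>P. up p)"
    using int unfolding I_def frac_integral_def frac_integrable_def lower_frac_integral_def upper_frac_integral_def P_def lo_def up_def
    by simp_all
  have bdd: "bdd_below (F ` curve_section v x y)" "bdd_above (F ` curve_section v x y)"
    using int by (auto simp: frac_integrable_def bounded_imp_bdd_below bounded_imp_bdd_above)
  have below: "\<exists>s. (s has_integral lo p) {S x..S y} \<and> (\<forall>u\<in>{S x..S y}. s u \<le> F (v (T u)))" if "p \<in> P" for p
    using step_below[OF _ x(1) bdd(1)] that unfolding P_def lo_def by (auto simp: case_prod_unfold)
  have above: "\<exists>s. (s has_integral up p) {S x..S y} \<and> (\<forall>u\<in>{S x..S y}. F (v (T u)) \<le> s u)" if "p \<in> P" for p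
    using step_above[OF _ x(1) bdd(2)] that unfolding P_def up_def by (auto simp: case_prod_unfold)
  have le: "lo p \<le> up q" if "p \<in> P" "q \<in> P" for p q
    using below[OF that(1)] above[OF that(2)] by (meson has_integral_le order_trans)
  have P: "P \<noteq> {}" using fine_subdivision_exists[OF x(2), of 1] by (auto simp: P_def)
  have b: "bdd_above (lo ` P)" "bdd_below (up ` P)"
    using P le by (auto simp: bdd_above_def bdd_below_def ex_in_conv[symmetric]; blast)+
  have ex: "\<exists>p\<in>P. lo p > I - e" "\<exists>p\<in>P. up p < I + e" if "e > 0" for e
    using less_cSUP_iff[OF P b(1), of "I - e"] cINF_less_iff[OF P b(2), of "I + e"] I that by auto
  have "(\<lambda>u. F (v (T u))) integrable_on cbox (S x) (S y)"
  proof (rule integrable_straddle_interval)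
    fix e :: real assume "e > 0"
    then obtain p q where pq: "p \<in> P" "q \<in> P" "lo p > I - e / 2" "up q < I + e / 2" using ex[of "e / 2"] by auto
    obtain s t where "(s has_integral lo p) {S x..S y}" "\<forall>u\<in>{S x..S y}. s u \<le> F (v (T u))"
      "(t has_integral up q) {S x..S y}" "\<forall>u\<in>{S x..S y}. F (v (T u)) \<le> t u"
      using below[OF pq(1)] above[OF pq(2)] by blast
    then show "\<exists>g h i j. (g has_integral i) (cbox (S x) (S y)) \<and> (h has_integral j) (cbox (S x) (S y)) \<and>
       \<bar>i - j\<bar> < e \<and> (\<forall>u\<in>cbox (S x) (S y). g u \<le> F (v (T u)) \<and> F (v (T u)) \<le> h u)"
      using le[OF pq(1,2)] pq by (intro exI[of _ s] exI[of _ t] exI[of _ "lo p"] exI[of _ "up q"]) auto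
  qed
  then obtain K where K: "((\<lambda>u. F (v (T u))) has_integral K) {S x..S y}" by auto
  have "lo p \<le> K" "K \<le> up p" if "p \<in> P" for p
    using below[OF that] above[OF that] K by (meson has_integral_le)+
  then have "(SUP p\<in>P. lo p) \<le> K" "K \<le> (INF p\<in>P. up p)"
    by (auto intro!: cSUP_least cINF_greatest P)
  then have "I \<le> K" "K \<le> I" using I by simp_all
  then show ?thesis using K by (simp add: I_def)
qed

text \<open>The fractal integral is by definition a supremum of lower sums. By uniform continuity the lower
  sums of fine subdivisions come arbitrarily close to the ordinary integral. This is how the
  transform of \<open>f\<close>, whose integrand is continuous, is evaluated.\<close>
lemma lower_frac_integral_continuous:
  assumes x: "0 \<le> x" "x \<le> y" and F: "continuous_on {x..y} (\<lambda>t. F (v t))"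
  shows "frac_integral v J F x y = integral {S x..S y} (\<lambda>u. F (v (T u)))"
proof -
  define P where "P = {(z, N). subdivision x y z N}"
  define lo where "lo = (\<lambda>(z, N). \<Sum>i<N. (INF \<theta>\<in>curve_section v (z i) (z (Suc i)). F \<theta>) * (J (v (z (Suc i))) - J (v (z i))))"
  have I: "frac_integral v J F x y = (SUP p\<in>P. lo p)"
    unfolding frac_integral_def lower_frac_integral_def P_def lo_def by simp
  have "continuous_on {S x..S y} (\<lambda>u. F (v (T u)))"
    by (rule continuous_on_compose2[OF F continuous_on_subset[OF T_continuous]]) (use section_param[OF x(1) _ x(2)] in auto)
  then have K: "((\<lambda>u. F (v (T u))) has_integral integral {S x..S y} (\<lambda>u. F (v (T u)))) {S x..S y}" (is "(_ has_integral ?K) _")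
    by (intro integrable_integral integrable_continuous_real)
  have "compact (F ` curve_section v x y)"
    unfolding curve_section_def image_image using F by (intro compact_continuous_image) auto
  then have bdd: "bdd_below (F ` curve_section v x y)" by (intro bounded_imp_bdd_below compact_imp_bounded)
  have P: "P \<noteq> {}" using fine_subdivision_exists[OF x(2), of 1] by (auto simp: P_def)
  have lo_le: "lo p \<le> ?K" if "p \<in> P" for p
    using step_below[OF _ x(1) bdd] that K unfolding P_def lo_def
    by (auto simp: case_prod_unfold) (meson has_integral_le)
  have "?K \<le> (SUP p\<in>P. lo p)"
  proof (rule field_le_epsilon)
    fix e :: real assume e: "e > 0"
    define d where "d = e / (S y - S x + 1)"
    have Sxy: "S y - S x \<ge> 0" using S_le_iff[of x y] x by simp
    have d: "d > 0" "d * (S y - S x) \<le> e" using e Sxy by (auto simp: d_def field_simps)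
    have "uniformly_continuous_on {x..y} (\<lambda>t. F (v t))" using F by (intro compact_uniformly_continuous) auto
    then obtain \<delta> where \<delta>: "\<delta> > 0" "\<And>t t'. t \<in> {x..y} \<Longrightarrow> t' \<in> {x..y} \<Longrightarrow> dist t' t < \<delta> \<Longrightarrow> dist (F (v t')) (F (v t)) < d"
      unfolding uniformly_continuous_on_def using d(1) by metis
    obtain z N where z: "subdivision x y z N" "\<And>i. i < N \<Longrightarrow> z (Suc i) - z i \<le> \<delta> / 2"
      using fine_subdivision_exists[OF x(2), of "\<delta> / 2"] \<delta>(1) by auto
    have "\<exists>s. (s has_integral lo (z, N)) {S x..S y} \<and> (\<forall>u\<in>{S x..S y}. F (v (T u)) - d \<le> s u)"
      unfolding lo_def prod.case
    proof (rule step_function_exists[OF z(1) x(1), where R="\<lambda>t c. F (v t) - d \<le> c"])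
      show "\<exists>c. F (v t) - d \<le> c" for t by blast
      fix i t assume i: "i < N" "z i \<le> t" "t \<le> z (Suc i)"
      have zb: "x \<le> z i" "z (Suc i) \<le> y" using subdivision_bounds[OF z(1)] i by auto
      show "F (v t) - d \<le> (INF \<theta>\<in>curve_section v (z i) (z (Suc i)). F \<theta>)"
      proof (rule cINF_greatest)
        show "curve_section v (z i) (z (Suc i)) \<noteq> {}" using i by (auto simp: curve_section_def)
        fix \<theta> assume "\<theta> \<in> curve_section v (z i) (z (Suc i))"
        then obtain t' where t': "z i \<le> t'" "t' \<le> z (Suc i)" "\<theta> = v t'" by (auto simp: curve_section_def)
        have "dist (F (v t')) (F (v t)) < d"
          using i t' zb z(2)[OF i(1)] \<delta>(1) by (intro \<delta>(2)) (auto simp: dist_real_def)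
        then show "F (v t) - d \<le> F \<theta>" using t'(3) by (simp add: dist_real_def)
      qed
    qed
    then obtain s where s: "(s has_integral lo (z, N)) {S x..S y}" "\<forall>u\<in>{S x..S y}. F (v (T u)) - d \<le> s u" by blast
    have "((\<lambda>u. F (v (T u)) - d) has_integral (?K - (S y - S x) * d)) {S x..S y}"
      using has_integral_diff[OF K has_integral_const_real[of d "S x" "S y"]] Sxy by simp
    then have "?K - (S y - S x) * d \<le> lo (z, N)" using s by (meson has_integral_le)
    also have "\<dots> \<le> (SUP p\<in>P. lo p)"
      by (rule cSUP_upper) (use z(1) lo_le in \<open>auto simp: P_def bdd_above_def\<close>)
    finally show "?K \<le> (SUP p\<in>P. lo p) + e" using d(2) by (simp add: mult.commute)
  qed
  moreover have "(SUP p\<in>P. lo p) \<le> ?K" using P lo_le by (rule cSUP_least)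
  ultimately show ?thesis using I by simp
qed

end

section \<open>Improper integrals\<close>

lemma nonneg_improper_set_integrable:
  fixes h :: "real \<Rightarrow> real" and a b :: ereal
  assumes ab: "a < b" and cont: "\<And>x. a < ereal x \<Longrightarrow> ereal x < b \<Longrightarrow> isCont h x"
    and nonneg: "\<And>x. a < ereal x \<Longrightarrow> ereal x < b \<Longrightarrow> 0 \<le> h x"
    and lim: "((\<lambda>(r, R). integral {r..R} h) \<longlongrightarrow> I) (filtercomap ereal (at_right a) \<times>\<^sub>F filtercomap ereal (at_left b))"
  shows "set_integrable lborel (einterval a b) h"
proof -
  obtain u l :: "nat \<Rightarrow> real" where ul: "einterval a b = (\<Union>i. {l i .. u i})"
    "incseq u" "decseq l" "\<And>i. l i < u i" "\<And>i. a < l i" "\<And>i. u i < b"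
    "(\<lambda>i. ereal (l i)) \<longlonglongrightarrow> a" "(\<lambda>i. ereal (u i)) \<longlonglongrightarrow> b"
    by (rule einterval_Icc_approximation[OF ab]) (rule that)
  have c: "continuous_on {l i..u i} h" for i
  proof (intro continuous_at_imp_continuous_on ballI cont)
    fix x assume x: "x \<in> {l i..u i}"
    then have "ereal (l i) \<le> ereal x" "ereal x \<le> ereal (u i)" by auto
    then show "a < ereal x" "ereal x < b"
      using less_le_trans[OF ul(5)[of i]] le_less_trans[OF _ ul(6)[of i]] by auto
  qed
  have i: "set_integrable lborel {l i..u i} h" for i
    by (rule borel_integrable_atLeastAtMost'[OF c])
  have eq: "(LBINT x=l i..u i. h x) = integral {l i..u i} h" for i
    using ul(4)[of i] by (simp add: interval_integral_Icc set_borel_integral_eq_integral(2)[OF i])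
  show ?thesis
  proof (rule interval_integral_Icc_approx_nonneg(1)[OF ab ul(1-8) i])
    show "set_borel_measurable lborel (einterval a b) h"
    proof -
      have "continuous_on (einterval a b) h"
        using cont by (intro continuous_at_imp_continuous_on) (auto simp: einterval_iff)
      from borel_measurable_continuous_on_indicator[OF _ this] show ?thesis
        by (simp add: set_borel_measurable_def)
    qed
    show "AE x in lborel. a < ereal x \<longrightarrow> ereal x < b \<longrightarrow> 0 \<le> h x" using nonneg by auto
    have "filterlim l (filtercomap ereal (at_right a)) sequentially"
      unfolding filterlim_filtercomap_iff o_def filterlim_at using ul(5,7) by (auto intro!: always_eventually less_imp_neq[THEN not_sym])
    moreover have "filterlim u (filtercomap ereal (at_left b)) sequentially"
      unfolding filterlim_filtercomap_iff o_def filterlim_at using ul(6,8) by (auto intro!: always_eventually simp: less_imp_neq)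
    ultimately have "filterlim (\<lambda>i. (l i, u i)) (filtercomap ereal (at_right a) \<times>\<^sub>F filtercomap ereal (at_left b)) sequentially"
      by (rule filterlim_Pair)
    from filterlim_compose[OF lim this] show "(\<lambda>i. LBINT x=l i..u i. h x) \<longlonglongrightarrow> I" unfolding eq by simp
  qed
qed

lemma weighted_integrable_compare:
  fixes g :: "real \<Rightarrow> real"
  assumes g: "continuous_on UNIV g" and A: "A \<subseteq> {0<..}" "A \<in> sets borel"
    and int: "set_integrable lborel A (\<lambda>u. \<bar>g u\<bar> * u powr (\<sigma> - 1))"
    and C: "\<And>u. u \<in> A \<Longrightarrow> u powr (x - \<sigma>) \<le> C"
  shows "set_integrable lborel A (\<lambda>u. g u * u powr (x - 1))"
proof (rule set_integrable_bound[OF _ weighted_measurable[OF g A]])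
  show "set_integrable lborel A (\<lambda>u. C * (\<bar>g u\<bar> * u powr (\<sigma> - 1)))" using int by simp
  show "AE u in lborel. u \<in> A \<longrightarrow> norm (g u * u powr (x - 1)) \<le> norm (C * (\<bar>g u\<bar> * u powr (\<sigma> - 1)))"
  proof (intro AE_I2 impI)
    fix u assume u: "u \<in> A"
    have "u powr (x - 1) = u powr (x - \<sigma>) * u powr (\<sigma> - 1)" using u A by (auto simp: powr_add[symmetric])
    also have "\<dots> \<le> C * u powr (\<sigma> - 1)" using C[OF u] by (intro mult_right_mono) auto
    finally have "\<bar>g u\<bar> * u powr (x - 1) \<le> \<bar>g u\<bar> * (C * u powr (\<sigma> - 1))" by (intro mult_left_mono) auto
    then have "norm (g u * u powr (x - 1)) \<le> C * (\<bar>g u\<bar> * u powr (\<sigma> - 1))"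
      by (simp add: abs_mult mult_ac)
    then show "norm (g u * u powr (x - 1)) \<le> norm (C * (\<bar>g u\<bar> * u powr (\<sigma> - 1)))"
      unfolding real_norm_def by linarith
  qed
qed

lemma weighted_integrable_strip:
  fixes g :: "real \<Rightarrow> real"
  assumes g: "continuous_on UNIV g" and c: "c > 0"
    and near: "set_integrable lborel {0<..<c} (\<lambda>u. \<bar>g u\<bar> * u powr (\<sigma>1 - 1))"
    and far: "set_integrable lborel {c<..} (\<lambda>u. \<bar>g u\<bar> * u powr (\<sigma>2 - 1))"
    and x: "\<sigma>1 \<le> x" "x \<le> \<sigma>2"
  shows "weighted_integrable g x"
proof -
  have 1: "set_integrable lborel {0<..<c} (\<lambda>u. g u * u powr (x - 1))"
    by (rule weighted_integrable_compare[OF g _ _ near, where C="c powr (x - \<sigma>1)"]) (use x in \<open>auto intro!: powr_mono2\<close>)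
  have 2: "set_integrable lborel {c<..} (\<lambda>u. g u * u powr (x - 1))"
    by (rule weighted_integrable_compare[OF g _ _ far, where C="c powr (x - \<sigma>2)"]) (use x c in \<open>auto intro!: powr_mono2'\<close>)
  have "set_integrable lborel {c} (\<lambda>u. g u * u powr (x - 1))"
    using borel_integrable_atLeastAtMost'[of c c "\<lambda>u. g u * u powr (x - 1)"] by simp
  from set_integrable_Un[OF set_integrable_Un[OF 1 this] 2]
  have "set_integrable lborel ({0<..<c} \<union> {c} \<union> {c<..}) (\<lambda>u. g u * u powr (x - 1))" by simp
  moreover have "{0<..<c} \<union> {c} \<union> {c<..} = {0<..}" using c by auto
  ultimately show ?thesis by (simp add: weighted_integrable_def)
qed

text \<open>For \<open>n > 0\<close> the integrand contains a derivative that may be discontinuous. Partial integration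
  expresses a primitive through the previous derivative, which is continuous.\<close>
lemma weighted_primitive_exists:
  fixes D :: "nat \<Rightarrow> real \<Rightarrow> real" and s :: complex
  assumes D0: "continuous_on {0<..} (D 0)"
    and D: "\<And>k u. k < n \<Longrightarrow> u > 0 \<Longrightarrow> (D k has_real_derivative D (Suc k) u) (at u)"
  obtains H where "\<And>u. u > 0 \<Longrightarrow> (H has_vector_derivative of_real (D n u) * of_real u powr (s - 1)) (at u)"
proof (cases n)
  case 0
  have "continuous_on {0<..} (\<lambda>u. complex_of_real (D n u) * of_real u powr (s - 1))"
    using D0 0 by (auto intro!: continuous_intros)
  from halfline_antiderivative[OF this] show ?thesis using that by blast
next
  case (Suc m)
  have "continuous_on {0<..} (D m)"
    by (rule DERIV_continuous_on[of _ _ "D (Suc m)"]) (use D[of m] Suc in \<open>auto intro: DERIV_subset\<close>)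
  then have "continuous_on {0<..} (\<lambda>u. complex_of_real (D m u) * of_real u powr (s - 1 - 1))"
    by (auto intro!: continuous_intros)
  then obtain Q where Q: "\<And>u. u > 0 \<Longrightarrow> (Q has_vector_derivative of_real (D m u) * of_real u powr (s - 1 - 1)) (at u)"
    using halfline_antiderivative by blast
  show ?thesis
  proof (rule that[of "\<lambda>u. of_real (D m u) * of_real u powr (s - 1) - (s - 1) * Q u"])
    fix u :: real assume u: "u > 0"
    have "((\<lambda>u. complex_of_real (D m u)) has_vector_derivative of_real (D n u)) (at u)"
      using D[of m u] u Suc by (intro has_vector_derivative_of_real) (auto simp: has_real_derivative_iff_has_vector_derivative)
    from has_vector_derivative_diff[OF has_vector_derivative_mult[OF this has_vector_derivative_of_real_powr[OF u, of "s - 1" UNIV]]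
        has_vector_derivative_mult_right[OF Q[OF u], of "s - 1"]]
    show "((\<lambda>u. of_real (D m u) * of_real u powr (s - 1) - (s - 1) * Q u) has_vector_derivative of_real (D n u) * of_real u powr (s - 1)) (at u)"
      by (simp add: algebra_simps)
  qed
qed

text \<open>If \<open>g u \<noteq> 0\<close>, the integrand keeps its sign near \<open>u\<close> and dominates a multiple of \<open>1 / (u - \<tau>)\<close>,
  whose integral diverges logarithmically.\<close>
lemma divergent_kernel_vanishing:
  fixes g :: "real \<Rightarrow> real"
  assumes g: "continuous_on UNIV g" and p: "p \<le> -1" and u: "u > 0"
    and lim: "((\<lambda>(r, R). integral {r..R} (\<lambda>\<tau>. g \<tau> * (u - \<tau>) powr p)) \<longlongrightarrow> I) (at_right 0 \<times>\<^sub>F at_left u)"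
  shows "g u = 0"
proof (rule ccontr)
  assume nz: "g u \<noteq> 0"
  define \<epsilon> where "\<epsilon> = sgn (g u)"
  define c where "c = \<bar>g u\<bar> / 2"
  have c: "c > 0" using nz by (simp add: c_def)
  have "isCont (\<lambda>\<tau>. \<epsilon> * g \<tau>) u" using g by (auto simp: continuous_on_eq_continuous_at intro!: continuous_intros)
  then have "((\<lambda>\<tau>. \<epsilon> * g \<tau>) \<longlongrightarrow> \<epsilon> * g u) (at_left u)" by (simp add: isCont_def filterlim_at_split)
  moreover have "\<epsilon> * g u > c" using nz by (auto simp: \<epsilon>_def c_def sgn_if)
  ultimately have "eventually (\<lambda>\<tau>. \<epsilon> * g \<tau> > c) (at_left u)" by (rule order_tendstoD)
  then obtain a1 where a1: "a1 < u" "\<And>\<tau>. a1 < \<tau> \<Longrightarrow> \<tau> < u \<Longrightarrow> \<epsilon> * g \<tau> > c"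
    by (auto simp: eventually_at_left_field)
  from lim have "eventually (\<lambda>x. dist (case x of (r, R) \<Rightarrow> integral {r..R} (\<lambda>\<tau>. g \<tau> * (u - \<tau>) powr p)) I < 1) (at_right 0 \<times>\<^sub>F at_left u)"
    by (rule tendstoD) simp
  then obtain P Q where P: "eventually P (at_right (0::real))" and Q: "eventually Q (at_left u)"
    and PQ: "\<And>x y. P x \<Longrightarrow> Q y \<Longrightarrow> dist (integral {x..y} (\<lambda>\<tau>. g \<tau> * (u - \<tau>) powr p)) I < 1"
    unfolding eventually_prod_filter by auto
  obtain a2 where a2: "a2 < u" "\<And>y. a2 < y \<Longrightarrow> y < u \<Longrightarrow> Q y" using Q by (auto simp: eventually_at_left_field)
  obtain a3 where a3: "a3 > 0" "\<And>x. 0 < x \<Longrightarrow> x < a3 \<Longrightarrow> P x" using P by (auto simp: eventually_at_right_field)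
  define a where "a = Max {0, a1, a2, u - 1}"
  have a: "a < u" "0 \<le> a" "a1 \<le> a" "a2 \<le> a" "u - 1 \<le> a" using a1 a2 u by (auto simp: a_def)
  define r where "r = (a + u) / 2"
  have r: "a < r" "r < u" "0 < r" using a by (auto simp: r_def)
  define x where "x = min (a3 / 2) (r / 2)"
  have x: "P x" "0 < x" "x < r" using a3 r by (auto simp: x_def)
  \<comment> \<open>the point \<open>R\<close> is chosen so that \<open>c / (u - \<tau>)\<close> has integral 3 over \<open>[r, R]\<close>\<close>
  define \<eta> where "\<eta> = (u - r) * exp (- (3 / c))"
  define R where "R = u - \<eta>"
  have "exp (- (3 / c)) < 1" using c by simp
  then have "\<eta> < (u - r) * 1" unfolding \<eta>_def using r by (intro mult_strict_left_mono) auto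
  moreover have "0 < \<eta>" unfolding \<eta>_def using r by (intro mult_pos_pos) auto
  ultimately have R: "r < R" "R < u" by (simp_all add: R_def)
  have cont: "continuous_on {s..t} (\<lambda>\<tau>. g \<tau> * (u - \<tau>) powr p)" if "t < u" for s t
    using that by (auto intro!: continuous_intros continuous_on_subset[OF g])
  have "integral {x..r} (\<lambda>\<tau>. g \<tau> * (u - \<tau>) powr p) + integral {r..R} (\<lambda>\<tau>. g \<tau> * (u - \<tau>) powr p) = integral {x..R} (\<lambda>\<tau>. g \<tau> * (u - \<tau>) powr p)"
    using x R r by (intro Henstock_Kurzweil_Integration.integral_combine integrable_continuous_real cont) auto
  moreover have "Q r" "Q R" using a2 a r R by auto
  then have "dist (integral {x..r} (\<lambda>\<tau>. g \<tau> * (u - \<tau>) powr p)) I < 1" "dist (integral {x..R} (\<lambda>\<tau>. g \<tau> * (u - \<tau>) powr p)) I < 1"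
    using PQ x by auto
  ultimately have small: "\<bar>integral {r..R} (\<lambda>\<tau>. g \<tau> * (u - \<tau>) powr p)\<bar> < 2" by (auto simp: dist_real_def)
  have "((\<lambda>\<tau>. c * (1 / (u - \<tau>))) has_integral (- (c * ln (u - R)) - - (c * ln (u - r)))) {r..R}"
    by (rule fundamental_theorem_of_calculus)
       (use R in \<open>auto intro!: derivative_eq_intros simp: has_real_derivative_iff_has_vector_derivative[symmetric] field_simps\<close>)
  moreover have "ln (u - R) = ln (u - r) - 3 / c"
    using r by (simp add: R_def \<eta>_def ln_mult)
  ultimately have "((\<lambda>\<tau>. c * (1 / (u - \<tau>))) has_integral 3) {r..R}" using c by (simp add: algebra_simps)
  moreover have "((\<lambda>\<tau>. \<epsilon> * (g \<tau> * (u - \<tau>) powr p)) has_integral \<epsilon> * integral {r..R} (\<lambda>\<tau>. g \<tau> * (u - \<tau>) powr p)) {r..R}"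
    by (intro has_integral_mult_right integrable_integral integrable_continuous_real cont R)
  ultimately have "3 \<le> \<epsilon> * integral {r..R} (\<lambda>\<tau>. g \<tau> * (u - \<tau>) powr p)"
  proof (rule has_integral_le)
    fix \<tau> assume \<tau>: "\<tau> \<in> {r..R}"
    then have t: "0 < u - \<tau>" "u - \<tau> \<le> 1" using R r a by auto
    have "1 / (u - \<tau>) = (u - \<tau>) powr (-1)" using t by (simp add: powr_minus divide_inverse)
    also have "\<dots> \<le> (u - \<tau>) powr p" using t p by (intro powr_mono') auto
    finally have "c * (1 / (u - \<tau>)) \<le> c * (u - \<tau>) powr p" using c by (intro mult_left_mono) auto
    also have "\<dots> \<le> (\<epsilon> * g \<tau>) * (u - \<tau>) powr p" using a1(2)[of \<tau>] \<tau> R r a by (intro mult_right_mono) auto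
    finally show "c * (1 / (u - \<tau>)) \<le> \<epsilon> * (g \<tau> * (u - \<tau>) powr p)" by (simp add: mult.assoc)
  qed
  also have "\<dots> \<le> \<bar>integral {r..R} (\<lambda>\<tau>. g \<tau> * (u - \<tau>) powr p)\<bar>" using nz by (auto simp: \<epsilon>_def sgn_if)
  finally show False using small by simp
qed

context fractal_halfline
begin

section \<open>Transforms along the curve\<close>

text \<open>The cut-off at \<open>0\<close> makes the pullback of a function continuous along the curve a continuous function
  on the whole line.\<close>
definition rise_pullback :: "('a \<Rightarrow> real) \<Rightarrow> real \<Rightarrow> real" where
  "rise_pullback F u = F (v (T (max 0 u)))"

lemma rise_pullback_eq: "u \<ge> 0 \<Longrightarrow> rise_pullback F u = F (v (T u))"
  by (simp add: rise_pullback_def)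

lemma J_T: "u \<ge> 0 \<Longrightarrow> J (v (T u)) = u"
  using J_v[of "T u"] T_nonneg[of u] S_T[of u] base by simp

lemma T_at_left:
  assumes "z > 0"
  shows "filterlim T (at_left z) (at_left (S z))"
proof (rule filterlim_at[THEN iffD2, OF conjI])
  have "T x \<in> {..<z} \<and> T x \<noteq> z" if "x < S z" for x using T_less[OF that] T_S[of z] assms by simp
  then show "eventually (\<lambda>x. T x \<in> {..<z} \<and> T x \<noteq> z) (at_left (S z))"
    by (auto simp: eventually_at_left_field intro!: exI[of _ "S z - 1"])
  have "isCont T (S z)" using T_continuous by (simp add: continuous_on_eq_continuous_at)
  then show "(T \<longlongrightarrow> z) (at_left (S z))"
    using T_S[of z] assms by (simp add: isCont_def filterlim_at_split)
qed

lemma T_at_right: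
  assumes "z \<ge> 0"
  shows "filterlim T (at_right z) (at_right (S z))"
proof (rule filterlim_at[THEN iffD2, OF conjI])
  have "T x \<in> {z<..} \<and> T x \<noteq> z" if "x > S z" for x using T_less[OF that] T_S[of z] assms by simp
  then show "eventually (\<lambda>x. T x \<in> {z<..} \<and> T x \<noteq> z) (at_right (S z))"
    by (auto simp: eventually_at_right_field intro!: exI[of _ "S z + 1"])
  have "isCont T (S z)" using T_continuous by (simp add: continuous_on_eq_continuous_at)
  then show "(T \<longlongrightarrow> z) (at_right (S z))"
    using T_S[of z] assms by (simp add: isCont_def filterlim_at_split)
qed

text \<open>The two ends of an improper fractal integral are carried to the rise variable by \<open>T\<close>; \<open>E\<close> describes
  how the upper end is approached there, and \<open>m\<close> separates the lower end from the upper one.\<close>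
lemma pullback_improper_limit:
  assumes c: "0 \<le> c" and int: "frac_improper_integrable v J F c b"
    and E: "filterlim T (filtercomap ereal (at_left b)) E"
    and m: "S c < m" "eventually (\<lambda>R. m \<le> R \<and> ereal (T R) < b) E"
    and nontrivial: "improper_ends c b \<noteq> bot"
    and h: "\<And>u. u > S c \<Longrightarrow> F (v (T u)) = h u"
  shows "((\<lambda>(r, R). integral {r..R} h) \<longlongrightarrow> frac_improper_integral v J F c b) (at_right (S c) \<times>\<^sub>F E)"
proof -
  let ?I = "\<lambda>x y. frac_integral v J F x y"
  obtain I where I: "((\<lambda>(x, y). ?I x y) \<longlongrightarrow> I) (improper_ends c b)"
    using int unfolding frac_improper_integrable_def by blast
  then have eq: "frac_improper_integral v J F c b = I"
    unfolding frac_improper_integral_def by (rule tendsto_Lim[OF nontrivial])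
  have "filterlim (\<lambda>x. (T (fst x), T (snd x))) (improper_ends c b) (at_right (S c) \<times>\<^sub>F E)"
    unfolding improper_ends_def
    by (intro filterlim_Pair filterlim_compose[OF T_at_right[OF c] filterlim_fst] filterlim_compose[OF E filterlim_snd])
  from filterlim_compose[OF I this]
  have "((\<lambda>x. ?I (T (fst x)) (T (snd x))) \<longlongrightarrow> I) (at_right (S c) \<times>\<^sub>F E)" by simp
  moreover have "eventually (\<lambda>x. ?I (T (fst x)) (T (snd x)) = (case x of (r, R) \<Rightarrow> integral {r..R} h)) (at_right (S c) \<times>\<^sub>F E)"
    unfolding eventually_prod_filter
  proof (intro exI conjI allI impI)
    show "eventually (\<lambda>r. S c < r \<and> r < m) (at_right (S c))" using m(1) by (auto simp: eventually_at_right_field)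
    show "eventually (\<lambda>R. m \<le> R \<and> ereal (T R) < b) E" by (rule m)
    fix r R assume rR: "S c < r \<and> r < m" "m \<le> R \<and> ereal (T R) < b"
    have Sc: "0 \<le> S c" using S_le_iff[of 0 c] S_0 c by simp
    have T: "c < T r" "T r \<le> T R" using T_less[of "S c" r] T_S[OF c] T_le[of r R] rR by auto
    then have "frac_integrable v J F (T r) (T R)" using int rR by (simp add: frac_improper_integrable_def)
    from integral_unique[OF frac_integrable_has_integral[OF _ T(2) this]]
    have "?I (T r) (T R) = integral {r..R} (\<lambda>u. F (v (T u)))" using T c rR Sc by (simp add: S_T)
    also have "\<dots> = integral {r..R} h"
      by (rule Henstock_Kurzweil_Integration.integral_cong) (use rR h in auto)
    finally show "?I (T (fst (r, R))) (T (snd (r, R))) = (case (r, R) of (r, R) \<Rightarrow> integral {r..R} h)" by simp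
  qed
  ultimately show ?thesis unfolding eq by (rule Lim_transform_eventually)
qed

lemma pullback_limit_left:
  assumes "0 \<le> c" "c < z" "frac_improper_integrable v J F c (ereal z)" "\<And>u. u > S c \<Longrightarrow> F (v (T u)) = h u"
  shows "((\<lambda>(r, R). integral {r..R} h) \<longlongrightarrow> frac_improper_integral v J F c (ereal z)) (at_right (S c) \<times>\<^sub>F at_left (S z))"
proof (rule pullback_improper_limit[OF assms(1,3) _ _ _ _ assms(4)])
  have less: "S c < S z" using S_less_iff assms by simp
  then show "S c < (S c + S z) / 2" by simp
  show "filterlim T (filtercomap ereal (at_left (ereal z))) (at_left (S z))"
    unfolding at_left_ereal filtercomap_ereal_filtermap using assms by (intro T_at_left) simp
  show "improper_ends c (ereal z) \<noteq> bot" by (simp add: improper_ends_real prod_filter_eq_bot)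
  have "T R < z" if "R < S z" for R using T_less[OF that] T_S[of z] assms by simp
  then show "eventually (\<lambda>R. (S c + S z) / 2 \<le> R \<and> ereal (T R) < ereal z) (at_left (S z))"
    using less by (auto simp: eventually_at_left_field intro!: exI[of _ "(S c + S z) / 2"])
qed

lemma pullback_limit_infinity:
  assumes "0 \<le> c" "frac_improper_integrable v J F c \<infinity>" "\<And>u. u > S c \<Longrightarrow> F (v (T u)) = h u"
  shows "((\<lambda>(r, R). integral {r..R} h) \<longlongrightarrow> frac_improper_integral v J F c \<infinity>) (at_right (S c) \<times>\<^sub>F at_top)"
proof (rule pullback_improper_limit[OF assms(1,2) _ _ _ _ assms(3)])
  show "filterlim T (filtercomap ereal (at_left \<infinity>)) at_top"
    unfolding at_left_PInf filtercomap_ereal_filtermap by (rule T_at_top)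
  show "improper_ends c \<infinity> \<noteq> bot" by (simp add: improper_ends_infinity prod_filter_eq_bot)
  show "eventually (\<lambda>R. S c + 1 \<le> R \<and> ereal (T R) < \<infinity>) at_top" by (simp add: eventually_ge_at_top)
qed simp

text \<open>A function with a fractal derivative is continuous along the curve: its increments are difference
  quotients times increments of the continuous rise.\<close>
lemma frac_C_continuous:
  assumes "f \<in> frac_C (curve_points v a0) J n"
  shows "continuous_on {0..} (\<lambda>z. f (v z))"
proof (cases n)
  case 0
  then have "continuous_on (curve_points v a0) f" using assms by (simp add: frac_C_def)
  then show ?thesis
    by (rule continuous_on_compose2[OF _ continuous_on_subset[OF v_continuous]]) (use base in auto)
next
  case (Suc m)
  show ?thesis
    unfolding continuous_on_def
  proof
    fix z :: real assume z: "z \<in> {0..}"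
    then have z': "z \<ge> a0" using base by auto
    have "frac_differentiable_at (curve_points v a0) J ((frac_deriv (curve_points v a0) J ^^ 0) f) (v z)"
      using assms Suc z' unfolding frac_C_def by blast
    then obtain l where l: "(frac_quot J f (v z) \<longlongrightarrow> l) (at (v z) within curve_points v a0)"
      by (auto simp: frac_differentiable_at_def)
    have ev: "eventually (\<lambda>x. x \<in> {0..} \<and> x \<noteq> z) (at z within {0..})"
      by (simp add: eventually_at_filter)
    have "filterlim v (at (v z) within curve_points v a0) (at z within {0..})"
    proof (rule filterlim_at[THEN iffD2, OF conjI])
      show "eventually (\<lambda>x. v x \<in> curve_points v a0 \<and> v x \<noteq> v z) (at z within {0..})"
        using ev
      proof eventually_elim
        case (elim x)
        then have "x \<ge> a0" using base by auto
        then show ?case using elim z' v_inj by (auto dest: inj_onD)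
      qed
      have "continuous_on {0..} v" using v_continuous base by (auto intro: continuous_on_subset)
      then show "(v \<longlongrightarrow> v z) (at z within {0..})" using z by (simp add: continuous_on_def)
    qed
    from filterlim_compose[OF l this]
    have 1: "((\<lambda>x. frac_quot J f (v z) (v x)) \<longlongrightarrow> l) (at z within {0..})" .
    have "(S \<longlongrightarrow> S z) (at z within {0..})" using S_continuous z by (simp add: continuous_on_def)
    then have "((\<lambda>x. frac_quot J f (v z) (v x) * (S x - S z) + f (v z)) \<longlongrightarrow> l * (S z - S z) + f (v z)) (at z within {0..})"
      by (intro tendsto_intros 1)
    moreover have "eventually (\<lambda>x. frac_quot J f (v z) (v x) * (S x - S z) + f (v z) = f (v x)) (at z within {0..})"
      using ev
    proof eventually_elim
      case (elim x)
      then have "S x \<noteq> S z" using z S_inj by (auto dest: inj_onD)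
      then show ?case using elim z base by (simp add: frac_quot_def J_v)
    qed
    ultimately show "((\<lambda>z. f (v z)) \<longlongrightarrow> f (v z)) (at z within {0..})"
      by (simp add: Lim_transform_eventually)
  qed
qed

lemma continuous_on_rise_pullback:
  assumes "continuous_on {0..} (\<lambda>z. f (v z))"
  shows "continuous_on UNIV (rise_pullback f)"
  unfolding rise_pullback_def
  by (rule continuous_on_compose2[OF assms])
     (auto intro!: continuous_on_compose2[OF T_continuous] continuous_intros T_nonneg)

lemma frac_integral_improper:
  assumes h: "set_integrable lborel {0<..} h"
    and F: "\<And>x y. 0 < x \<Longrightarrow> x \<le> y \<Longrightarrow> frac_integral v J F x y = integral {S x..S y} h"
  shows "frac_improper_integral v J F 0 \<infinity> = (LINT u:{0<..}|lborel. h u)"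
  unfolding frac_improper_integral_def improper_ends_infinity
proof (rule tendsto_Lim)
  show "\<not> trivial_limit halfline_ends" by (rule halfline_ends_nontrivial)
  have "filterlim (\<lambda>x. (S (fst x), S (snd x))) halfline_ends halfline_ends"
    by (intro filterlim_Pair filterlim_compose[OF S_at_right_0 filterlim_fst] filterlim_compose[OF unbounded filterlim_snd])
  from filterlim_compose[OF tendsto_halfline_integral[OF h] this]
  have "((\<lambda>x. LINT u:{S (fst x)..S (snd x)}|lborel. h u) \<longlongrightarrow> (LINT u:{0<..}|lborel. h u)) halfline_ends"
    by simp
  then show "((\<lambda>(x, y). frac_integral v J F x y) \<longlongrightarrow> (LINT u:{0<..}|lborel. h u)) halfline_ends"
  proof (rule tendsto_halfline_ends_cong)
    fix x y :: real assume xy: "0 < x" "x \<le> 1" "1 \<le> y"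
    have "set_integrable lborel {S x..S y} h"
      by (rule set_integrable_subset[OF h]) (use S_pos[of x] xy in auto)
    then show "(LINT u:{S x..S y}|lborel. h u) = frac_integral v J F x y"
      using xy F[of x y] by (simp add: set_borel_integral_eq_integral(2))
  qed
qed

lemma mellin_rise:
  assumes f: "continuous_on {0<..} (\<lambda>z. f (v z))"
    and gc: "continuous_on {0<..} g" and g: "\<And>u. u > 0 \<Longrightarrow> g u = f (v (T u))"
    and gi: "weighted_integrable g (Re w)"
  shows "mellin v J f w = halfline_mellin g w"
proof -
  define m where "m = (\<lambda>u. complex_of_real (g u) * of_real u powr (w - 1))"
  have mi: "set_integrable lborel {0<..} m" unfolding m_def by (rule mellin_set_integrable[OF gc gi])
  have mc: "continuous_on {x..y} (\<lambda>t. mellin_integrand J f w (v t))" if "0 < x" for x y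
  proof -
    have "continuous_on {0<..} S" using S_continuous by (rule continuous_on_subset) auto
    also have "?this \<longleftrightarrow> continuous_on {0<..} (\<lambda>t. J (v t))"
      by (rule continuous_on_cong) (use base in \<open>auto simp: J_v\<close>)
    finally have Jc: "continuous_on {0<..} (\<lambda>t. J (v t))" .
    have "continuous_on {0<..} (\<lambda>u. complex_of_real u powr (w - 1))"
      by (auto intro!: continuous_intros)
    then have "continuous_on {0<..} (\<lambda>t. complex_of_real (J (v t)) powr (w - 1))"
      by (rule continuous_on_compose2[OF _ Jc]) (use S_pos base in \<open>auto simp: J_v\<close>)
    then have "continuous_on {0<..} (\<lambda>t. mellin_integrand J f w (v t))"
      unfolding mellin_integrand_def by (rule continuous_on_mult[OF continuous_on_of_real[OF f]])
    then show ?thesis by (rule continuous_on_subset) (use that in auto)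
  qed
  have eq: "mellin_integrand J f w (v (T u)) = m u" if "u > 0" for u
    using that by (simp add: mellin_integrand_def m_def g J_T)
  have part: "frac_improper_integral v J (\<lambda>\<theta>. l (mellin_integrand J f w \<theta>)) 0 \<infinity> = l (LINT u:{0<..}|lborel. m u)"
    if l: "bounded_linear l" for l :: "complex \<Rightarrow> real"
  proof -
    have "set_integrable lborel {0<..} (\<lambda>u. l (m u))" "(LINT u:{0<..}|lborel. l (m u)) = l (LINT u:{0<..}|lborel. m u)"
      using integrable_bounded_linear[OF l mi[unfolded set_integrable_def]]
        integral_bounded_linear[OF l mi[unfolded set_integrable_def]] linear_simps(5)[OF l]
      by (simp_all add: set_integrable_def set_lebesgue_integral_def)
    then show ?thesis
    proof (subst frac_integral_improper[of "\<lambda>u. l (m u)"])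
      show "frac_integral v J (\<lambda>\<theta>. l (mellin_integrand J f w \<theta>)) x y = integral {S x..S y} (\<lambda>u. l (m u))"
        if "0 < x" "x \<le> y" for x y
        using that S_pos[of x] eq
        by (subst lower_frac_integral_continuous)
           (auto intro!: bounded_linear.continuous_on[OF l] mc Henstock_Kurzweil_Integration.integral_cong)
    qed
  qed
  show ?thesis
    by (simp add: mellin_def halfline_mellin_def part bounded_linear_Re bounded_linear_Im flip: m_def)
qed

lemma strip_weighted_integrable:
  assumes f: "continuous_on {0..} (\<lambda>z. f (v z))" and strip: "mellin_strip v J f \<sigma>1 \<sigma>2"
    and x: "\<sigma>1 \<le> x" "x \<le> \<sigma>2"
  shows "weighted_integrable (rise_pullback f) x"
proof (rule weighted_integrable_strip[OF continuous_on_rise_pullback[OF f] _ _ _ x])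
  define h where "h \<sigma> u = \<bar>rise_pullback f u\<bar> * u powr (\<sigma> - 1)" for \<sigma> u
  have gc: "isCont (rise_pullback f) u" for u
    using continuous_on_rise_pullback[OF f] by (simp add: continuous_on_eq_continuous_at)
  have hc: "isCont (h \<sigma>) u" if "u > 0" for \<sigma> u
    unfolding h_def using that gc by (auto intro!: continuous_intros)
  have h0: "0 \<le> h \<sigma> u" for \<sigma> u by (simp add: h_def)
  have h: "\<bar>f (v (T u))\<bar> * J (v (T u)) powr (\<sigma> - 1) = h \<sigma> u" if "u > 0" for \<sigma> u
    using that by (simp add: h_def rise_pullback_eq J_T)
  show S1: "S 1 > 0" by (rule S_pos) simp
  have "set_integrable lborel (einterval (ereal 0) (ereal (S 1))) (h \<sigma>1)"
  proof (rule nonneg_improper_set_integrable)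
    let ?F = "\<lambda>\<theta>. \<bar>f \<theta>\<bar> * J \<theta> powr (\<sigma>1 - 1)"
    have "frac_improper_integrable v J ?F 0 (ereal 1)" using strip by (simp add: mellin_strip_def one_ereal_def)
    from pullback_limit_left[OF order_refl zero_less_one this, of "h \<sigma>1"]
    show "((\<lambda>(r, R). integral {r..R} (h \<sigma>1)) \<longlongrightarrow> frac_improper_integral v J ?F 0 (ereal 1))
       (filtercomap ereal (at_right (ereal 0)) \<times>\<^sub>F filtercomap ereal (at_left (ereal (S 1))))"
      unfolding at_right_ereal at_left_ereal filtercomap_ereal_filtermap S_0 using h by simp
  qed (use S1 hc h0 in auto)
  then show "set_integrable lborel {0<..<S 1} (\<lambda>u. \<bar>rise_pullback f u\<bar> * u powr (\<sigma>1 - 1))"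
    by (simp add: einterval_eq h_def[abs_def])
  have "set_integrable lborel (einterval (ereal (S 1)) \<infinity>) (h \<sigma>2)"
  proof (rule nonneg_improper_set_integrable)
    let ?F = "\<lambda>\<theta>. \<bar>f \<theta>\<bar> * J \<theta> powr (\<sigma>2 - 1)"
    have "frac_improper_integrable v J ?F 1 \<infinity>" using strip by (simp add: mellin_strip_def)
    from pullback_limit_infinity[OF zero_le_one this, of "h \<sigma>2"]
    show "((\<lambda>(r, R). integral {r..R} (h \<sigma>2)) \<longlongrightarrow> frac_improper_integral v J ?F 1 \<infinity>)
       (filtercomap ereal (at_right (ereal (S 1))) \<times>\<^sub>F filtercomap ereal (at_left \<infinity>))"
      unfolding at_right_ereal at_left_PInf filtercomap_ereal_filtermap using h S1 by simp
  qed (use S1 hc h0 in auto)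
  then show "set_integrable lborel {S 1<..} (\<lambda>u. \<bar>rise_pullback f u\<bar> * u powr (\<sigma>2 - 1))"
    by (simp add: einterval_eq h_def[abs_def])
qed

end

context fractal_halfline
begin

lemma RL_integral_limit:
  assumes z: "z > 0" and int: "frac_improper_integrable v J (RL_integrand J n \<beta> f (v z)) 0 (ereal z)"
  shows "((\<lambda>(r, R). integral {r..R} (\<lambda>\<tau>. rise_pullback f \<tau> * (S z - \<tau>) powr (real n - \<beta> - 1)))
     \<longlongrightarrow> RL_integral v a0 J n \<beta> f (v z)) (at_right 0 \<times>\<^sub>F at_left (S z))"
proof -
  have "RL_integrand J n \<beta> f (v z) (v (T \<tau>)) = rise_pullback f \<tau> * (S z - \<tau>) powr (real n - \<beta> - 1)"
    if "\<tau> > S 0" for \<tau>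
  proof -
    have "\<tau> > 0" using that by (simp add: S_0)
    moreover have "real n - \<beta> - 1 = - (- real n + \<beta> + 1)" by simp
    ultimately show ?thesis
      using z base by (simp only: RL_integrand_def rise_pullback_eq[OF less_imp_le] J_T[OF less_imp_le] J_v powr_minus divide_inverse)
  qed
  from pullback_limit_left[OF order_refl z int this] show ?thesis
    using z base by (simp add: RL_integral_def curve_param_v S_0)
qed

lemma RL_integral_riesz:
  assumes f: "continuous_on {0..} (\<lambda>z. f (v z))" and z: "z > 0" and \<gamma>: "real n - \<beta> > 0"
    and int: "frac_improper_integrable v J (RL_integrand J n \<beta> f (v z)) 0 (ereal z)"
  shows "RL_integral v a0 J n \<beta> f (v z) = riesz (real n - \<beta>) (rise_pullback f) (S z)"
proof -
  let ?k = "\<lambda>\<tau>. rise_pullback f \<tau> * (S z - \<tau>) powr (real n - \<beta> - 1)"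
  have Sz: "S z > 0" by (rule S_pos[OF z])
  have K: "(?k has_integral riesz (real n - \<beta>) (rise_pullback f) (S z)) {0..S z}"
    by (rule riesz_has_integral[OF \<gamma> continuous_on_rise_pullback[OF f] Sz])
  define I where "I = (\<lambda>x. integral {0..x} ?k)"
  have Ic: "continuous_on {0..S z} I"
    unfolding I_def using K by (intro indefinite_integral_continuous_1) auto
  have "(I \<longlongrightarrow> I 0) (at 0 within {0..S z})" using Ic Sz by (simp add: continuous_on_def)
  then have I0: "(I \<longlongrightarrow> 0) (at_right 0)"
    using Sz by (simp add: at_within_Icc_at_right I_def)
  have "(I \<longlongrightarrow> I (S z)) (at (S z) within {0..S z})" using Ic Sz by (simp add: continuous_on_def)
  then have I1: "(I \<longlongrightarrow> I (S z)) (at_left (S z))"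
    using Sz by (simp add: at_within_Icc_at_left)
  have "((\<lambda>x. I (snd x) - I (fst x)) \<longlongrightarrow> I (S z) - 0) (at_right 0 \<times>\<^sub>F at_left (S z))"
    by (intro tendsto_diff filterlim_compose[OF I1 filterlim_snd] filterlim_compose[OF I0 filterlim_fst])
  moreover have "eventually (\<lambda>x. I (snd x) - I (fst x) = (case x of (r, R) \<Rightarrow> integral {r..R} ?k)) (at_right 0 \<times>\<^sub>F at_left (S z))"
    unfolding eventually_prod_filter
  proof (intro exI conjI allI impI)
    show "eventually (\<lambda>r. 0 < r \<and> r < S z / 2) (at_right (0::real))" using Sz by (auto simp: eventually_at_right_field intro!: exI[of _ "S z / 2"])
    show "eventually (\<lambda>R. S z / 2 < R \<and> R < S z) (at_left (S z))" using Sz by (auto simp: eventually_at_left_field intro!: exI[of _ "S z / 2"])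
    fix r R :: real assume rR: "0 < r \<and> r < S z / 2" "S z / 2 < R \<and> R < S z"
    have "?k integrable_on {0..R}"
      by (rule integrable_on_subinterval[OF has_integral_integrable[OF K]]) (use rR in auto)
    then have "integral {0..r} ?k + integral {r..R} ?k = integral {0..R} ?k"
      using rR by (intro Henstock_Kurzweil_Integration.integral_combine) auto
    then show "I (snd (r, R)) - I (fst (r, R)) = (case (r, R) of (r, R) \<Rightarrow> integral {r..R} ?k)"
      by (simp add: I_def)
  qed
  ultimately have "((\<lambda>(r, R). integral {r..R} ?k) \<longlongrightarrow> I (S z) - 0) (at_right 0 \<times>\<^sub>F at_left (S z))"
    by (rule Lim_transform_eventually)
  moreover have "at_right (0::real) \<times>\<^sub>F at_left (S z) \<noteq> bot" by (simp add: prod_filter_eq_bot)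
  ultimately have "RL_integral v a0 J n \<beta> f (v z) = I (S z)"
    using tendsto_unique RL_integral_limit[OF z int] by force
  then show ?thesis using K by (simp add: I_def integral_unique)
qed

abbreviation RL_iterate :: "nat \<Rightarrow> real \<Rightarrow> ('a \<Rightarrow> real) \<Rightarrow> nat \<Rightarrow> 'a \<Rightarrow> real" where
  "RL_iterate n \<beta> f k \<equiv> (frac_deriv (curve_points v a0) J ^^ k) (RL_integral v a0 J n \<beta> f)"

lemma frac_deriv_iterate:
  assumes "RL_differentiable v a0 J n \<beta> f" "k < n" "u > 0"
  shows "((\<lambda>x. RL_iterate n \<beta> f k (v (T x))) has_real_derivative
     RL_iterate n \<beta> f (Suc k) (v (T u))) (at u)"
proof -
  have "frac_differentiable_at (curve_points v a0) J (RL_iterate n \<beta> f k) (v (T u))"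
    using assms T_pos[of u] by (simp add: RL_differentiable_def)
  from frac_deriv_rise[OF this \<open>u > 0\<close>] show ?thesis by simp
qed

lemma mellin_zero:
  assumes "\<And>z. z > 0 \<Longrightarrow> f (v z) = 0"
  shows "mellin v J f w = 0"
proof -
  have "mellin v J f w = halfline_mellin (\<lambda>_. 0) w"
  proof (rule mellin_rise)
    have "continuous_on {0<..} (\<lambda>z. f (v z)) \<longleftrightarrow> continuous_on {0::real<..} (\<lambda>z. 0::real)"
      by (rule continuous_on_cong) (use assms in auto)
    then show "continuous_on {0<..} (\<lambda>z. f (v z))" by simp
  qed (use assms T_pos in \<open>auto simp: weighted_integrable_def set_integrable_def\<close>)
  then show ?thesis by (simp add: halfline_mellin_def set_lebesgue_integral_def)
qed

text \<open>For \<open>\<alpha> > 1\<close> the condition \<open>\<beta> < n \<alpha>\<close> allows \<open>\<beta> \<ge> n\<close>. The kernel of the Riemann-Liouville integral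
  is then not integrable, convergence at every point forces \<open>f\<close> to vanish on the section from \<open>0\<close>, and
  both transforms are zero.\<close>
lemma mellin_RL_deriv_singular:
  assumes f: "continuous_on {0..} (\<lambda>z. f (v z))" and RL: "RL_differentiable v a0 J n \<beta> f"
    and \<beta>: "real n \<le> \<beta>"
  shows "mellin v J (RL_deriv v a0 J n \<beta> f) s = 0" "mellin v J f w = 0"
proof -
  have lim: "((\<lambda>(r, R). integral {r..R} (\<lambda>\<tau>. rise_pullback f \<tau> * (S z - \<tau>) powr (real n - \<beta> - 1)))
     \<longlongrightarrow> RL_integral v a0 J n \<beta> f (v z)) (at_right 0 \<times>\<^sub>F at_left (S z))" if "z > 0" for z
    using RL that by (intro RL_integral_limit) (auto simp: RL_differentiable_def)
  have g0: "rise_pullback f u = 0" if "u > 0" for u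
    using divergent_kernel_vanishing[OF continuous_on_rise_pullback[OF f] _ that, of "real n - \<beta> - 1"] lim[of "T u"] T_pos[OF that] \<beta> that
    by (auto simp: S_T)
  have f0: "f (v z) = 0" if "z > 0" for z
    using g0[OF S_pos[OF that]] S_pos[OF that] that by (simp add: rise_pullback_eq T_S)
  show "mellin v J f w = 0" by (rule mellin_zero) (rule f0)
  define D where "D = (\<lambda>k u. RL_iterate n \<beta> f k (v (T u)))"
  have D0: "D 0 u = 0" if "u > 0" for u
  proof -
    have z: "T u > 0" "S (T u) = u" using T_pos[OF that] S_T that by auto
    have "eventually (\<lambda>x. (case x of (r, R) \<Rightarrow> integral {r..R} (\<lambda>\<tau>. rise_pullback f \<tau> * (u - \<tau>) powr (real n - \<beta> - 1))) = 0) (at_right 0 \<times>\<^sub>F at_left u)"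
      unfolding eventually_prod_filter
    proof (intro exI conjI allI impI)
      show "eventually (\<lambda>r. 0 < r) (at_right (0::real))" by (auto simp: eventually_at_right_field intro: exI[of _ 1])
      show "eventually (\<lambda>_. True) (at_left u)" by simp
      fix r R :: real assume "0 < r"
      then have "integral {r..R} (\<lambda>\<tau>. rise_pullback f \<tau> * (u - \<tau>) powr (real n - \<beta> - 1)) = integral {r..R} (\<lambda>_. 0)"
        by (intro Henstock_Kurzweil_Integration.integral_cong) (simp add: g0)
      then show "(case (r, R) of (r, R) \<Rightarrow> integral {r..R} (\<lambda>\<tau>. rise_pullback f \<tau> * (u - \<tau>) powr (real n - \<beta> - 1))) = 0" by simp
    qed
    from Lim_transform_eventually[OF lim[OF z(1), unfolded z(2)] this]
    have "((\<lambda>x. 0::real) \<longlongrightarrow> RL_integral v a0 J n \<beta> f (v (T u))) (at_right (0::real) \<times>\<^sub>F at_left u)" .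
    moreover have "at_right (0::real) \<times>\<^sub>F at_left u \<noteq> bot" by (simp add: prod_filter_eq_bot)
    ultimately show ?thesis by (simp add: D_def tendsto_const_iff)
  qed
  have "\<forall>u>0. D k u = 0" if "k \<le> n" for k
    using that
  proof (induction k)
    case (Suc k)
    show ?case
    proof (intro allI impI)
      fix u :: real assume u: "u > 0"
      have "(D k has_real_derivative D (Suc k) u) (at u)"
        unfolding D_def using Suc.prems by (intro frac_deriv_iterate[OF RL _ u]) simp
      moreover have "((\<lambda>_. 0) has_real_derivative 0) (at u)" by simp
      then have "(D k has_real_derivative 0) (at u)"
        by (rule has_field_derivative_transform_within_open[where S="{0<..}"]) (use u Suc in auto)
      ultimately show "D (Suc k) u = 0" by (rule DERIV_unique)
    qed
  qed (use D0 in simp)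
  then have "RL_deriv v a0 J n \<beta> f (v z) = 0" if "z > 0" for z
    using S_pos[OF that] that by (simp add: RL_deriv_def D_def) (metis T_S less_imp_le order_refl)
  then show "mellin v J (RL_deriv v a0 J n \<beta> f) s = 0" by (rule mellin_zero)
qed

text \<open>The case of a convergent kernel: the definitions along the curve are translated into \<open>RL_data\<close> for
  the pullback of \<open>f\<close>. The factor \<open>\<Gamma>(n - \<beta>)\<close> of the half-line identity is cancelled by the
  normalization of the Riemann-Liouville derivative.\<close>
lemma mellin_RL_deriv_regular:
  assumes f: "continuous_on {0..} (\<lambda>z. f (v z))" and RL: "RL_differentiable v a0 J n \<beta> f"
    and \<beta>: "\<beta> < real n"
    and strip: "mellin_strip v J f \<sigma>1 \<sigma>2" "\<sigma>1 < Re s - \<beta>" "Re s - \<beta> < \<sigma>2"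
    and convergent: "mellin_convergent v J (RL_deriv v a0 J n \<beta> f) s"
    and no_pole: "1 - s + complex_of_real \<beta> \<notin> \<int>\<^sub>\<le>\<^sub>0"
  shows "mellin v J (RL_deriv v a0 J n \<beta> f) s =
           Gamma (1 - s + complex_of_real \<beta>) / Gamma (1 - s) * mellin v J f (s - complex_of_real \<beta>)"
proof -
  define \<gamma> where "\<gamma> = real n - \<beta>"
  define w where "w = s - complex_of_real \<beta>"
  define g where "g = rise_pullback f"
  define D where "D = (\<lambda>k u. RL_iterate n \<beta> f k (v (T u)))"
  have \<gamma>: "\<gamma> > 0" using \<beta> by (simp add: \<gamma>_def)
  have gc: "continuous_on UNIV g" unfolding g_def by (rule continuous_on_rise_pullback[OF f])
  have gi: "weighted_integrable g (Re w)" "weighted_integrable g \<sigma>2" "\<sigma>2 > Re w"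
    unfolding g_def w_def using strip by (auto intro!: strip_weighted_integrable[OF f strip(1)])
  then have adm: "admissible g (Re w)" using gc by (auto simp: admissible_def)
  have D0: "D 0 u = riesz \<gamma> g u" if "u > 0" for u
    using RL_integral_riesz[OF f T_pos[OF that], of n \<beta>] RL T_pos[OF that] \<beta> that
    by (simp add: D_def \<gamma>_def g_def RL_differentiable_def S_T)
  have D: "(D k has_real_derivative D (Suc k) u) (at u)" if "k < n" "u > 0" for k u
    unfolding D_def by (rule frac_deriv_iterate[OF RL that])
  have "continuous_on {0<..} (D 0) \<longleftrightarrow> continuous_on {0<..} (riesz \<gamma> g)"
    by (rule continuous_on_cong) (auto simp: D0)
  then have "continuous_on {0<..} (D 0)" using continuous_on_riesz[OF \<gamma> gc] by simp
  then obtain H where H: "\<And>u. u > 0 \<Longrightarrow> (H has_vector_derivative of_real (D n u) * of_real u powr (s - 1)) (at u)"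
    by (rule weighted_primitive_exists[of D n s]) (use D in auto)
  define h where "h = RL_deriv v a0 J n \<beta> f"
  define M where "M = mellin v J h s"
  define m where "m u = of_real (1 / Gamma \<gamma>) * (of_real (D n u) * of_real u powr (s - 1))" for u
  have \<Gamma>: "Gamma \<gamma> > 0" by (rule Gamma_real_pos[OF \<gamma>])
  have hm: "mellin_integrand J h s (v (T u)) = m u" if "u > S 0" for u
    using that by (simp add: S_0 mellin_integrand_def h_def RL_deriv_def D_def m_def \<gamma>_def J_T)
  have m: "(m has_integral (H R - H r) / of_real (Gamma \<gamma>)) {r..R}" if "0 < r" "r \<le> R" for r R
  proof -
    have "((\<lambda>u. of_real (D n u) * of_real u powr (s - 1)) has_integral (H R - H r)) {r..R}"
      by (rule fundamental_theorem_of_calculus) (use that H in \<open>auto intro: has_vector_derivative_at_within\<close>)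
    from has_integral_mult_right[OF this, of "of_real (1 / Gamma \<gamma>)"] show ?thesis by (simp add: m_def[abs_def])
  qed
  have part: "((\<lambda>(r, R). l ((H R - H r) / of_real (Gamma \<gamma>))) \<longlongrightarrow>
      frac_improper_integral v J (\<lambda>\<theta>. l (mellin_integrand J h s \<theta>)) 0 \<infinity>) halfline_ends"
    if l: "bounded_linear l" and int: "frac_improper_integrable v J (\<lambda>\<theta>. l (mellin_integrand J h s \<theta>)) 0 \<infinity>"
    for l :: "complex \<Rightarrow> real"
  proof (rule tendsto_halfline_ends_cong)
    show "((\<lambda>x. integral {fst x..snd x} (\<lambda>u. l (m u))) \<longlongrightarrow>
        frac_improper_integral v J (\<lambda>\<theta>. l (mellin_integrand J h s \<theta>)) 0 \<infinity>) halfline_ends"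
      using pullback_limit_infinity[OF order_refl int, of "\<lambda>u. l (m u)"] hm by (simp add: S_0 case_prod_unfold)
    show "integral {r..R} (\<lambda>u. l (m u)) = l ((H R - H r) / of_real (Gamma \<gamma>))" if "0 < r" "r \<le> 1" "1 \<le> R" for r R
      using has_integral_linear[OF m l, of r R] that by (auto simp: o_def intro!: integral_unique)
  qed
  have "((\<lambda>(r, R). Re ((H R - H r) / of_real (Gamma \<gamma>))) \<longlongrightarrow> Re M) halfline_ends"
    "((\<lambda>(r, R). Im ((H R - H r) / of_real (Gamma \<gamma>))) \<longlongrightarrow> Im M) halfline_ends"
    using part[OF bounded_linear_Re] part[OF bounded_linear_Im] convergent
    by (simp_all add: M_def mellin_def mellin_convergent_def h_def)
  then have "((\<lambda>(r, R). (H R - H r) / of_real (Gamma \<gamma>)) \<longlongrightarrow> M) halfline_ends"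
    unfolding tendsto_complex_iff by (simp add: case_prod_unfold)
  from tendsto_mult_left[OF this, of "of_real (Gamma \<gamma>)"]
  have L: "((\<lambda>(r, R). H R - H r) \<longlongrightarrow> of_real (Gamma \<gamma>) * M) halfline_ends"
    using \<Gamma> by (simp add: case_prod_unfold)
  have "RL_data \<gamma> g n s D H (of_real (Gamma \<gamma>) * M)"
    unfolding RL_data_def using D0 D H L by blast
  moreover have "w = s - of_nat n + of_real \<gamma>" by (simp add: w_def \<gamma>_def)
  moreover have "1 - w \<notin> \<int>\<^sub>\<le>\<^sub>0" using no_pole by (simp add: w_def algebra_simps)
  ultimately have "of_real (Gamma \<gamma>) * M = Gamma (of_real \<gamma>) * Gamma (1 - w) * rGamma (1 - s) * halfline_mellin g w"
    by (intro riesz_derivative_mellin[OF \<gamma> adm])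
  moreover have "Gamma (complex_of_real \<gamma>) = of_real (Gamma \<gamma>)" by (simp add: Gamma_complex_of_real)
  moreover have "Gamma \<gamma> \<noteq> 0" using \<Gamma> by simp
  ultimately have "M = Gamma (1 - w) * rGamma (1 - s) * halfline_mellin g w" by simp
  also have "halfline_mellin g w = mellin v J f w"
    by (rule mellin_rise[symmetric])
       (use f gc gi in \<open>auto simp: g_def rise_pullback_eq intro: continuous_on_subset\<close>)
  finally show ?thesis
    by (simp add: M_def h_def w_def rGamma_inverse_Gamma divide_inverse algebra_simps)
qed

end

theorem theorem4:
  fixes v :: "real \<Rightarrow> 'a::euclidean_space"
    and a0 \<alpha> q0 \<beta> \<sigma>1 \<sigma>2 :: real
    and J f :: "'a \<Rightarrow> real"
    and n :: nat
    and s :: complex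
  assumes curve: "fractal_curve v a0 \<alpha> q0"
    and J: "J = rise_pt v a0 \<alpha> q0"
    and base: "a0 \<le> 0" "J (v 0) = 0"
    and unbounded: "filterlim (rise_fun v \<alpha> q0) at_top at_top"
    and order: "real n * \<alpha> - \<alpha> \<le> \<beta>" "\<beta> < real n * \<alpha>"
    and smooth: "f \<in> frac_C (curve_points v a0) J n"
    and RL: "RL_differentiable v a0 J n \<beta> f"
    and strip: "mellin_strip v J f \<sigma>1 \<sigma>2" "\<sigma>1 < Re s - \<beta>" "Re s - \<beta> < \<sigma>2"
    and convergent: "mellin_convergent v J (RL_deriv v a0 J n \<beta> f) s"
    and no_pole: "1 - s + complex_of_real \<beta> \<notin> \<int>\<^sub>\<le>\<^sub>0"
  shows "mellin v J (RL_deriv v a0 J n \<beta> f) s =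
           Gamma (1 - s + complex_of_real \<beta>) / Gamma (1 - s) * mellin v J f (s - complex_of_real \<beta>)"
proof -
  interpret fractal_halfline v a0 \<alpha> q0 J
    by unfold_locales (fact curve J base unbounded)+
  have f: "continuous_on {0..} (\<lambda>z. f (v z))" by (rule frac_C_continuous[OF smooth])
  show ?thesis
  proof (cases "\<beta> < real n")
    case True
    then show ?thesis by (rule mellin_RL_deriv_regular[OF f RL _ strip convergent no_pole])
  next
    case False
    then show ?thesis using mellin_RL_deriv_singular[OF f RL] by simp
  qed
qed

end
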